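(* Let $\mathbb{F}_q$ be a finite field of size $q = O(1)$, let $n$ be a positive integer, and let $N = 2^n$. There is an algorithm which, given as input a vector $v \in \mathbb{F}_q^N$, computes the length-$N$ Walsh-Hadamard transform $H_N v$ over $\mathbb{F}_q$ using $O\left(\frac{N \log N}{\log \log N}\right)$ bit operations.
   Context: $\log$ denotes the base-$2$ logarithm. For matrices $A \in \mathbb{F}^{N\times N}$, $B \in \mathbb{F}^{M \times M}$, the Kronecker product $A \otimes B \in \mathbb{F}^{NM \times NM}$ is the block matrix whose $(a,b)$ block (for $a,b \in \{1,\dots,M\}$) is $B[a,b]\cdot A$; $A^{\otimes n}$ denotes the Kronecker product of $n$ copies of $A$. For $N$ a power of $2$, the Walsh-Hadamard matrix is $H_N = H_2^{\otimes \log N}$ where $H_2 = \begin{bmatrix} 1 & 1 \\ 1 & -1\end{bmatrix}$ (equivalently $H_N = \begin{bmatrix} H_{N/2} & H_{N/2} \\ H_{N/2} & -H_{N/2}\end{bmatrix}$). The cost measure is bit complexity: the number of operations on bits performed by a RAM algorithm (in particular, an algorithm may build and use lookup tables, where a lookup table with $b$-bit keys and values supports lookups and updates in $O(b)$ bit operations). The constant in the $O(\cdot)$ may depend on $q$. *)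

theory Defs
  imports
    "Jordan_Normal_Form.Matrix"
    "HOL-Library.Log_Nat"
    "HOL-Library.Landau_Symbols"
begin

section \<open>Kronecker powers and the Walsh-Hadamard matrix\<close>

text \<open>The outer block structure comes from the second factor: block \<open>(a,b)\<close> is \<open>B[a,b] \<cdot> A\<close>.\<close>

definition kronecker :: "'a::times mat \<Rightarrow> 'a mat \<Rightarrow> 'a mat" where
  "kronecker A B =
     mat (dim_row A * dim_row B) (dim_col A * dim_col B)
       (\<lambda>(i, j). B $$ (i div dim_row A, j div dim_col A) * A $$ (i mod dim_row A, j mod dim_col A))"

fun kronecker_power :: "'a::semiring_1 mat \<Rightarrow> nat \<Rightarrow> 'a mat" where
  "kronecker_power A 0 = 1\<^sub>m 1"
| "kronecker_power A (Suc n) = kronecker (kronecker_power A n) A"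

definition hadamard2 :: "'a::ring_1 mat" where
  "hadamard2 = mat_of_rows_list 2 [[1, 1], [1, - 1]]"

text \<open>The index is the exponent: \<open>walsh_hadamard n\<close> has dimension \<open>2 ^ n\<close>.\<close>

definition walsh_hadamard :: "nat \<Rightarrow> 'a::ring_1 mat" where
  "walsh_hadamard n = kronecker_power hadamard2 n"


section \<open>A random access machine with bit cost\<close>

text \<open>
  A machine has registers holding natural numbers and bit-addressable arrays. A program is a fixed
  piece of syntax, so it mentions only finitely many registers and arrays. Every step is charged
  one unit plus the number of bits it handles. In particular an array access is charged for the
  length of the address as well as for every bit transferred, so that a lookup or an update in a
  table with \<open>b\<close>-bit keys and values costs \<open>O(b)\<close>; there is no free address
  arithmetic. Addition, subtraction and shifts are charged linearly, and multiplication and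
  division at the cost of the schoolbook methods.
\<close>

type_synonym reg = nat
type_synonym arr = nat

datatype binop = Add | Sub | Mul | Div | Mod | Shl | Shr

datatype com =
    Const reg nat
  | Op binop reg reg reg    \<comment> \<open>operation, destination, two sources\<close>
  | Load reg arr reg reg    \<comment> \<open>destination, array, register with address, register with length\<close>
  | Store arr reg reg reg   \<comment> \<open>array, register with address, register with length, source\<close>
  | Seq com com
  | IfLess reg reg com com
  | WhileLess reg reg com

text \<open>The length of the binary representation; \<open>bits 0 = 0\<close>.\<close>

abbreviation bits :: "nat \<Rightarrow> nat" where
  "bits x \<equiv> floorlog 2 x"

fun op_val :: "binop \<Rightarrow> nat \<Rightarrow> nat \<Rightarrow> nat" where
  "op_val Add x y = x + y"
| "op_val Sub x y = x - y"
| "op_val Mul x y = x * y"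
| "op_val Div x y = x div y"
| "op_val Mod x y = x mod y"
| "op_val Shl x y = x * 2 ^ y"
| "op_val Shr x y = x div 2 ^ y"

fun op_cost :: "binop \<Rightarrow> nat \<Rightarrow> nat \<Rightarrow> nat" where
  "op_cost Add x y = 1 + bits x + bits y"
| "op_cost Sub x y = 1 + bits x + bits y"
| "op_cost Mul x y = (1 + bits x) * (1 + bits y)"
| "op_cost Div x y = (1 + bits x) * (1 + bits y)"
| "op_cost Mod x y = (1 + bits x) * (1 + bits y)"
| "op_cost Shl x y = 1 + bits x + bits y + y"
| "op_cost Shr x y = 1 + bits x + bits y"

type_synonym memory = "arr \<Rightarrow> nat \<Rightarrow> bool"
type_synonym state = "(reg \<Rightarrow> nat) \<times> memory"

definition read_field :: "(nat \<Rightarrow> bool) \<Rightarrow> nat \<Rightarrow> nat \<Rightarrow> nat" where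
  "read_field m a l = (\<Sum>j<l. of_bool (m (a + j)) * 2 ^ j)"

definition write_field :: "(nat \<Rightarrow> bool) \<Rightarrow> nat \<Rightarrow> nat \<Rightarrow> nat \<Rightarrow> (nat \<Rightarrow> bool)" where
  "write_field m a l x = (\<lambda>p. if a \<le> p \<and> p < a + l then bit x (p - a) else m p)"

text \<open>\<open>exec c s t s'\<close>: started in state \<open>s\<close>, the program \<open>c\<close> halts in state \<open>s'\<close>
  after exactly \<open>t\<close> bit operations.\<close>

inductive exec :: "com \<Rightarrow> state \<Rightarrow> nat \<Rightarrow> state \<Rightarrow> bool" where
  Const: "exec (Const d k) (R, M) (1 + bits k) (R(d := k), M)"
| Op: "exec (Op f d x y) (R, M) (op_cost f (R x) (R y)) (R(d := op_val f (R x) (R y)), M)"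
| Load: "exec (Load d A a l) (R, M) (1 + bits (R a) + bits (R l) + R l)
           (R(d := read_field (M A) (R a) (R l)), M)"
| Store: "exec (Store A a l x) (R, M) (1 + bits (R a) + bits (R l) + bits (R x) + R l)
            (R, M(A := write_field (M A) (R a) (R l) (R x)))"
| Seq: "exec c1 s1 t1 s2 \<Longrightarrow> exec c2 s2 t2 s3 \<Longrightarrow> exec (Seq c1 c2) s1 (t1 + t2) s3"
| IfTrue: "R x < R y \<Longrightarrow> exec c1 (R, M) t s \<Longrightarrow>
             exec (IfLess x y c1 c2) (R, M) (1 + bits (R x) + bits (R y) + t) s"
| IfFalse: "\<not> R x < R y \<Longrightarrow> exec c2 (R, M) t s \<Longrightarrow>
             exec (IfLess x y c1 c2) (R, M) (1 + bits (R x) + bits (R y) + t) s"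
| WhileFalse: "\<not> R x < R y \<Longrightarrow>
             exec (WhileLess x y c) (R, M) (1 + bits (R x) + bits (R y)) (R, M)"
| WhileTrue: "R x < R y \<Longrightarrow> exec c (R, M) t1 s2 \<Longrightarrow> exec (WhileLess x y c) s2 t2 s3 \<Longrightarrow>
             exec (WhileLess x y c) (R, M) (1 + bits (R x) + bits (R y) + t1 + t2) s3"


section \<open>Input and output of vectors\<close>

text \<open>
  Each entry is written with \<open>w\<close> bits (least significant first) under an encoding
  \<open>enc\<close> of the field elements, and the entries are packed consecutively.
  Input is in array 0, with the exponent \<open>n\<close> in register 0, everything else being zero;
  output is in array 1.
\<close>

definition input_state :: "('a \<Rightarrow> nat) \<Rightarrow> nat \<Rightarrow> nat \<Rightarrow> 'a vec \<Rightarrow> state" where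
  "input_state enc w n v =
     ((\<lambda>r. if r = 0 then n else 0),
      (\<lambda>A p. A = 0 \<and> p < dim_vec v * w \<and> bit (enc (v $ (p div w))) (p mod w)))"

definition outputs :: "('a \<Rightarrow> nat) \<Rightarrow> nat \<Rightarrow> state \<Rightarrow> 'a vec \<Rightarrow> bool" where
  "outputs enc w s u \<longleftrightarrow>
     (\<forall>i < dim_vec u. \<forall>j < w. snd s 1 (i * w + j) \<longleftrightarrow> bit (enc (u $ i)) j)"

end

theory Submission
  imports Defs "HOL-Real_Asymp.Real_Asymp"
begin

text \<open>
  The transform is a product of \<open>n\<close> commuting butterfly levels, one per bit of the index. With
  \<open>j\<close> about \<open>(log n) / 2\<close>, a word of \<open>4 ^ j\<close> packed entries has at most \<open>n / 2\<close> bits, so a table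
  holding the result of \<open>j\<close> levels for every word has only \<open>2 ^ (n / 2)\<close> slots and can be filled
  naively. One lookup then performs \<open>j\<close> levels on \<open>4 ^ j\<close> entries in time linear in the word
  length, so the whole vector passes \<open>j\<close> levels in \<open>O(2 ^ n)\<close> bit operations, and there are about
  \<open>n / j\<close> such passes.

  The entries to be combined are far apart, and reaching an entry of the main array costs \<open>n\<close>
  operations. Hence whole words are fetched, \<open>2 ^ j\<close> of them at the distance of the current levels,
  into a scratch array of polylogarithmic address length; there, pieces of \<open>2 ^ j\<close> entries (which
  are as long as their addresses, so that moving them costs linear time) are regrouped into table keys.
  The lowest \<open>2 j + ((n - 2 j) mod j)\<close> levels act within blocks that fit into the scratch array,
  and \<open>O(log n)\<close> levels may be computed there one at a time.
\<close>

section \<open>Total correctness with cost\<close>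

text \<open>One regrouping principle is applied twice. Gathering at distance \<open>2 ^ p\<close>
  turns the levels from \<open>p\<close> on of the main array into the levels from
  \<open>2 * j\<close> on of a scratch array of \<open>8 ^ j\<close> entries; a second gathering
  turns these into the levels from \<open>j\<close> on of a single key. This is why the table
  performs levels \<open>j\<close> to \<open>2 * j - 1\<close> of a word of \<open>4 ^ j\<close>
  entries, and why a level below \<open>2 * j\<close> cannot be reached by a pass. Levels computed
  one at a time cost \<open>O(j ^ 3)\<close> per entry, which is affordable only because
  \<open>j ^ 4 = O(n)\<close>. The encoding need not be onto, so some table keys and memory contents
  code no vector. Hence every cost bound is proved for arbitrary contents, and correctness is a
  conditional statement about those contents that are codes. Field arithmetic is hidden in one
  numeral constant, so that nothing is assumed about the encoding beyond injectivity and width. One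
  program serves all \<open>n\<close>; therefore \<open>j\<close> is computed at run time.\<close>

definition wp :: "com \<Rightarrow> (nat \<Rightarrow> state \<Rightarrow> bool) \<Rightarrow> state \<Rightarrow> bool" where
  "wp c Q s \<longleftrightarrow> (\<exists>t s'. exec c s t s' \<and> Q t s')"

inductive_cases exec_ConstE: "exec (Const d k) s t s'"
inductive_cases exec_OpE: "exec (Op f d x y) s t s'"
inductive_cases exec_LoadE: "exec (Load d A a l) s t s'"
inductive_cases exec_StoreE: "exec (Store A a l x) s t s'"
inductive_cases exec_SeqE: "exec (Seq c1 c2) s t s'"

text \<open>Determinism of the primitive commands turns the existential \<open>wp\<close> into an
  equation, so that straight-line code can be executed by rewriting.\<close>

lemma wp_eqI:
  "exec c s t s' \<Longrightarrow> (\<And>t2 s2. exec c s t2 s2 \<Longrightarrow> t2 = t \<and> s2 = s') \<Longrightarrow> wp c Q s = Q t s'"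
  unfolding wp_def by blast

lemma wp_Const: "wp (Const d k) Q s = Q (1 + bits k) ((fst s)(d := k), snd s)"
  by (cases s) (simp only: fst_conv snd_conv, rule wp_eqI[OF exec.Const], erule exec_ConstE, simp)

lemma wp_Op: "wp (Op f d x y) Q s =
    Q (op_cost f (fst s x) (fst s y)) ((fst s)(d := op_val f (fst s x) (fst s y)), snd s)"
  by (cases s) (simp only: fst_conv snd_conv, rule wp_eqI[OF exec.Op], erule exec_OpE, simp)

lemma wp_Load: "wp (Load d A a l) Q s =
    Q (1 + bits (fst s a) + bits (fst s l) + fst s l)
      ((fst s)(d := read_field (snd s A) (fst s a) (fst s l)), snd s)"
  by (cases s) (simp only: fst_conv snd_conv, rule wp_eqI[OF exec.Load], erule exec_LoadE, simp)

lemma wp_Store: "wp (Store A a l x) Q s =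
    Q (1 + bits (fst s a) + bits (fst s l) + bits (fst s x) + fst s l)
      (fst s, (snd s)(A := write_field (snd s A) (fst s a) (fst s l) (fst s x)))"
  by (cases s) (simp only: fst_conv snd_conv, rule wp_eqI[OF exec.Store], erule exec_StoreE, simp)

lemma wp_Seq: "wp (Seq c1 c2) Q s = wp c1 (\<lambda>t1. wp c2 (\<lambda>t2. Q (t1 + t2))) s"
  unfolding wp_def by (blast elim: exec_SeqE intro: exec.Seq)

lemmas wp_simps = wp_Const wp_Op wp_Load wp_Store wp_Seq

lemmas step_simps = wp_simps fst_conv snd_conv fun_upd_apply op_val.simps rel_simps
  simp_thms if_True if_False

lemma wp_mono: "wp c Q s \<Longrightarrow> (\<And>t s'. Q t s' \<Longrightarrow> Q' t s') \<Longrightarrow> wp c Q' s"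
  unfolding wp_def by blast

text \<open>Abstracting the postcondition keeps the simplifier from working inside it while it
  executes a straight-line program.\<close>

lemma wp_abstract: "(\<And>Q. (\<And>t s'. P t s' \<Longrightarrow> Q t s') \<Longrightarrow> wp c Q s) \<Longrightarrow> wp c P s"
  by blast

lemma wp_SeqI:
  "wp c1 Q1 s \<Longrightarrow> (\<And>t s'. Q1 t s' \<Longrightarrow> wp c2 (\<lambda>t2. Q (t + t2)) s') \<Longrightarrow> wp (Seq c1 c2) Q s"
  unfolding wp_Seq by (erule wp_mono)

section \<open>Syntactic frame conditions\<close>

fun written_regs :: "com \<Rightarrow> reg set" where
  "written_regs (Const d k) = {d}"
| "written_regs (Op f d x y) = {d}"
| "written_regs (Load d A a l) = {d}"
| "written_regs (Store A a l x) = {}"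
| "written_regs (Seq c1 c2) = written_regs c1 \<union> written_regs c2"
| "written_regs (IfLess x y c1 c2) = written_regs c1 \<union> written_regs c2"
| "written_regs (WhileLess x y c) = written_regs c"

fun written_arrs :: "com \<Rightarrow> arr set" where
  "written_arrs (Const d k) = {}"
| "written_arrs (Op f d x y) = {}"
| "written_arrs (Load d A a l) = {}"
| "written_arrs (Store A a l x) = {A}"
| "written_arrs (Seq c1 c2) = written_arrs c1 \<union> written_arrs c2"
| "written_arrs (IfLess x y c1 c2) = written_arrs c1 \<union> written_arrs c2"
| "written_arrs (WhileLess x y c) = written_arrs c"

definition agree_off :: "com \<Rightarrow> state \<Rightarrow> state \<Rightarrow> bool" where
  "agree_off c s s' \<longleftrightarrow> (\<forall>r. r \<notin> written_regs c \<longrightarrow> fst s' r = fst s r) \<and>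
     (\<forall>A. A \<notin> written_arrs c \<longrightarrow> snd s' A = snd s A)"

lemma agree_off_refl [simp]: "agree_off c s s"
  by (simp add: agree_off_def)

lemma agree_off_trans: "agree_off c s s' \<Longrightarrow> agree_off c s' s'' \<Longrightarrow> agree_off c s s''"
  by (simp add: agree_off_def)

lemma agree_off_sub:
  "agree_off c s s' \<Longrightarrow> written_regs c \<subseteq> written_regs d \<Longrightarrow> written_arrs c \<subseteq> written_arrs d \<Longrightarrow>
     agree_off d s s'"
  by (auto simp: agree_off_def)

lemma agree_off_reg: "agree_off c s s' \<Longrightarrow> r \<notin> written_regs c \<Longrightarrow> fst s' r = fst s r"
  by (simp add: agree_off_def)

lemma agree_off_arr: "agree_off c s s' \<Longrightarrow> A \<notin> written_arrs c \<Longrightarrow> snd s' A = snd s A"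
  by (simp add: agree_off_def)

lemma exec_agree_off: "exec c s t s' \<Longrightarrow> agree_off c s s'"
  by (induction rule: exec.induct) (auto simp: agree_off_def)

lemma wp_frame: "wp c Q s \<Longrightarrow> wp c (\<lambda>t s'. Q t s' \<and> agree_off c s s') s"
  unfolding wp_def using exec_agree_off by blast

lemma wp_While:
  assumes init: "I 0 s"
    and test: "\<And>i s'. i < m \<Longrightarrow> I i s' \<Longrightarrow> agree_off c s s' \<Longrightarrow> fst s' x < fst s' y"
    and final: "\<And>s'. I m s' \<Longrightarrow> agree_off c s s' \<Longrightarrow> \<not> fst s' x < fst s' y"
    and test_cost: "\<And>i s'. i \<le> m \<Longrightarrow> I i s' \<Longrightarrow> agree_off c s s' \<Longrightarrow>
      1 + bits (fst s' x) + bits (fst s' y) \<le> C0"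
    and step: "\<And>i s'. i < m \<Longrightarrow> I i s' \<Longrightarrow> agree_off c s s' \<Longrightarrow>
      wp c (\<lambda>t s''. t \<le> C \<and> I (Suc i) s'') s'"
  shows "wp (WhileLess x y c) (\<lambda>t s'. t \<le> m * (C + C0) + C0 \<and> I m s' \<and> agree_off c s s') s"
proof -
  \<comment> \<open>Induction on the number \<open>k\<close> of iterations still to come.\<close>
  have "wp (WhileLess x y c) (\<lambda>t s''. t \<le> k * (C + C0) + C0 \<and> I m s'' \<and> agree_off c s s'') s'"
    if "k \<le> m" "I (m - k) s'" "agree_off c s s'" for k s'
    using that
  proof (induction k arbitrary: s')
    case 0
    obtain R M where s': "s' = (R, M)" by fastforce
    have "exec (WhileLess x y c) s' (1 + bits (R x) + bits (R y)) s'"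
      unfolding s' using final[of s'] 0 s' by (intro exec.WhileFalse) auto
    then show ?case
      using 0 test_cost[of m s'] s' unfolding wp_def by fastforce
  next
    case (Suc k)
    let ?i = "m - Suc k"
    have i: "?i < m" "Suc ?i = m - k" using Suc.prems by auto
    obtain R M where s': "s' = (R, M)" by fastforce
    obtain t1 s2 where 1: "exec c s' t1 s2" "t1 \<le> C" "I (m - k) s2"
      using step[OF i(1) Suc.prems(2,3)] i(2) unfolding wp_def by auto
    have ag: "agree_off c s s2"
      using Suc.prems(3) exec_agree_off[OF 1(1)] agree_off_trans by blast
    obtain t2 s3 where 2: "exec (WhileLess x y c) s2 t2 s3"
        "t2 \<le> k * (C + C0) + C0" "I m s3" "agree_off c s s3"
      using Suc.IH[of s2] Suc.prems 1 ag unfolding wp_def by auto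
    have "exec (WhileLess x y c) s' (1 + bits (R x) + bits (R y) + t1 + t2) s3"
      unfolding s' using test[OF i(1) Suc.prems(2,3)] 1 2 s' by (intro exec.WhileTrue) auto
    moreover have "1 + bits (R x) + bits (R y) + t1 + t2 \<le> Suc k * (C + C0) + C0"
      using test_cost[of ?i s'] i Suc.prems 1 2 s' by auto
    ultimately show ?case using 2 unfolding wp_def by blast
  qed
  from this[of m s] show ?thesis using init by simp
qed

section \<open>Bit lengths and bit fields\<close>

lemma bits_le: "x < 2 ^ k \<Longrightarrow> bits x \<le> k"
  by (rule floorlog_leI) auto

lemma bits_le_self: "bits x \<le> x"
  by (rule bits_le) simp

lemma bits_mult_le: "bits (x * 2 ^ k) \<le> bits x + k"
  by (cases "x = 0") (auto simp: floorlog_eq_zero_iff)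

lemma bits_0 [simp]: "bits 0 = 0"
  by (simp add: floorlog_def)

lemma bits_1 [simp]: "bits 1 = 1" "bits (Suc 0) = 1"
  by (simp_all add: floorlog_def)

text \<open>\<open>Shl\<close> is excluded because its cost grows with the value of the second
  operand, not only with its length.\<close>

lemma op_cost_le:
  "bits x \<le> b \<Longrightarrow> bits y \<le> b \<Longrightarrow> f \<noteq> Shl \<Longrightarrow> op_cost f x y \<le> (1 + b)\<^sup>2"
proof -
  assume a: "bits x \<le> b" "bits y \<le> b" "f \<noteq> Shl"
  have "(1 + bits x) * (1 + bits y) \<le> (1 + b) * (1 + b)"
    using a by (intro mult_le_mono) auto
  moreover have "1 + 2 * b \<le> (1 + b)\<^sup>2" by (simp add: power2_eq_square)
  ultimately show ?thesis using a by (cases f) (auto simp: power2_eq_square)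
qed

lemma bit_read_field: "bit (read_field m a l) t \<longleftrightarrow> t < l \<and> m (a + t)"
proof -
  have "read_field m a l = horner_sum of_bool 2 (map (\<lambda>j. m (a + j)) [0..<l])"
    by (simp add: read_field_def horner_sum_eq_sum lessThan_atLeast0)
  then show ?thesis by (auto simp: bit_horner_sum_bit_iff)
qed

lemma read_field_less: "read_field m a l < 2 ^ l"
  using horner_sum_of_bool_2_less[of "map (\<lambda>j. m (a + j)) [0..<l]", where 'a=nat]
  by (simp add: read_field_def horner_sum_eq_sum lessThan_atLeast0)

lemma bits_read_field: "bits (read_field m a l) \<le> l"
  by (rule bits_le[OF read_field_less])

lemma write_field_in: "t < l \<Longrightarrow> write_field m a l x (a + t) = bit x t"
  by (simp add: write_field_def)

lemma write_field_out: "p < a \<or> a + l \<le> p \<Longrightarrow> write_field m a l x p = m p"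
  by (auto simp: write_field_def)

section \<open>Butterflies\<close>

text \<open>Vectors are functions on all of \<open>nat\<close>: no length is fixed, so the same
  levels can be spoken of in the main array, in a scratch array and in a table key.\<close>

definition butterfly :: "nat \<Rightarrow> (nat \<Rightarrow> 'a::ring_1) \<Rightarrow> nat \<Rightarrow> 'a" where
  "butterfly l f i = (if even (i div 2 ^ l) then f i + f (i + 2 ^ l) else f (i - 2 ^ l) - f i)"

primrec butterflies :: "nat \<Rightarrow> nat \<Rightarrow> (nat \<Rightarrow> 'a::ring_1) \<Rightarrow> nat \<Rightarrow> 'a" where
  "butterflies l 0 f = f"
| "butterflies l (Suc k) f = butterfly (l + k) (butterflies l k f)"

lemma butterflies_add: "butterflies l (k1 + k2) f = butterflies (l + k1) k2 (butterflies l k1 f)"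
  by (induction k2) (simp_all add: add.assoc)

text \<open>Adding \<open>2 ^ k\<close> sets the clear bit \<open>k\<close> of \<open>d\<close> and
  changes no other bit, so the result still has only \<open>j\<close> bits.\<close>

lemma even_div_add_less:
  assumes "even (d div 2 ^ k)" "d < 2 ^ j" "k < j"
  shows "d + 2 ^ k < (2::nat) ^ j"
proof -
  obtain z where z: "d div 2 ^ k = 2 * z" using assms by blast
  have j: "2 ^ j = (2::nat) ^ (j - Suc k) * 2 ^ Suc k"
    using assms(3) by (simp flip: power_add power_Suc)
  have "z * 2 ^ Suc k \<le> d"
    using z div_times_less_eq_dividend[of d "2 ^ k"] by simp
  then have "z * 2 ^ Suc k < 2 ^ (j - Suc k) * 2 ^ Suc k"
    using assms(2) unfolding j by (rule le_less_trans)
  then have "z < 2 ^ (j - Suc k)"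
    by (simp only: mult_less_cancel2)
  then have "Suc z * 2 ^ Suc k \<le> 2 ^ j"
    unfolding j by (intro mult_le_mono1) simp
  moreover have "d = (2 * z) * 2 ^ k + d mod 2 ^ k" using z by (metis div_mult_mod_eq)
  moreover have "d mod 2 ^ k < 2 ^ k" by simp
  ultimately show ?thesis unfolding power_Suc mult_Suc by linarith
qed

text \<open>Levels \<open>p\<close> to \<open>p + j - 1\<close> look only at the \<open>j\<close>
  index bits from \<open>p\<close> on. These are zero in \<open>a\<close>, so in
  \<open>a + d * 2 ^ p\<close> they spell \<open>d\<close>, and everything depends on
  \<open>d\<close> alone. Offset and distance may therefore be exchanged, which justifies all
  gathering of entries.\<close>

lemma butterflies_reindex:
  assumes "(a div 2 ^ p) mod 2 ^ j = 0" "(a' div 2 ^ p') mod 2 ^ j = 0"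
    and "\<And>d. d < 2 ^ j \<Longrightarrow> f (a + d * 2 ^ p) = f' (a' + d * 2 ^ p')"
    and "d < 2 ^ j"
  shows "butterflies p j f (a + d * 2 ^ p) = butterflies p' j f' (a' + d * 2 ^ p')"
proof -
  have "butterflies p k f (a + d * 2 ^ p) = butterflies p' k f' (a' + d * 2 ^ p')"
    if "k \<le> j" "d < 2 ^ j" for k d
    using that
  proof (induction k arbitrary: d)
    case 0
    then show ?case using assms(3) by simp
  next
    case (Suc k)
    \<comment> \<open>Bit \<open>q + k\<close> of the position is bit \<open>k\<close> of
      \<open>d\<close>, so both sides take the same branch of \<open>butterfly\<close>.\<close>
    have ev: "even ((b + d * 2 ^ q) div 2 ^ (q + k)) = even (d div 2 ^ k)"
      if "(b div 2 ^ q) mod 2 ^ j = 0" for b q :: nat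
    proof -
      obtain c where c: "b div 2 ^ q = 2 ^ j * c" using \<open>(b div 2 ^ q) mod 2 ^ j = 0\<close> by auto
      have "2 ^ j = (2::nat) ^ k * (2 * 2 ^ (j - Suc k))"
        using Suc.prems by (simp flip: power_Suc power_add)
      then have "(2 ^ j * c + d) div 2 ^ k = 2 * (2 ^ (j - Suc k) * c) + d div 2 ^ k"
        by (simp add: mult.assoc)
      moreover have "(b + d * 2 ^ q) div 2 ^ q = 2 ^ j * c + d"
        using c by (simp add: add.commute)
      then have "(b + d * 2 ^ q) div 2 ^ (q + k) = (2 ^ j * c + d) div 2 ^ k"
        by (simp only: power_add div_mult2_eq)
      ultimately show ?thesis by simp
    qed
    have sh: "b + d * 2 ^ q + 2 ^ (q + k) = b + (d + 2 ^ k) * 2 ^ q" for b q :: nat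
      by (simp add: power_add algebra_simps)
    show ?case
    proof (cases "even (d div 2 ^ k)")
      case True
      have "d + 2 ^ k < 2 ^ j"
        using True Suc.prems by (intro even_div_add_less) simp_all
      then show ?thesis
        using True Suc ev[OF assms(1)] ev[OF assms(2)]
        by (simp add: butterfly_def sh)
    next
      case False
      then have "2 ^ k \<le> d"
        by (metis div_less even_zero not_less)
      then have "b + d * 2 ^ q - 2 ^ (q + k) = b + (d - 2 ^ k) * 2 ^ q" for b q :: nat
        by (simp add: power_add algebra_simps)
      then show ?thesis
        using False Suc ev[OF assms(1)] ev[OF assms(2)]
        by (simp add: butterfly_def)
    qed
  qed
  then show ?thesis using assms(4) by simp
qed

section \<open>The Walsh-Hadamard matrix as a product of butterfly levels\<close>

lemma dim_hadamard2 [simp]: "dim_row hadamard2 = 2" "dim_col hadamard2 = 2"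
  by (simp_all add: hadamard2_def mat_of_rows_list_def)

lemma hadamard2_entry:
  "i < 2 \<Longrightarrow> j < 2 \<Longrightarrow> hadamard2 $$ (i, j) = (if i = 1 \<and> j = 1 then - 1 else 1)"
  by (auto simp: hadamard2_def mat_of_rows_list_def less_2_cases_iff)

lemma dim_kronecker_power_hadamard2 [simp]:
  "dim_row (kronecker_power hadamard2 n) = 2 ^ n"
  "dim_col (kronecker_power hadamard2 n) = 2 ^ n"
  by (induction n) (simp_all add: kronecker_def)

lemma sum_lessThan_add:
  fixes g :: "nat \<Rightarrow> 'a::comm_monoid_add"
  shows "(\<Sum>k<m + n. g k) = (\<Sum>k<m. g k) + (\<Sum>k<n. g (m + k))"
  by (induction n) (simp_all add: add.assoc)

text \<open>Induction with the top bit last. The offset \<open>c * 2 ^ n\<close> is carried along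
  because the step splits block \<open>c\<close> of length \<open>2 ^ Suc n\<close> into the blocks
  \<open>2 * c\<close> and \<open>2 * c + 1\<close> of length \<open>2 ^ n\<close>.\<close>

lemma butterflies_eq_sum:
  fixes f :: "nat \<Rightarrow> 'a::ring_1"
  assumes "i < 2 ^ n"
  shows "butterflies 0 n f (c * 2 ^ n + i) =
    (\<Sum>k<2 ^ n. kronecker_power hadamard2 n $$ (i, k) * f (c * 2 ^ n + k))"
  using assms
proof (induction n arbitrary: c i)
  case 0
  then show ?case by simp
next
  case (Suc n)
  let ?H = "kronecker_power hadamard2 n :: 'a mat"
  \<comment> \<open>The last Kronecker factor governs the top bits of row and column and contributes
    only a sign.\<close>
  have entry: "kronecker_power hadamard2 (Suc n) $$ (a, b) =
      (if a div 2 ^ n = 1 \<and> b div 2 ^ n = 1 then - 1 else 1) * ?H $$ (a mod 2 ^ n, b mod 2 ^ n)"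
    if "a < 2 ^ Suc n" "b < 2 ^ Suc n" for a b
  proof -
    have "a div 2 ^ n < 2" "b div 2 ^ n < 2"
      using that by (simp_all add: less_mult_imp_div_less)
    then show ?thesis using that
      by (simp add: kronecker_def hadamard2_entry)
  qed
  have split: "(\<Sum>k<2 ^ Suc n. g k) = (\<Sum>k<2 ^ n. g k) + (\<Sum>k<2 ^ n. g (2 ^ n + k))"
    for g :: "nat \<Rightarrow> 'a"
    using sum_lessThan_add[of g "2 ^ n" "2 ^ n"] by (simp add: mult_2)
  show ?case
  proof (cases "i < 2 ^ n")
    case True
    have "butterflies 0 (Suc n) f (c * 2 ^ Suc n + i) =
        butterflies 0 n f ((2 * c) * 2 ^ n + i) + butterflies 0 n f ((2 * c + 1) * 2 ^ n + i)"
    proof -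
      have "c * 2 ^ Suc n + i = (2 * c) * 2 ^ n + i" by simp
      moreover have "even (((2 * c) * 2 ^ n + i) div 2 ^ n)" using True by simp
      moreover have "(2 * c) * 2 ^ n + i + 2 ^ n = (2 * c + 1) * 2 ^ n + i" by simp
      ultimately show ?thesis
        by (simp only: butterflies.simps butterfly_def add_0 if_True)
    qed
    also have "\<dots> = (\<Sum>k<2 ^ Suc n. kronecker_power hadamard2 (Suc n) $$ (i, k) * f (c * 2 ^ Suc n + k))"
    proof -
      have "kronecker_power hadamard2 (Suc n) $$ (i, k) = ?H $$ (i, k)"
        "kronecker_power hadamard2 (Suc n) $$ (i, 2 ^ n + k) = ?H $$ (i, k)" if "k < 2 ^ n" for k
        using entry[of i k] entry[of i "2 ^ n + k"] that True by simp_all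
      moreover have "c * 2 ^ Suc n = (2 * c) * 2 ^ n"
        "c * 2 ^ Suc n + (2 ^ n + k) = (2 * c + 1) * 2 ^ n + k" for k by simp_all
      ultimately show ?thesis
        unfolding split Suc.IH[OF True]
        by (intro arg_cong2[where f="(+)"] sum.cong) (simp_all add: algebra_simps del: kronecker_power.simps)
    qed
    finally show ?thesis .
  next
    case False
    define z where "z = i - 2 ^ n"
    have z: "z < 2 ^ n" "i = 2 ^ n + z" using False Suc.prems by (auto simp: z_def)
    have "c * 2 ^ Suc n + i = (2 * c + 1) * 2 ^ n + z"
      using z by (simp add: algebra_simps)
    moreover have "odd (((2 * c + 1) * 2 ^ n + z) div 2 ^ n)"
      using z by (simp add: div_add1_eq)
    moreover have "(2 * c + 1) * 2 ^ n + z - 2 ^ n = (2 * c) * 2 ^ n + z" by simp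
    ultimately have "butterflies 0 (Suc n) f (c * 2 ^ Suc n + i) =
        butterflies 0 n f ((2 * c) * 2 ^ n + z) - butterflies 0 n f ((2 * c + 1) * 2 ^ n + z)"
      by (simp only: butterflies.simps butterfly_def add_0 if_False)
    also have "\<dots> = (\<Sum>k<2 ^ Suc n. kronecker_power hadamard2 (Suc n) $$ (i, k) * f (c * 2 ^ Suc n + k))"
    proof -
      have "kronecker_power hadamard2 (Suc n) $$ (i, k) = ?H $$ (z, k)"
        "kronecker_power hadamard2 (Suc n) $$ (i, 2 ^ n + k) = - ?H $$ (z, k)" if "k < 2 ^ n" for k
        using entry[of i k] entry[of i "2 ^ n + k"] that z by simp_all
      moreover have "c * 2 ^ Suc n = (2 * c) * 2 ^ n"
        "c * 2 ^ Suc n + (2 ^ n + k) = (2 * c + 1) * 2 ^ n + k" for k by simp_all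
      ultimately show ?thesis
        unfolding split Suc.IH[OF z(1)] diff_conv_add_uminus sum_negf[symmetric]
        by (intro arg_cong2[where f="(+)"] sum.cong) (simp_all add: algebra_simps del: kronecker_power.simps)
    qed
    finally show ?thesis .
  qed
qed

lemma walsh_hadamard_butterflies:
  fixes v :: "'a::ring_1 vec"
  assumes "v \<in> carrier_vec (2 ^ n)" "i < 2 ^ n" "\<And>k. k < 2 ^ n \<Longrightarrow> f k = v $ k"
  shows "(walsh_hadamard n *\<^sub>v v) $ i = butterflies 0 n f i"
  using butterflies_eq_sum[OF assms(2), of f 0] assms
  by (simp add: walsh_hadamard_def scalar_prod_def lessThan_atLeast0)

section \<open>Levels computed one at a time\<close>

locale encoding =
  fixes enc :: "'a::{field, finite} \<Rightarrow> nat" and w :: nat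
  assumes inj_enc: "inj enc" and enc_less: "enc x < 2 ^ w"
begin

lemma w_pos: "0 < w"
proof (rule ccontr)
  assume "\<not> 0 < w"
  then have "enc 0 = enc 1" using enc_less[of 0] enc_less[of 1] by simp
  then show False using inj_enc by (simp add: inj_eq)
qed

lemma bit_encD: "bit (enc x) t \<Longrightarrow> t < w"
  by (metis enc_less take_bit_nat_eq_self bit_take_bit_iff)

text \<open>A relation rather than a decoding function, since memory may contain bit patterns that
  code no field element.\<close>

definition holds :: "(nat \<Rightarrow> bool) \<Rightarrow> nat \<Rightarrow> nat \<Rightarrow> (nat \<Rightarrow> 'a) \<Rightarrow> bool" where
  "holds m a L g \<longleftrightarrow> (\<forall>i<L. \<forall>t<w. m (a + i * w + t) \<longleftrightarrow> bit (enc (g i)) t)"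

lemma field_index_less: "i < L \<Longrightarrow> t < w \<Longrightarrow> i * w + t < L * w"
proof -
  assume "i < L" "t < w"
  then have "Suc i * w \<le> L * w" by (intro mult_le_mono1) simp
  then show ?thesis using \<open>t < w\<close> by simp
qed

lemma holds_cong_bits:
  assumes "holds m a L g" "\<And>t. t < L * w \<Longrightarrow> m' (b + t) = m (a + t)"
  shows "holds m' b L g"
  unfolding holds_def
proof (intro allI impI)
  fix i t assume "i < L" "t < w"
  then show "m' (b + i * w + t) = bit (enc (g i)) t"
    using assms(2)[OF field_index_less[of i L t]] assms(1) by (simp add: holds_def add.assoc)
qed

lemma holds_cong: "holds m a L g \<Longrightarrow> (\<And>i. i < L \<Longrightarrow> g' i = g i) \<Longrightarrow> holds m a L g'"
  by (simp add: holds_def)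

lemma holds_read: "holds m a L g \<Longrightarrow> i < L \<Longrightarrow> read_field m (a + i * w) w = enc (g i)"
  by (rule bit_eqI) (auto simp: bit_read_field holds_def dest: bit_encD)

lemma holds_write_Suc:
  assumes "holds m 0 i g"
  shows "holds (write_field m (i * w) w (enc (g i))) 0 (Suc i) g"
  unfolding holds_def
proof (intro allI impI)
  fix k t assume k: "k < Suc i" and t: "t < w"
  show "write_field m (i * w) w (enc (g i)) (0 + k * w + t) = bit (enc (g k)) t"
  proof (cases "k = i")
    case True
    then show ?thesis using t write_field_in[of t w m "i * w"] by simp
  next
    case False
    then show ?thesis
      using assms k t field_index_less[of k i t]
      by (subst write_field_out) (auto simp: holds_def)
  qed
qed

lemma ex_digits:
  fixes f :: "nat \<Rightarrow> nat"
  assumes "\<And>k. f k < 2 ^ w"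
  shows "\<exists>G. \<forall>k<n. G div 2 ^ (k * w) mod 2 ^ w = f k"
  using assms
proof (induction n arbitrary: f)
  case 0
  then show ?case by simp
next
  case (Suc n)
  obtain G where G: "\<forall>k<n. G div 2 ^ (k * w) mod 2 ^ w = f (Suc k)"
    using Suc.IH[of "\<lambda>k. f (Suc k)"] Suc.prems by auto
  have "(f 0 + 2 ^ w * G) div 2 ^ (k * w) mod 2 ^ w = f k" if "k < Suc n" for k
  proof (cases k)
    case 0
    then show ?thesis using Suc.prems[of 0] by simp
  next
    case (Suc k')
    have "(f 0 + 2 ^ w * G) div 2 ^ w = G" using Suc.prems[of 0] by simp
    then have "(f 0 + 2 ^ w * G) div 2 ^ (k * w) = G div 2 ^ (k' * w)"
      unfolding Suc mult_Suc power_add div_mult2_eq by simp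
    then show ?thesis using G that Suc by simp
  qed
  then show ?case by blast
qed

text \<open>Addition and subtraction of codes are read off from one numeral in base \<open>2 ^ w\<close>, which the
  program contains as a constant.\<close>

definition op_index :: "nat \<Rightarrow> nat \<Rightarrow> nat \<Rightarrow> nat" where
  "op_index b x y = ((b * 2 ^ w + x) * 2 ^ w + y) * w"

text \<open>In the subtraction \<open>x\<close> is the entry whose index bit is set and
  \<open>y\<close> its partner, whence the order \<open>y - x\<close>.\<close>

lemma ex_op_table:
  "\<exists>G. \<forall>x y. G div 2 ^ op_index 0 (enc x) (enc y) mod 2 ^ w = enc (x + y) \<and>
     G div 2 ^ op_index 1 (enc x) (enc y) mod 2 ^ w = enc (y - x)"
proof -
  \<comment> \<open>On patterns that are not codes \<open>inv_into\<close> returns some element; the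
    value is still a code and so fits into one digit.\<close>
  define f where "f k = (let x = inv_into UNIV enc (k div 2 ^ w mod 2 ^ w); y = inv_into UNIV enc (k mod 2 ^ w) in
    if k div 2 ^ w div 2 ^ w = 0 then enc (x + y) else enc (y - x))" for k :: nat
  have "f k < 2 ^ w" for k using enc_less by (simp add: f_def Let_def)
  then obtain G where G: "\<And>k. k < 2 * 2 ^ w * 2 ^ w \<Longrightarrow> G div 2 ^ (k * w) mod 2 ^ w = f k"
    using ex_digits[of f "2 * 2 ^ w * 2 ^ w"] by blast
  have less: "(b * 2 ^ w + enc x) * 2 ^ w + enc y < 2 * 2 ^ w * 2 ^ w" if "b < 2" for b x y
  proof -
    have "b * 2 ^ w + enc x + 1 \<le> (b + 1) * 2 ^ w"
      using enc_less[of x] by (simp add: Suc_le_eq)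
    also have "\<dots> \<le> 2 * 2 ^ w" using that by (intro mult_le_mono1) simp
    finally have "(b * 2 ^ w + enc x + 1) * 2 ^ w \<le> 2 * 2 ^ w * 2 ^ w"
      by (rule mult_le_mono1)
    then show ?thesis using enc_less[of y] by simp
  qed
  have f: "f ((b * 2 ^ w + enc x) * 2 ^ w + enc y) = (if b = 0 then enc (x + y) else enc (y - x))"
    for b x y
    using enc_less[of x] enc_less[of y] inj_enc by (simp add: f_def)
  have "G div 2 ^ op_index b (enc x) (enc y) mod 2 ^ w = (if b = 0 then enc (x + y) else enc (y - x))"
    if "b < 2" for b x y
    unfolding op_index_def G[OF less[OF that]] f ..
  from this[of 0] this[of 1] show ?thesis by (intro exI[of _ G]) simp
qed

definition op_table :: nat where
  "op_table = (SOME G. \<forall>x y. G div 2 ^ op_index 0 (enc x) (enc y) mod 2 ^ w = enc (x + y) \<and>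
     G div 2 ^ op_index 1 (enc x) (enc y) mod 2 ^ w = enc (y - x))"

lemma op_table:
  "op_table div 2 ^ op_index 0 (enc x) (enc y) mod 2 ^ w = enc (x + y)"
  "op_table div 2 ^ op_index (Suc 0) (enc x) (enc y) mod 2 ^ w = enc (y - x)"
  using someI_ex[OF ex_op_table, folded op_table_def] by simp_all

text \<open>Bits needed beyond the number of levels so that every operand of a butterfly fits:
  \<open>3 * w + 1\<close> bounds the position in the numeral, \<open>w + 1\<close> the excess of a
  bit address, and the numeral itself has \<open>bits op_table\<close>.\<close>

definition overhead :: nat where
  "overhead = 3 * w + 2 + bits op_table"

text \<open>
  Register allocation: 0 holds \<open>n\<close>; 1, 2, 3, 12 and 17 hold the constants \<open>1\<close>, \<open>0\<close>, \<open>w\<close>, \<open>2\<close> and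
  \<open>2 ^ w\<close>; 4 and 5 hold \<open>j\<close> and \<open>2 ^ j\<close>; 6, 7, 8, 9 and 15 hold the lengths in bits of \<open>2 ^ j\<close>, \<open>4 ^ j\<close>,
  \<open>8 ^ j\<close>, \<open>2 ^ n\<close> and \<open>2 ^ m\<close> entries, where \<open>m\<close> is the number of low levels; 10 holds the
  logarithm of the slot length of the table and 16 the number of its keys. All others are temporary.
  Array 0 is the input, 1 the output, 2 and 3 are scratch space and 4 is the table.

  In the program below, register 42 holds bit \<open>l\<close> of the index \<open>i\<close>, and the address of the
  partner of \<open>i\<close> is computed without branching as \<open>i + 2 ^ l - 2 * 2 ^ l * bit\<close>.
\<close>

definition naive_entry :: com where
  "naive_entry =
     Seq (Load 40 2 41 3) (Seq (Op Div 42 41 43) (Seq (Op Mod 42 42 12)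
    (Seq (Op Mul 44 42 43) (Seq (Op Add 44 44 44) (Seq (Op Add 45 41 43) (Seq (Op Sub 45 45 44)
    (Seq (Load 46 2 45 3) (Seq (Op Mul 47 42 17) (Seq (Op Add 47 47 40) (Seq (Op Mul 47 47 17)
    (Seq (Op Add 47 47 46) (Seq (Op Mul 47 47 3) (Seq (Const 48 op_table) (Seq (Op Shr 48 48 47)
    (Seq (Op Mod 48 48 17) (Seq (Store 3 41 3 48) (Op Add 41 41 3)))))))))))))))))"

text \<open>Peels one instruction off the cost of straight-line code: a right-nested sum of
  \<open>k\<close> terms, each at most \<open>C\<close>, is at most \<open>k * C\<close>.\<close>

lemma add_le_mult_step: "a \<le> C \<Longrightarrow> r \<le> (k - 1) * C \<Longrightarrow> 0 < k \<Longrightarrow> a + r \<le> k * (C::nat)"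
  by (cases k) auto

lemma le_mult_step: "a \<le> C \<Longrightarrow> 0 < k \<Longrightarrow> a \<le> k * (C::nat)"
  by (cases k) auto

lemma two_power_less_overhead:
  assumes "m + overhead \<le> b" "x \<le> 2 * (2 ^ m * w)"
  shows "x < 2 ^ b"
proof -
  have "x < 2 * (2 ^ m * 2 ^ w)"
    using assms(2) by (rule le_less_trans) simp
  also have "\<dots> = 2 ^ (1 + m + w)" by (simp add: power_add)
  also have "\<dots> \<le> 2 ^ b" using assms(1) by (intro power_increasing) (auto simp: overhead_def)
  finally show ?thesis .
qed

text \<open>The stored value \<open>v\<close> is fixed before \<open>g\<close> is quantified: run
  and cost do not presuppose that the array holds codes. This matters when the table is filled for
  every bit pattern.\<close>

lemma wp_naive_entry:
  assumes R: "fst s 3 = w" "fst s 12 = 2" "fst s 17 = 2 ^ w" "fst s 41 = i * w"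
      "fst s 43 = 2 ^ l * w"
    and il: "i < 2 ^ m" "l < m" and b: "m + overhead \<le> b"
  shows "wp naive_entry (\<lambda>t s'. t \<le> 90 * (1 + b)\<^sup>2 \<and> fst s' 41 = Suc i * w \<and>
      (\<exists>v. snd s' = (snd s)(3 := write_field (snd s 3) (i * w) w v) \<and>
        (\<forall>g. holds (snd s 2) 0 (2 ^ m) g \<longrightarrow> v = enc (butterfly l g i)))) s"
proof -
  define q where "q = i div 2 ^ l mod 2"
  define j where "j = (if even (i div 2 ^ l) then i + 2 ^ l else i - 2 ^ l)"
  define x where "x = read_field (snd s 2) (i * w) w"
  define y where "y = read_field (snd s 2) (j * w) w"
  have q: "i * w div (2 ^ l * w) mod 2 = q" using w_pos by (simp add: q_def)
  have q2: "q < 2" by (simp add: q_def)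
  have jm: "j < 2 ^ m"
    using even_div_add_less[OF _ il] il by (auto simp: j_def)
  have le: "2 ^ l \<le> i" if "odd (i div 2 ^ l)" using that by (metis div_less even_zero not_less)
  \<comment> \<open>The branch-free partner address; truncated subtraction is exact because
    \<open>2 ^ l \<le> i\<close> whenever bit \<open>l\<close> of \<open>i\<close> is set.\<close>
  have j: "i * w + 2 ^ l * w - (q * (2 ^ l * w) + q * (2 ^ l * w)) = j * w"
  proof (cases "even (i div 2 ^ l)")
    case False
    then have "q = 1" by (simp add: q_def odd_iff_mod_2_eq_one)
    then show ?thesis using False le by (simp add: j_def algebra_simps diff_mult_distrib)
  qed (simp add: q_def j_def algebra_simps)
  have v: "op_table div 2 ^ op_index q x y mod 2 ^ w = enc (butterfly l g i)"
    if "holds (snd s 2) 0 (2 ^ m) g" for g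
  proof -
    have "x = enc (g i)" "y = enc (g j)"
      using holds_read[OF that il(1)] holds_read[OF that jm] by (simp_all add: x_def y_def)
    then show ?thesis
      by (cases "even (i div 2 ^ l)")
        (simp_all add: op_table butterfly_def q_def j_def odd_iff_mod_2_eq_one even_iff_mod_2_eq_zero)
  qed
  have big0: "bits z \<le> b" if "z \<le> 2 * (2 ^ m * w)" for z
    using bits_le two_power_less_overhead[OF b that] .
  have "2 ^ l * w \<le> 2 ^ m * w" "i * w \<le> 2 ^ m * w" "j * w \<le> 2 ^ m * w"
    using il jm by (intro mult_le_mono1; simp)+
  moreover have "q * (2 ^ l * w) \<le> 1 * (2 ^ l * w)"
    using q2 by (intro mult_le_mono1) simp
  moreover have "i * w div (2 ^ l * w) \<le> i * w" by (rule div_le_dividend)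
  ultimately have big: "bits (i * w) \<le> b" "bits (2 ^ l * w) \<le> b" "bits (j * w) \<le> b"
    "bits (i * w + 2 ^ l * w) \<le> b" "bits (q * (2 ^ l * w)) \<le> b"
    "bits (q * (2 ^ l * w) + q * (2 ^ l * w)) \<le> b" "bits (i * w div (2 ^ l * w)) \<le> b"
    by - (rule big0, linarith)+
  have xy: "x < 2 ^ w" "y < 2 ^ w" by (simp_all add: x_def y_def read_field_less)
  have k: "z < 2 ^ b" if "z < 2 * 2 ^ w * 2 ^ w * 2 ^ w" for z :: nat
  proof -
    have "2 * 2 ^ w * 2 ^ w * 2 ^ w = (2::nat) ^ (3 * w + 1)" by (simp add: power_add numeral_3_eq_3 power_mult[symmetric])
    also have "\<dots> \<le> 2 ^ b" using b by (intro power_increasing) (auto simp: overhead_def)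
    finally show ?thesis using that by simp
  qed
  have "q * 2 ^ w + x < (q + 1) * 2 ^ w" using xy by simp
  also have "\<dots> \<le> 2 * 2 ^ w" using q2 by (intro mult_le_mono1) simp
  finally have k1: "q * 2 ^ w + x < 2 * 2 ^ w" .
  then have "(q * 2 ^ w + x + 1) * 2 ^ w \<le> 2 * 2 ^ w * 2 ^ w" by (intro mult_le_mono1) simp
  then have k2: "(q * 2 ^ w + x) * 2 ^ w + y < 2 * 2 ^ w * 2 ^ w" using xy by simp
  have k3: "op_index q x y < 2 * 2 ^ w * 2 ^ w * 2 ^ w"
    unfolding op_index_def using k2 by (intro mult_strict_mono) simp_all
  have small0: "bits z \<le> b" if "z < 2 * 2 ^ w * 2 ^ w * 2 ^ w" for z
    using bits_le k[OF that] .
  have pw: "2 * 2 ^ w \<le> 2 * 2 ^ w * (2::nat) ^ w" "2 * 2 ^ w * 2 ^ w \<le> 2 * 2 ^ w * 2 ^ w * (2::nat) ^ w"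
    by simp_all
  have two: "2 \<le> (2::nat) ^ w" using power_increasing[of 1 w "2::nat"] w_pos by simp
  have ww: "w < 2 ^ w" by simp
  have small: "bits q \<le> b" "bits 2 \<le> b" "bits w \<le> b" "bits (2 ^ w) \<le> b" "bits (q * 2 ^ w) \<le> b"
    "bits x \<le> b" "bits y \<le> b" "bits (q * 2 ^ w + x) \<le> b" "bits ((q * 2 ^ w + x) * 2 ^ w) \<le> b"
    "bits ((q * 2 ^ w + x) * 2 ^ w + y) \<le> b" "bits (op_index q x y) \<le> b"
    using pw two ww xy k1 k2 k3 q2 by - (rule small0, linarith)+
  have table: "bits op_table \<le> b" "bits (op_table div 2 ^ op_index q x y) \<le> b"
    "bits (op_table div 2 ^ op_index q x y mod 2 ^ w) \<le> b"
  proof -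
    show 1: "bits op_table \<le> b" using b by (simp add: overhead_def)
    then show "bits (op_table div 2 ^ op_index q x y) \<le> b"
      using floorlog_mono[OF div_le_dividend] by (rule order_trans[rotated])
    then show "bits (op_table div 2 ^ op_index q x y mod 2 ^ w) \<le> b"
      using floorlog_mono[OF mod_less_eq_dividend] by (rule order_trans[rotated])
  qed
  \<comment> \<open>There are eighteen instructions of cost at most \<open>C\<close>, which gives
    the \<open>90\<close>; the factor \<open>5\<close> leaves room for memory accesses.\<close>
  define C where "C = 5 * (1 + b)\<^sup>2"
  have C: "op_cost f x y \<le> C" if "bits x \<le> b" "bits y \<le> b" "f \<noteq> Shl" for f x y
    using op_cost_le[OF that] by (simp add: C_def)
  have C': "z \<le> C" if "z \<le> 1 + 3 * b + w" for z
  proof -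
    have "1 + 4 * b \<le> C" by (simp add: C_def power2_eq_square)
    then show ?thesis using that b by (simp add: overhead_def)
  qed
  show ?thesis
  proof (rule wp_abstract, goal_cases)
    case (1 Q)
    show ?case
      unfolding naive_entry_def
    proof (simp (no_asm) only: step_simps R q j x_def[symmetric] y_def[symmetric]
        op_index_def[symmetric], intro 1 conjI, goal_cases)
      case 1
      have eq: "90 * (1 + b)\<^sup>2 = 18 * C" by (simp add: C_def)
      show ?case unfolding eq
        by (intro add_le_mult_step le_mult_step C big small table; (simp; fail)?)
          (rule C', use big small table in linarith)+
    next
      case 3
      show ?case using v by auto
    qed simp
  qed
qed


text \<open>Old entries are still needed by their partners, so results go to array 3 and return in
  one wide transfer, linear in the length.\<close>

definition naive_level :: "reg \<Rightarrow> com" where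
  "naive_level tot = Seq (Const 41 0) (Seq (WhileLess 41 tot naive_entry)
     (Seq (Load 40 3 2 tot) (Seq (Store 2 2 tot 40) (Op Add 43 43 43))))"

text \<open>Register 43 is both the distance of partners and the loop control: it doubles from the
  value of \<open>lv\<close> until it equals the array length \<open>tot\<close>.\<close>

definition naive :: "reg \<Rightarrow> reg \<Rightarrow> com" where
  "naive lv tot = Seq (Op Add 43 lv 2) (WhileLess 43 tot (naive_level tot))"

lemma written_naive_entry [simp]:
  "written_regs naive_entry = {40, 41, 42, 44, 45, 46, 47, 48}" "written_arrs naive_entry = {3}"
  by (auto simp: naive_entry_def)

lemma written_naive_level [simp]:
  "written_regs (naive_level tot) = {40..48}" "written_arrs (naive_level tot) = {2, 3}"
  by (auto simp: naive_level_def)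

lemma written_naive [simp]:
  "written_regs (naive lv tot) = {40..48}" "written_arrs (naive lv tot) = {2, 3}"
  by (auto simp: naive_def)

definition ready :: "state \<Rightarrow> bool" where
  "ready s \<longleftrightarrow> fst s 1 = 1 \<and> fst s 2 = 0 \<and> fst s 3 = w \<and> fst s 12 = 2 \<and> fst s 17 = 2 ^ w"

lemma ready_agree:
  "ready s \<Longrightarrow> agree_off c s s' \<Longrightarrow> {1, 2, 3, 12, 17} \<inter> written_regs c = {} \<Longrightarrow> ready s'"
  by (auto simp: ready_def agree_off_def)

lemma readyD:
  assumes "ready s"
  shows "fst s 1 = 1" "fst s 2 = 0" "fst s 3 = w" "fst s 12 = 2" "fst s 17 = 2 ^ w"
  using assms by (simp_all add: ready_def)

lemma wp_naive_level:
  assumes R: "ready s" "fst s 43 = 2 ^ l * w" "fst s tot = 2 ^ m * w" and tot: "tot \<notin> {40..48}"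
    and l: "l < m" and b: "m + overhead \<le> b"
  shows "wp (naive_level tot) (\<lambda>t s'. t \<le> 2 ^ m * (110 * (1 + b)\<^sup>2) \<and> fst s' 43 = 2 ^ Suc l * w \<and>
      (\<forall>g. holds (snd s 2) 0 (2 ^ m) g \<longrightarrow> holds (snd s' 2) 0 (2 ^ m) (butterfly l g))) s"
proof -
  let ?D = "(1 + b)\<^sup>2"
  define s1 where "s1 = ((fst s)(41 := 0), snd s)"
  define I where "I i s' \<longleftrightarrow> fst s' 41 = i * w \<and>
    (\<forall>g. holds (snd s 2) 0 (2 ^ m) g \<longrightarrow> holds (snd s' 3) 0 i (butterfly l g))" for i and s' :: state
  have bits0: "bits z \<le> b" if "z \<le> 2 * (2 ^ m * w)" for z
    using bits_le two_power_less_overhead[OF b that] .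
  have "(2::nat) ^ l \<le> 2 ^ m" using l by simp
  then have lm: "2 ^ l * w \<le> 2 ^ m * w" by (rule mult_le_mono1)
  have loop: "wp (WhileLess 41 tot naive_entry) (\<lambda>t s'. t \<le> 2 ^ m * (90 * ?D + (1 + 2 * b)) + (1 + 2 * b) \<and>
      I (2 ^ m) s' \<and> agree_off naive_entry s1 s') s1"
  proof (rule wp_While)
    show "I 0 s1" by (simp add: I_def s1_def holds_def)
  next
    fix i s' assume i: "i < 2 ^ m" and s': "I i s'" "agree_off naive_entry s1 s'"
    have tot': "fst s' tot = 2 ^ m * w"
      using agree_off_reg[OF s'(2), of tot] tot R by (auto simp: s1_def)
    show "fst s' 41 < fst s' tot"
      using tot' s'(1) i w_pos by (simp add: I_def)
    have "ready s1" using R(1) by (simp add: ready_def s1_def)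
    then have "ready s'" using s'(2) by (rule ready_agree) simp
    moreover have "fst s' 43 = 2 ^ l * w"
      using agree_off_reg[OF s'(2), of 43] R(2) by (simp add: s1_def)
    moreover have s2: "snd s' 2 = snd s 2"
      using agree_off_arr[OF s'(2), of 2] by (simp add: s1_def)
    ultimately have "wp naive_entry (\<lambda>t s''. t \<le> 90 * ?D \<and> fst s'' 41 = Suc i * w \<and>
      (\<exists>v. snd s'' = (snd s')(3 := write_field (snd s' 3) (i * w) w v) \<and>
        (\<forall>g. holds (snd s 2) 0 (2 ^ m) g \<longrightarrow> v = enc (butterfly l g i)))) s'"
      using wp_naive_entry[of s' i l m b] s'(1) i l b by (simp add: I_def readyD)
    then show "wp naive_entry (\<lambda>t s''. t \<le> 90 * ?D \<and> I (Suc i) s'') s'"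
      by (rule wp_mono) (use s'(1) holds_write_Suc in \<open>auto simp: I_def\<close>)
  next
    fix s' assume s': "I (2 ^ m) s'" "agree_off naive_entry s1 s'"
    then show "\<not> fst s' 41 < fst s' tot"
      using agree_off_reg[OF s'(2), of tot] tot R by (auto simp: s1_def I_def)
  next
    fix i s' assume i: "i \<le> 2 ^ m" and s': "I i s'" "agree_off naive_entry s1 s'"
    have "fst s' tot = 2 ^ m * w"
      using agree_off_reg[OF s'(2), of tot] tot R by (auto simp: s1_def)
    moreover have "i * w \<le> 2 ^ m * w" using i by (rule mult_le_mono1)
    ultimately have "fst s' 41 \<le> 2 * (2 ^ m * w)" "fst s' tot \<le> 2 * (2 ^ m * w)"
      using s'(1) unfolding I_def by linarith+
    then show "1 + bits (fst s' 41) + bits (fst s' tot) \<le> 1 + 2 * b"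
      using bits0[of "fst s' 41"] bits0[of "fst s' tot"] by linarith
  qed
  have w_le: "2 ^ m * w \<le> 2 ^ m * b" using b by (intro mult_le_mono2) (simp add: overhead_def)
  have D: "1 + 2 * b \<le> ?D" by (simp add: power2_eq_square)
  then have D2: "2 ^ m * (1 + 2 * b) \<le> 2 ^ m * ?D" by (rule mult_le_mono2)
  have D1: "?D \<le> 2 ^ m * ?D" by simp
  show ?thesis
    unfolding naive_level_def
  proof (rule wp_SeqI[where ?Q1.0 = "\<lambda>t s'. t = 1 \<and> s' = s1"], goal_cases)
    case 1
    then show ?case by (simp add: wp_simps s1_def)
  next
    case (2 t s')
    show ?case
    proof (rule wp_SeqI, use 2 loop in simp, goal_cases)
      case (1 t' s2)
      then have t': "t' \<le> 2 ^ m * (90 * ?D + (1 + 2 * b)) + (1 + 2 * b)" and I: "I (2 ^ m) s2"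
        and ag: "agree_off naive_entry s1 s2" by auto
      have R2: "fst s2 tot = 2 ^ m * w" "fst s2 43 = 2 ^ l * w" "fst s2 2 = 0" "ready s2"
        using agree_off_reg[OF ag, of tot] agree_off_reg[OF ag, of 43] tot R
          ready_agree[OF _ ag] agree_off_reg[OF ag, of 2]
        by (auto simp: s1_def ready_def)
      have copy: "holds (write_field (snd s2 2) 0 (2 ^ m * w) (read_field (snd s2 3) 0 (2 ^ m * w))) 0 (2 ^ m) g"
        if "holds (snd s2 3) 0 (2 ^ m) g" for g
        using that by (rule holds_cong_bits) (simp add: write_field_def bit_read_field)
      have tn: "tot \<noteq> 40" "tot \<noteq> 41" "tot \<noteq> 43" using tot by auto
      show ?case
      proof (rule wp_abstract, goal_cases)
        case (1 Q)
        show ?case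
        proof (simp (no_asm) only: step_simps R2 tn, intro 1 conjI, goal_cases)
          case 1
          have "bits (read_field (snd s2 3) 0 (2 ^ m * w)) \<le> 2 ^ m * w"
            by (rule bits_read_field)
          moreover have "bits (2 ^ m * w) \<le> b" "bits (2 ^ l * w) \<le> b"
            by (rule bits0, use lm in linarith)+
          moreover have "2 ^ m * (90 * ?D + (1 + 2 * b)) = 90 * (2 ^ m * ?D) + 2 ^ m * (1 + 2 * b)"
            "2 ^ m * (110 * ?D) = 110 * (2 ^ m * ?D)" "2 ^ m * (1 + 2 * b) = 2 ^ m + 2 * (2 ^ m * b)"
            by (simp_all add: algebra_simps)
          ultimately show ?case
            using t' 2 w_le D D1 D2 unfolding op_cost.simps bits_0 by linarith
        next
          case 3
          then show ?case using I copy by (simp add: I_def)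
        qed simp
      qed
    qed
  qed
qed

lemma wp_naive:
  assumes R: "ready s" "fst s lv = 2 ^ l * w" "fst s tot = 2 ^ (l + k) * w" and tot: "tot \<notin> {40..48}"
    and b: "l + k + overhead \<le> b"
  shows "wp (naive lv tot) (\<lambda>t s'. t \<le> (k + 1) * 2 ^ (l + k) * (120 * (1 + b)\<^sup>2) \<and>
      (\<forall>g. holds (snd s 2) 0 (2 ^ (l + k)) g \<longrightarrow>
        holds (snd s' 2) 0 (2 ^ (l + k)) (butterflies l k g))) s"
proof -
  let ?D = "(1 + b)\<^sup>2" and ?m = "l + k"
  define s1 where "s1 = ((fst s)(43 := 2 ^ l * w), snd s)"
  define I where "I i s' \<longleftrightarrow> fst s' 43 = 2 ^ (l + i) * w \<and>
    (\<forall>g. holds (snd s 2) 0 (2 ^ ?m) g \<longrightarrow> holds (snd s' 2) 0 (2 ^ ?m) (butterflies l i g))"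
    for i and s' :: state
  have bits0: "bits z \<le> b" if "z \<le> 2 * (2 ^ ?m * w)" for z
    using bits_le two_power_less_overhead[OF b that] .
  have le: "2 ^ (l + i) * w \<le> 2 ^ ?m * w" if "i \<le> k" for i
    using that by (intro mult_le_mono1) simp
  have R1: "fst s' tot = 2 ^ ?m * w" "ready s'" if "agree_off (naive_level tot) s1 s'" for s'
  proof -
    have "ready s1" using R(1) by (simp add: ready_def s1_def)
    then show "ready s'" using that by (rule ready_agree) simp
    show "fst s' tot = 2 ^ ?m * w"
      using agree_off_reg[OF that, of tot] tot R by (auto simp: s1_def)
  qed
  have loop: "wp (WhileLess 43 tot (naive_level tot))
      (\<lambda>t s'. t \<le> k * (2 ^ ?m * (110 * ?D) + (1 + 2 * b)) + (1 + 2 * b) \<and>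
      I k s' \<and> agree_off (naive_level tot) s1 s') s1"
  proof (rule wp_While)
    show "I 0 s1" by (simp add: I_def s1_def)
  next
    fix i s' assume i: "i < k" and s': "I i s'" "agree_off (naive_level tot) s1 s'"
    show "fst s' 43 < fst s' tot"
      using R1[OF s'(2)] s'(1) i w_pos by (simp add: I_def)
    have "wp (naive_level tot) (\<lambda>t s''. t \<le> 2 ^ ?m * (110 * ?D) \<and> fst s'' 43 = 2 ^ Suc (l + i) * w \<and>
      (\<forall>g. holds (snd s' 2) 0 (2 ^ ?m) g \<longrightarrow> holds (snd s'' 2) 0 (2 ^ ?m) (butterfly (l + i) g))) s'"
      using s' i b tot R1[OF s'(2)] by (intro wp_naive_level) (auto simp: I_def)
    then show "wp (naive_level tot) (\<lambda>t s''. t \<le> 2 ^ ?m * (110 * ?D) \<and> I (Suc i) s'') s'"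
      by (rule wp_mono) (use s'(1) in \<open>auto simp: I_def\<close>)
  next
    fix s' assume s': "I k s'" "agree_off (naive_level tot) s1 s'"
    then show "\<not> fst s' 43 < fst s' tot"
      using R1[OF s'(2)] by (simp add: I_def)
  next
    fix i s' assume i: "i \<le> k" and s': "I i s'" "agree_off (naive_level tot) s1 s'"
    have "fst s' 43 \<le> 2 * (2 ^ ?m * w)" "fst s' tot \<le> 2 * (2 ^ ?m * w)"
      using s'(1) R1[OF s'(2)] le[OF i] unfolding I_def by linarith+
    then show "1 + bits (fst s' 43) + bits (fst s' tot) \<le> 1 + 2 * b"
      using bits0[of "fst s' 43"] bits0[of "fst s' tot"] by linarith
  qed
  have D: "1 + 2 * b \<le> ?D" by (simp add: power2_eq_square)
  have D1: "?D \<le> 2 ^ ?m * ?D" by simp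
  have "k * (2 ^ ?m * (110 * ?D) + (1 + 2 * b)) \<le> k * (111 * (2 ^ ?m * ?D))"
    using D D1 by (intro mult_le_mono2) linarith
  moreover have "k * (111 * (2 ^ ?m * ?D)) = 111 * (k * (2 ^ ?m * ?D))"
    "(k + 1) * 2 ^ ?m * (120 * ?D) = 120 * (k * (2 ^ ?m * ?D)) + 120 * (2 ^ ?m * ?D)"
    by (simp_all add: algebra_simps)
  ultimately have bound: "k * (2 ^ ?m * (110 * ?D) + (1 + 2 * b)) + (1 + 2 * b) + (1 + b)
      \<le> (k + 1) * 2 ^ ?m * (120 * ?D)"
    using D D1 by linarith
  have "bits (2 ^ l * w) \<le> b"
    by (rule bits0) (use le[of 0] in \<open>simp only: add_0_right; linarith\<close>)
  then show ?thesis
    unfolding naive_def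
    by (intro wp_SeqI[where ?Q1.0 = "\<lambda>t s'. t \<le> 1 + b \<and> s' = s1"])
      (use R bound in \<open>auto simp: wp_simps s1_def readyD I_def simp del: floorlog_power
        intro!: wp_mono[OF loop[unfolded s1_def]]\<close>)
qed

end

section \<open>Passes over blocks\<close>

definition copy_step :: "arr \<Rightarrow> reg \<Rightarrow> arr \<Rightarrow> reg \<Rightarrow> reg \<Rightarrow> com" where
  "copy_step A dx B dy len = Seq (Load 35 A 32 len) (Seq (Store B 33 len 35)
     (Seq (Op Add 32 32 dx) (Seq (Op Add 33 33 dy) (Op Add 34 34 1))))"

text \<open>Register 2 holds zero, so adding it is a move; register 5 supplies the number
  \<open>2 ^ j\<close> of fields.\<close>

definition copy :: "arr \<Rightarrow> reg \<Rightarrow> reg \<Rightarrow> arr \<Rightarrow> reg \<Rightarrow> reg \<Rightarrow> reg \<Rightarrow> com" where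
  "copy A x dx B y dy len = Seq (Op Add 32 x 2) (Seq (Op Add 33 y 2) (Seq (Op Add 34 2 2)
     (WhileLess 34 5 (copy_step A dx B dy len))))"

lemma written_copy_step [simp]:
  "written_regs (copy_step A dx B dy len) = {32..35}" "written_arrs (copy_step A dx B dy len) = {B}"
  by (auto simp: copy_step_def)

lemma written_copy [simp]:
  "written_regs (copy A x dx B y dy len) = {32..35}" "written_arrs (copy A x dx B y dy len) = {B}"
  by (auto simp: copy_def)

text \<open>\<open>L \<le> DY\<close> keeps the target fields disjoint, so no store destroys an
  earlier one. The cost per field is linear in address length \<open>b\<close> plus field length
  \<open>L\<close>, hence linear in the data once \<open>L\<close> is of the order of
  \<open>b\<close>.\<close>

lemma wp_copy:
  assumes R: "fst s 1 = 1" "fst s 2 = 0" "fst s 5 = T" "fst s x = X" "fst s dx = DX"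
      "fst s y = Y" "fst s dy = DY" "fst s len = L"
    and regs: "x \<notin> {32..35}" "dx \<notin> {32..35}" "y \<notin> {32..35}" "dy \<notin> {32..35}" "len \<notin> {32..35}"
    and "A \<noteq> B" and L: "L \<le> DY" and T: "0 < T" "T < 2 ^ b"
    and X: "X + T * DX < 2 ^ b" and Y: "Y + T * DY < 2 ^ b"
  shows "wp (copy A x dx B y dy len) (\<lambda>t s'. t \<le> T * (12 * (1 + b) + 3 * L) + 5 * (1 + b) \<and>
      (\<forall>d<T. \<forall>t<L. snd s' B (Y + d * DY + t) = snd s A (X + d * DX + t)) \<and>
      (\<forall>p. (\<forall>d<T. \<forall>t<L. p \<noteq> Y + d * DY + t) \<longrightarrow> snd s' B p = snd s B p)) s"
proof -
  let ?c = "copy_step A dx B dy len"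
  define s1 where "s1 = ((fst s)(32 := X, 33 := Y, 34 := 0), snd s)"
  define I where "I i s' \<longleftrightarrow> fst s' 32 = X + i * DX \<and> fst s' 33 = Y + i * DY \<and> fst s' 34 = i \<and>
      (\<forall>d<i. \<forall>t<L. snd s' B (Y + d * DY + t) = snd s A (X + d * DX + t)) \<and>
      (\<forall>p. (\<forall>d<i. \<forall>t<L. p \<noteq> Y + d * DY + t) \<longrightarrow> snd s' B p = snd s B p)"
    for i and s' :: state
  have bX: "bits (X + i * DX) \<le> b" if "i \<le> T" for i
    using X that mult_le_mono1[OF that, of DX] by (intro bits_le) linarith
  have bY: "bits (Y + i * DY) \<le> b" if "i \<le> T" for i
    using Y that mult_le_mono1[OF that, of DY] by (intro bits_le) linarith
  have "DX \<le> T * DX" "DY \<le> T * DY" using T by simp_all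
  then have bD: "bits DX \<le> b" "bits DY \<le> b" "bits L \<le> b"
    using X Y L by (intro bits_le; linarith)+
  have bT: "bits i \<le> b" if "i \<le> T" for i using that T by (intro bits_le) linarith
  have ne: "r \<noteq> 32" "r \<noteq> 33" "r \<noteq> 34" "r \<noteq> 35" if "r \<notin> {32..35::nat}" for r
    using that by auto
  note ne = ne[OF regs(1)] ne[OF regs(2)] ne[OF regs(3)] ne[OF regs(4)] ne[OF regs(5)]
  have R1: "fst s' 1 = 1" "fst s' 5 = T" "fst s' dx = DX" "fst s' dy = DY" "fst s' len = L"
    "snd s' A = snd s A" if "agree_off ?c s1 s'" for s'
    using agree_off_reg[OF that, of 1] agree_off_reg[OF that, of 5] agree_off_reg[OF that, of dx]
      agree_off_reg[OF that, of dy] agree_off_reg[OF that, of len] agree_off_arr[OF that, of A]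
      R regs \<open>A \<noteq> B\<close> by (auto simp: s1_def)
  have loop: "wp (WhileLess 34 5 ?c)
      (\<lambda>t s'. t \<le> T * (5 + 10 * b + 3 * L + (1 + 2 * b)) + (1 + 2 * b) \<and> I T s' \<and> agree_off ?c s1 s') s1"
  proof (rule wp_While)
    show "I 0 s1" by (simp add: I_def s1_def)
  next
    fix i s' assume i: "i < T" and s': "I i s'" "agree_off ?c s1 s'"
    note R' = R1[OF s'(2)]
    show "fst s' 34 < fst s' 5" using i s' R' by (simp add: I_def)
    have I: "fst s' 32 = X + i * DX" "fst s' 33 = Y + i * DY" "fst s' 34 = i"
      using s'(1) by (simp_all add: I_def)
    show "wp ?c (\<lambda>t s''. t \<le> 5 + 10 * b + 3 * L \<and> I (Suc i) s'') s'"
    proof (rule wp_abstract, goal_cases)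
      case (1 Q)
      let ?v = "read_field (snd s A) (X + i * DX) L"
      show ?case
        unfolding copy_step_def
      proof (simp (no_asm) only: step_simps R' I ne, intro 1 conjI, goal_cases)
        case 1
        have "bits ?v \<le> L" by (rule bits_read_field)
        then show ?case
          unfolding op_cost.simps using bX[of i] bY[of i] bD bT[of i] bT[of 1] i by linarith
      next
        case 2
        have "(Y + i * DY + t) \<noteq> (Y + d * DY + t')" if "d < i" "t' < L" for d t t'
        proof -
          have "Suc d * DY \<le> i * DY" using that by (intro mult_le_mono1) simp
          then show ?thesis using that L by simp
        qed
        then have ne': "\<forall>t'<L. Y + d * DY + t \<noteq> Y + i * DY + t'" if "d < i" "t < L" for d t
          using that by metis
        let ?W = "write_field (snd s' B) (Y + i * DY) L ?v"
        have W1: "?W (Y + i * DY + t) = snd s A (X + i * DX + t)" if "t < L" for t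
          using that by (simp add: write_field_in bit_read_field)
        have W2: "?W p = snd s' B p" if "\<forall>t<L. p \<noteq> Y + i * DY + t" for p
        proof (rule write_field_out, rule ccontr)
          assume "\<not> (p < Y + i * DY \<or> Y + i * DY + L \<le> p)"
          then have "p - (Y + i * DY) < L" "p = Y + i * DY + (p - (Y + i * DY))" by linarith+
          then show False using that by blast
        qed
        have "?W (Y + d * DY + t) = snd s A (X + d * DX + t)" if "d < Suc i" "t < L" for d t
        proof (cases "d = i")
          case True
          then show ?thesis using W1 that by simp
        next
          case False
          then have d: "d < i" using that by simp
          show ?thesis
            using s'(1) d that(2) unfolding W2[OF ne'[OF d that(2)]] by (simp add: I_def)
        qed
        moreover have "?W p = snd s B p" if "\<forall>d<Suc i. \<forall>t<L. p \<noteq> Y + d * DY + t" for p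
        proof -
          have "\<forall>t<L. p \<noteq> Y + i * DY + t" using that by blast
          moreover have "\<forall>d<i. \<forall>t<L. p \<noteq> Y + d * DY + t" using that less_SucI by blast
          ultimately show ?thesis using s'(1) by (simp add: W2 I_def)
        qed
        ultimately show ?case by (simp add: I_def)
      qed
    qed
  next
    fix s' assume s': "I T s'" "agree_off ?c s1 s'"
    then show "\<not> fst s' 34 < fst s' 5" using R1[OF s'(2)] by (simp add: I_def)
  next
    fix i s' assume i: "i \<le> T" and s': "I i s'" "agree_off ?c s1 s'"
    then show "1 + bits (fst s' 34) + bits (fst s' 5) \<le> 1 + 2 * b"
      using R1[OF s'(2)] bT[of i] bT[of T] by (simp add: I_def)
  qed
  have aux: "t \<le> u + (1 + 2 * b) \<Longrightarrow> u \<le> v \<Longrightarrow> x \<le> b \<Longrightarrow> y \<le> b \<Longrightarrow>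
      1 + x + (1 + y + (1 + t)) \<le> v + 5 * (1 + b)" for t u v x y :: nat
    by simp
  show ?thesis
    unfolding copy_def
  proof (rule wp_abstract, goal_cases)
    case (1 Q)
    have "wp (WhileLess 34 5 ?c) (\<lambda>t. Q (1 + bits X + (1 + bits Y + (1 + t)))) s1"
    proof (rule wp_mono[OF loop], rule 1, goal_cases)
      case (1 t s')
      have "T * (5 + 10 * b + 3 * L + (1 + 2 * b)) = T * (6 + 12 * b + 3 * L)" by simp
      also have "\<dots> \<le> T * (12 * (1 + b) + 3 * L)" by (intro mult_le_mono2) simp
      finally have "1 + bits X + (1 + bits Y + (1 + t)) \<le> T * (12 * (1 + b) + 3 * L) + 5 * (1 + b)"
        using aux[OF conjunct1[OF 1] _ bX[OF le0] bY[OF le0]] unfolding mult_0 add_0_right by blast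
      then show ?case using 1 by (simp add: I_def)
    qed
    then show ?case
      by (simp only: step_simps R ne op_cost.simps bits_0 add_0_right s1_def)
  qed
qed

text \<open>Two positions share a block iff they differ only in the bits below \<open>e\<close>
  (place within a field) and the bits \<open>p\<close> to \<open>p + j - 1\<close> (number of the
  field). The remaining bits are concatenated in the order in which the nested loops of a pass run
  through them.\<close>

definition block_index :: "nat \<Rightarrow> nat \<Rightarrow> nat \<Rightarrow> nat \<Rightarrow> nat" where
  "block_index p e j i = i div 2 ^ (p + j) * 2 ^ (p - e) + i mod 2 ^ p div 2 ^ e"

text \<open>From the top, the binary digits of \<open>i\<close> are \<open>h\<close>, then
  \<open>d\<close> (\<open>j\<close> bits), \<open>y\<close> (\<open>p - e\<close> bits) and
  \<open>x\<close> (\<open>e\<close> bits); \<open>h\<close> and \<open>y\<close> select the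
  block.\<close>

lemma block_position:
  fixes x y z d :: nat
  assumes "e \<le> p" "y < 2 ^ (p - e)" "d < 2 ^ j" "x < 2 ^ e" "i = h * 2 ^ (p + j) + y * 2 ^ e + d * 2 ^ p + x"
  shows "block_index p e j i = h * 2 ^ (p - e) + y" "i < (h + 1) * 2 ^ (p + j)"
    "y * 2 ^ e + x < 2 ^ p"
proof -
  have p: "2 ^ p = (2::nat) ^ (p - e) * 2 ^ e" using assms(1) by (simp flip: power_add)
  have "Suc y * 2 ^ e \<le> 2 ^ p" unfolding p using assms(2) by (intro mult_le_mono1) simp
  then show yx: "y * 2 ^ e + x < 2 ^ p" using assms(4) by simp
  have i: "i = (h * 2 ^ j + d) * 2 ^ p + (y * 2 ^ e + x)"
    using assms(5) by (simp add: power_add algebra_simps)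
  have "i div 2 ^ p = h * 2 ^ j + d" "i mod 2 ^ p = y * 2 ^ e + x" using yx unfolding i by simp_all
  then show "block_index p e j i = h * 2 ^ (p - e) + y"
    using assms(3,4) by (simp add: block_index_def power_add div_mult2_eq)
  have "h * 2 ^ j + d + 1 \<le> (h + 1) * 2 ^ j" using assms(3) by simp
  then have "(h * 2 ^ j + d + 1) * 2 ^ p \<le> (h + 1) * 2 ^ j * 2 ^ p" by (rule mult_le_mono1)
  then show "i < (h + 1) * 2 ^ (p + j)"
    using yx unfolding i by (simp add: power_add algebra_simps)
qed

lemma block_indexE:
  assumes "block_index p e j i = h * 2 ^ (p - e) + y" "e \<le> p" "y < 2 ^ (p - e)"
  obtains d x where "d < 2 ^ j" "x < 2 ^ e" "i = h * 2 ^ (p + j) + y * 2 ^ e + d * 2 ^ p + x"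
proof -
  have "i mod 2 ^ p < 2 ^ (p - e) * 2 ^ e" using assms(2) by (simp flip: power_add)
  then have "i mod 2 ^ p div 2 ^ e < 2 ^ (p - e)" by (rule less_mult_imp_div_less)
  then have h: "i div 2 ^ (p + j) = h" "i mod 2 ^ p div 2 ^ e = y"
    using arg_cong[OF assms(1), of "\<lambda>k. k div 2 ^ (p - e)"]
      arg_cong[OF assms(1), of "\<lambda>k. k mod 2 ^ (p - e)"] assms(3)
    by (simp_all add: block_index_def)
  let ?d = "i div 2 ^ p mod 2 ^ j" and ?x = "i mod 2 ^ p mod 2 ^ e"
  have "i = (i div 2 ^ p div 2 ^ j * 2 ^ j + ?d) * 2 ^ p + (i mod 2 ^ p div 2 ^ e * 2 ^ e + ?x)"
    by (simp only: div_mult_mod_eq)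
  also have "i div 2 ^ p div 2 ^ j = h" using h by (simp add: power_add div_mult2_eq)
  finally have "i = h * 2 ^ (p + j) + y * 2 ^ e + ?d * 2 ^ p + ?x"
    unfolding h by (simp add: power_add algebra_simps)
  then show ?thesis using that[of ?d ?x] by simp
qed

definition block_step :: "arr \<Rightarrow> arr \<Rightarrow> reg \<Rightarrow> reg \<Rightarrow> reg \<Rightarrow> com \<Rightarrow> com" where
  "block_step A X a stride len inner =
     Seq (copy A a stride X 2 len len) (Seq inner (copy X 2 len A a stride len))"

definition inner_pass :: "arr \<Rightarrow> arr \<Rightarrow> reg \<Rightarrow> reg \<Rightarrow> reg \<Rightarrow> reg \<Rightarrow> reg \<Rightarrow> com \<Rightarrow> com" where
  "inner_pass A X stride len base lo a inner =
     Seq (Op Add a base lo) (Seq (block_step A X a stride len inner) (Op Add lo lo len))"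

definition outer_pass :: "arr \<Rightarrow> arr \<Rightarrow> reg \<Rightarrow> reg \<Rightarrow> reg \<Rightarrow> reg \<Rightarrow> reg \<Rightarrow> reg \<Rightarrow> com \<Rightarrow> com" where
  "outer_pass A X stride tp len base lo a inner =
     Seq (Op Add lo 2 2) (Seq (WhileLess lo stride (inner_pass A X stride len base lo a inner))
       (Op Add base base tp))"

text \<open>\<open>base\<close> runs through the groups of length \<open>tp\<close>,
  \<open>lo\<close> through the fields within one distance \<open>stride\<close>. The code is
  parametrised by registers and by \<open>inner\<close> because the \<open>inner\<close> of the main
  pass is itself a pass.\<close>

definition pass ::
  "arr \<Rightarrow> arr \<Rightarrow> reg \<Rightarrow> reg \<Rightarrow> reg \<Rightarrow> reg \<Rightarrow> reg \<Rightarrow> reg \<Rightarrow> reg \<Rightarrow> com \<Rightarrow> com" where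
  "pass A X stride tp tot len base lo a inner =
     Seq (Op Add base 2 2) (WhileLess base tot (outer_pass A X stride tp len base lo a inner))"

lemma written_block_step [simp]:
  "written_regs (block_step A X a stride len inner) = {32..35} \<union> written_regs inner"
  "written_arrs (block_step A X a stride len inner) = {A, X} \<union> written_arrs inner"
  by (auto simp: block_step_def)

lemma written_inner_pass [simp]:
  "written_regs (inner_pass A X stride len base lo a inner) = {lo, a} \<union> {32..35} \<union> written_regs inner"
  "written_arrs (inner_pass A X stride len base lo a inner) = {A, X} \<union> written_arrs inner"
  by (auto simp: inner_pass_def)

lemma written_outer_pass [simp]:
  "written_regs (outer_pass A X stride tp len base lo a inner) =
     {base, lo, a} \<union> {32..35} \<union> written_regs inner"
  "written_arrs (outer_pass A X stride tp len base lo a inner) = {A, X} \<union> written_arrs inner"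
  by (auto simp: outer_pass_def)

lemma written_pass [simp]:
  "written_regs (pass A X stride tp tot len base lo a inner) =
     {base, lo, a} \<union> {32..35} \<union> written_regs inner"
  "written_arrs (pass A X stride tp tot len base lo a inner) = {A, X} \<union> written_arrs inner"
  by (auto simp: pass_def)

context encoding begin

text \<open>A property of a single start state: inner code relies on registers and on the table,
  whose preservation is supplied by the frame of the enclosing pass.\<close>

definition transforms :: "arr \<Rightarrow> nat \<Rightarrow> nat \<Rightarrow> nat \<Rightarrow> nat \<Rightarrow> com \<Rightarrow> state \<Rightarrow> bool" where
  "transforms X m p j C c s \<longleftrightarrow> wp c (\<lambda>t s'. t \<le> C \<and>
     (\<forall>g. holds (snd s X) 0 (2 ^ m) g \<longrightarrow> holds (snd s' X) 0 (2 ^ m) (butterflies p j g))) s"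

definition copy_cost :: "nat \<Rightarrow> nat \<Rightarrow> nat \<Rightarrow> nat" where
  "copy_cost j e b = 2 ^ j * (12 * (1 + b) + 3 * (2 ^ e * w)) + 5 * (1 + b)"

text \<open>\<open>g\<close> is the current contents, where earlier blocks are already transformed,
  and \<open>f\<close> the original vector. They need to agree only on this block, because the
  levels in question do not mix blocks.\<close>

lemma wp_block_step:
  assumes R: "ready s" "fst s 5 = 2 ^ j" "fst s stride = 2 ^ p * w" "fst s len = 2 ^ e * w"
      "fst s a = (h * 2 ^ (p + j) + y * 2 ^ e) * w"
    and regs: "{1, 2, 5, a, stride, len} \<inter> ({32..35} \<union> written_regs inner) = {}"
    and arrs: "A \<noteq> X" "A \<notin> written_arrs inner"
    and inner: "\<And>s1. agree_off (block_step A X a stride len inner) s s1 \<Longrightarrow>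
      transforms X (e + j) e j C inner s1"
    and y: "e \<le> p" "y < 2 ^ (p - e)" and h: "(h + 1) * 2 ^ (p + j) \<le> 2 ^ n" and b: "n + overhead \<le> b"
  shows "wp (block_step A X a stride len inner) (\<lambda>t s'. t \<le> 2 * copy_cost j e b + C \<and>
      (\<forall>f g. holds (snd s A) 0 (2 ^ n) g \<and>
          (\<forall>i. block_index p e j i = h * 2 ^ (p - e) + y \<longrightarrow> g i = f i) \<longrightarrow>
        holds (snd s' A) 0 (2 ^ n)
          (\<lambda>i. if block_index p e j i = h * 2 ^ (p - e) + y then butterflies p j f i else g i))) s"
proof -
  define \<alpha> where "\<alpha> = h * 2 ^ (p + j) + y * 2 ^ e"
  let ?B = "block_step A X a stride len inner"
  let ?q = "h * 2 ^ (p - e) + y"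
  have a: "fst s a = \<alpha> * w" using R(5) by (simp add: \<alpha>_def)
  have pj: "2 ^ (p + j) \<le> (2::nat) ^ n"
    by (rule order_trans[OF _ h]) simp
  then have "p + j \<le> n" by (rule power_le_imp_le_exp[rotated]) simp
  have \<alpha>_le: "\<alpha> + 2 ^ j * 2 ^ p \<le> 2 * 2 ^ n"
  proof -
    have "\<alpha> < 2 ^ n"
      using block_position(2)[OF y, of 0 j 0 \<alpha> h] h by (simp add: \<alpha>_def)
    then show ?thesis using pj by (simp add: power_add mult.commute)
  qed
  have X: "\<alpha> * w + 2 ^ j * (2 ^ p * w) < 2 ^ b"
    using mult_le_mono1[OF \<alpha>_le, of w] by (intro two_power_less_overhead[OF b]) (simp add: algebra_simps)
  have Y: "0 + 2 ^ j * (2 ^ e * w) < 2 ^ b"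
  proof (rule two_power_less_overhead[OF b])
    have "2 ^ j * (2 ^ e * w) \<le> 2 ^ j * (2 ^ p * w)" using y(1) by (intro mult_le_mono) simp_all
    also have "\<dots> = 2 ^ (p + j) * w" by (simp add: power_add)
    also have "\<dots> \<le> 2 ^ n * w" using pj by (rule mult_le_mono1)
    finally show "0 + 2 ^ j * (2 ^ e * w) \<le> 2 * (2 ^ n * w)" by linarith
  qed
  have T: "(2::nat) ^ j < 2 ^ b" "(0::nat) < 2 ^ j"
    using \<open>p + j \<le> n\<close> b by (simp_all add: overhead_def)
  have L: "2 ^ e * w \<le> 2 ^ p * w" using y(1) by (intro mult_le_mono1) simp
  have tn: "r \<notin> {32..35}" "r \<notin> written_regs inner" if "r \<in> {1, 2, 5, a, stride, len}" for r
    using regs that by blast+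
  have R': "fst s' 1 = 1" "fst s' 2 = 0" "fst s' 5 = 2 ^ j" "fst s' stride = 2 ^ p * w"
      "fst s' len = 2 ^ e * w" "fst s' a = \<alpha> * w" if "agree_off ?B s s'" for s'
  proof -
    have "fst s' r = fst s r" if "r \<in> {1, 2, 5, a, stride, len}" for r
      using agree_off_reg[OF \<open>agree_off ?B s s'\<close>, of r] tn[OF that] by simp
    then show "fst s' 1 = 1" "fst s' 2 = 0" "fst s' 5 = 2 ^ j" "fst s' stride = 2 ^ p * w"
      "fst s' len = 2 ^ e * w" "fst s' a = \<alpha> * w"
      using R a by (simp_all add: ready_def)
  qed
  let ?gather = "copy A a stride X 2 len len" and ?scatter = "copy X 2 len A a stride len"
  let ?P1 = "\<lambda>s1. (\<forall>d<2 ^ j. \<forall>t<2 ^ e * w. snd s1 X (0 + d * (2 ^ e * w) + t) = snd s A (\<alpha> * w + d * (2 ^ p * w) + t))"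
  have "wp ?gather (\<lambda>t s1. t \<le> copy_cost j e b \<and> ?P1 s1 \<and>
      (\<forall>r. (\<forall>d<2 ^ j. \<forall>t<2 ^ e * w. r \<noteq> 0 + d * (2 ^ e * w) + t) \<longrightarrow> snd s1 X r = snd s X r)) s"
    unfolding copy_cost_def
    by (rule wp_copy[of s "2 ^ j" a "\<alpha> * w" stride "2 ^ p * w" 2 0 len "2 ^ e * w" len "2 ^ e * w" A X b])
      (use R'[OF agree_off_refl] tn arrs(1) X Y T in \<open>simp_all only: order_refl simp_thms insert_iff\<close>)
  then have 1: "wp ?gather (\<lambda>t s1. (t \<le> copy_cost j e b \<and> ?P1 s1) \<and> agree_off ?gather s s1) s"
    by (rule wp_mono[OF wp_frame]) blast
  show ?thesis
    unfolding block_step_def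
  proof (rule wp_SeqI[OF 1])
    fix t1 s1 assume s1: "(t1 \<le> copy_cost j e b \<and> ?P1 s1) \<and> agree_off ?gather s s1"
    then have ag1: "agree_off ?B s s1" by (auto elim!: agree_off_sub)
    have A1: "snd s1 A = snd s A" using s1 arrs by (auto dest: agree_off_arr[of _ _ _ A])
    let ?P2 = "\<lambda>s2. \<forall>g. holds (snd s1 X) 0 (2 ^ (e + j)) g \<longrightarrow> holds (snd s2 X) 0 (2 ^ (e + j)) (butterflies e j g)"
    have 2: "wp inner (\<lambda>t s2. (t \<le> C \<and> ?P2 s2) \<and> agree_off inner s1 s2) s1"
      using inner[OF ag1] unfolding transforms_def by (rule wp_frame)
    show "wp (Seq inner ?scatter) (\<lambda>t2 s'. t1 + t2 \<le> 2 * copy_cost j e b + C \<and>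
      (\<forall>f g. holds (snd s A) 0 (2 ^ n) g \<and> (\<forall>i. block_index p e j i = ?q \<longrightarrow> g i = f i) \<longrightarrow>
        holds (snd s' A) 0 (2 ^ n) (\<lambda>i. if block_index p e j i = ?q then butterflies p j f i else g i))) s1"
    proof (rule wp_SeqI[OF 2])
      fix t2 s2 assume s2: "(t2 \<le> C \<and> ?P2 s2) \<and> agree_off inner s1 s2"
      then have "agree_off ?B s1 s2" by (auto elim!: agree_off_sub)
      with ag1 have ag2: "agree_off ?B s s2" by (rule agree_off_trans)
      have A2: "snd s2 A = snd s A" using s2 arrs A1 by (auto dest: agree_off_arr[of _ _ _ A])
      let ?P3 = "\<lambda>s3. (\<forall>d<2 ^ j. \<forall>t<2 ^ e * w. snd s3 A (\<alpha> * w + d * (2 ^ p * w) + t) = snd s2 X (0 + d * (2 ^ e * w) + t)) \<and>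
        (\<forall>r. (\<forall>d<2 ^ j. \<forall>t<2 ^ e * w. r \<noteq> \<alpha> * w + d * (2 ^ p * w) + t) \<longrightarrow> snd s3 A r = snd s2 A r)"
      have 3: "wp ?scatter (\<lambda>t s3. t \<le> copy_cost j e b \<and> ?P3 s3) s2"
        unfolding copy_cost_def
        by (rule wp_copy[of s2 "2 ^ j" 2 0 len "2 ^ e * w" a "\<alpha> * w" stride "2 ^ p * w" len "2 ^ e * w" X A b])
          (use R'[OF ag2] tn arrs(1) X Y T L in \<open>simp_all only: order_refl simp_thms insert_iff not_sym\<close>)
      show "wp ?scatter (\<lambda>t3 s'. t1 + (t2 + t3) \<le> 2 * copy_cost j e b + C \<and>
        (\<forall>f g. holds (snd s A) 0 (2 ^ n) g \<and> (\<forall>i. block_index p e j i = ?q \<longrightarrow> g i = f i) \<longrightarrow>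
          holds (snd s' A) 0 (2 ^ n) (\<lambda>i. if block_index p e j i = ?q then butterflies p j f i else g i))) s2"
      proof (rule wp_mono[OF 3], intro conjI allI impI, goal_cases)
        case (1 t3 s3)
        then show ?case using s1 s2 by linarith
      next
        case (2 t3 s3 f g)
        then have P3: "?P3 s3" and hg: "holds (snd s A) 0 (2 ^ n) g"
          and gf: "\<And>i. block_index p e j i = ?q \<Longrightarrow> g i = f i" by blast+
        \<comment> \<open>The gathered block: entry \<open>i mod 2 ^ e\<close> of field
          \<open>i div 2 ^ e\<close>.\<close>
        define G where "G i = f (\<alpha> + i div 2 ^ e * 2 ^ p + i mod 2 ^ e)" for i
        have pos: "block_index p e j (\<alpha> + d * 2 ^ p + x) = ?q" "\<alpha> + d * 2 ^ p + x < 2 ^ n"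
          if "d < 2 ^ j" "x < 2 ^ e" for d x
          using block_position[OF y that, of "\<alpha> + d * 2 ^ p + x" h] h by (auto simp: \<alpha>_def)
        have sh: "\<alpha> * w + d * (2 ^ p * w) + (x * w + t) = 0 + (\<alpha> + d * 2 ^ p + x) * w + t"
          "0 + d * (2 ^ e * w) + (x * w + t) = 0 + (d * 2 ^ e + x) * w + t" for d x t
          by (simp_all add: algebra_simps)
        have dx: "d * 2 ^ e + x < 2 ^ (e + j)" if "d < 2 ^ j" "x < 2 ^ e" for d x :: nat
        proof -
          have "Suc d * 2 ^ e \<le> 2 ^ j * 2 ^ e" using that by (intro mult_le_mono1) simp
          then show ?thesis using that by (simp add: power_add mult.commute)
        qed
        have "holds (snd s1 X) 0 (2 ^ (e + j)) G"
          unfolding holds_def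
        proof (intro allI impI)
          fix i t :: nat assume i: "i < 2 ^ (e + j)" and t: "t < w"
          let ?d = "i div 2 ^ e" and ?x = "i mod 2 ^ e"
          have d: "?d < 2 ^ j" using i by (simp add: power_add less_mult_imp_div_less mult.commute)
          have x: "?x < 2 ^ e" by simp
          have "snd s1 X (0 + (?d * 2 ^ e + ?x) * w + t) = snd s A (0 + (\<alpha> + ?d * 2 ^ p + ?x) * w + t)"
            using s1 d field_index_less[OF x t] unfolding sh[symmetric] by blast
          also have "\<dots> = bit (enc (G i)) t"
            using hg pos[OF d x] t gf[OF pos(1)[OF d x]] unfolding holds_def G_def by simp
          finally show "snd s1 X (0 + i * w + t) = bit (enc (G i)) t" unfolding div_mult_mod_eq .
        qed
        then have X2: "holds (snd s2 X) 0 (2 ^ (e + j)) (butterflies e j G)" using s2 by blast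
        show ?case
          unfolding holds_def
        proof (intro allI impI)
          fix i t :: nat assume i: "i < 2 ^ n" and t: "t < w"
          show "snd s3 A (0 + i * w + t) =
            bit (enc (if block_index p e j i = ?q then butterflies p j f i else g i)) t"
          proof (cases "block_index p e j i = ?q")
            case True
            then obtain d x where d: "d < 2 ^ j" and x: "x < 2 ^ e" and i': "i = \<alpha> + d * 2 ^ p + x"
              using block_indexE[OF _ y] unfolding \<alpha>_def by metis
            \<comment> \<open>For fixed \<open>x\<close>, distance \<open>2 ^ p\<close> in
              \<open>A\<close> has become distance \<open>2 ^ e\<close> in \<open>X\<close>.\<close>
            have "butterflies p j f ((\<alpha> + x) + d * 2 ^ p) = butterflies e j G (x + d * 2 ^ e)"
            proof (rule butterflies_reindex[OF _ _ _ d])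
              have eq: "\<alpha> + x = h * 2 ^ j * 2 ^ p + (y * 2 ^ e + x)" by (simp add: \<alpha>_def power_add)
              have "(y * 2 ^ e + x) div 2 ^ p = 0" using block_position(3)[OF y d x refl] by simp
              moreover have "(h * 2 ^ j * 2 ^ p + (y * 2 ^ e + x)) div 2 ^ p = h * 2 ^ j + (y * 2 ^ e + x) div 2 ^ p"
                by (rule div_mult_self3) simp
              ultimately show "(\<alpha> + x) div 2 ^ p mod 2 ^ j = 0"
                unfolding eq by (simp only: add_0_right mod_mult_self2_is_0)
              show "x div 2 ^ e mod 2 ^ j = 0" using x by simp
              show "f (\<alpha> + x + d * 2 ^ p) = G (x + d * 2 ^ e)" for d
                using x by (simp add: G_def algebra_simps)
            qed
            then have "butterflies p j f i = butterflies e j G (d * 2 ^ e + x)"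
              by (simp add: i' algebra_simps)
            moreover have "snd s3 A (0 + i * w + t) = snd s2 X (0 + (d * 2 ^ e + x) * w + t)"
              using P3 d field_index_less[OF x t] unfolding i' sh[symmetric] by blast
            ultimately show ?thesis
              using True X2 dx[OF d x] t by (simp add: holds_def)
          next
            case False
            \<comment> \<open>Fields consist of whole entries: dividing a common bit address by
              \<open>w\<close> would put \<open>i\<close> into the block.\<close>
            have "0 + i * w + t \<noteq> \<alpha> * w + d * (2 ^ p * w) + t'" if d: "d < 2 ^ j" and t': "t' < 2 ^ e * w" for d t'
            proof
              let ?x = "t' div w"
              have x: "?x < 2 ^ e" using t' by (simp add: less_mult_imp_div_less)
              assume "0 + i * w + t = \<alpha> * w + d * (2 ^ p * w) + t'"
              also have "\<dots> = (\<alpha> + d * 2 ^ p + ?x) * w + t' mod w"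
                using div_mult_mod_eq[of t' w] by (simp add: algebra_simps)
              finally have "(i * w + t) div w = ((\<alpha> + d * 2 ^ p + ?x) * w + t' mod w) div w" by simp
              then have "i = \<alpha> + d * 2 ^ p + ?x" using t w_pos by simp
              then show False using False pos(1)[OF d x] by simp
            qed
            then have "snd s3 A (0 + i * w + t) = snd s2 A (0 + i * w + t)" using P3 by blast
            then show ?thesis using False hg i t A2 by (simp add: holds_def)
          qed
        qed
      qed
    qed
  qed
qed


text \<open>A block has \<open>2 ^ (j + e)\<close> entries, which gives the number of blocks;
  \<open>20 * (1 + b)\<close> absorbs the loop control of both loops.\<close>

definition pass_cost :: "nat \<Rightarrow> nat \<Rightarrow> nat \<Rightarrow> nat \<Rightarrow> nat \<Rightarrow> nat" where
  "pass_cost n j e b C = 2 ^ (n - j - e) * (2 * copy_cost j e b + C + 20 * (1 + b))"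

text \<open>Gathering \<open>2 ^ j\<close> fields of \<open>2 ^ e\<close> entries at distance \<open>2 ^ p\<close> turns the levels from \<open>p\<close>
  on of \<open>A\<close> into the levels from \<open>e\<close> on of the scratch array \<open>X\<close>, which \<open>inner\<close> performs.\<close>

lemma transforms_pass:
  assumes R: "ready s" "fst s 5 = 2 ^ j" "fst s stride = 2 ^ p * w" "fst s tp = 2 ^ (p + j) * w"
      "fst s tot = 2 ^ n * w" "fst s len = 2 ^ e * w"
    and regs: "{1, 2, 3, 5, 12, 17, stride, tp, tot, len} \<inter> ({base, lo, a} \<union> {32..35} \<union> written_regs inner) = {}"
      "{base, lo, a} \<inter> ({32..35} \<union> written_regs inner) = {}" "base \<noteq> lo" "base \<noteq> a" "lo \<noteq> a"
    and arrs: "A \<noteq> X" "A \<notin> written_arrs inner"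
    and inner: "\<And>s1. agree_off (pass A X stride tp tot len base lo a inner) s s1 \<Longrightarrow>
      transforms X (e + j) e j C inner s1"
    and n: "e \<le> p" "p + j \<le> n" and b: "n + overhead \<le> b"
  shows "transforms A n p j (pass_cost n j e b C) (pass A X stride tp tot len base lo a inner) s"
proof -
  let ?P = "pass A X stride tp tot len base lo a inner"
  let ?O = "outer_pass A X stride tp len base lo a inner"
  let ?N = "inner_pass A X stride len base lo a inner"
  let ?S = "block_step A X a stride len inner"
  \<comment> \<open>Blocks are visited in increasing \<open>block_index\<close>; the state after
    \<open>c\<close> of them is the loop invariant.\<close>
  define part where "part f c i = (if block_index p e j i < c then butterflies p j f i else f i)"
    for f :: "nat \<Rightarrow> 'a" and c i
  define H where "H = (2::nat) ^ (n - p - j)"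
  define K where "K = (2::nat) ^ (p - e)"
  have Kp: "K * 2 ^ e = 2 ^ p" using n by (simp add: K_def flip: power_add)
  have Hn: "H * 2 ^ (p + j) = 2 ^ n" using n by (simp add: H_def flip: power_add)
  have HK: "H * K = 2 ^ (n - j - e)" using n by (simp add: H_def K_def flip: power_add)
  have bits0: "bits z \<le> b" if "z \<le> 2 * (2 ^ n * w)" for z
    using bits_le two_power_less_overhead[OF b that] .
  have tn: "r \<noteq> base" "r \<noteq> lo" "r \<noteq> a" "r \<notin> {32..35}" "r \<notin> written_regs inner"
    if "r \<in> {1, 2, 3, 5, 12, 17, stride, tp, tot, len}" for r
    using regs(1) that by blast+
  have tb: "r \<notin> {32..35}" "r \<notin> written_regs inner" if "r \<in> {base, lo, a}" for r
    using regs(2) that by blast+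
  have R': "ready s'" "fst s' 5 = 2 ^ j" "fst s' stride = 2 ^ p * w" "fst s' tp = 2 ^ (p + j) * w"
      "fst s' tot = 2 ^ n * w" "fst s' len = 2 ^ e * w" "fst s' 2 = 0" if "agree_off ?P s s'" for s'
  proof -
    have "fst s' r = fst s r" if "r \<in> {1, 2, 3, 5, 12, 17, stride, tp, tot, len}" for r
      using agree_off_reg[OF \<open>agree_off ?P s s'\<close>, of r] tn[OF that] by simp
    then show "ready s'" "fst s' 5 = 2 ^ j" "fst s' stride = 2 ^ p * w" "fst s' tp = 2 ^ (p + j) * w"
      "fst s' tot = 2 ^ n * w" "fst s' len = 2 ^ e * w" "fst s' 2 = 0"
      using R by (simp_all add: ready_def)
  qed
  have P_le: "2 ^ p * w \<le> 2 ^ (p + j) * w" "2 ^ (p + j) * w \<le> 2 ^ n * w" "2 ^ e * w \<le> 2 ^ p * w"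
    using n by (intro mult_le_mono1; simp)+
  have cost_le: "1 + bits x + bits y \<le> 1 + 2 * b" if "x \<le> 2 * (2 ^ n * w)" "y \<le> 2 * (2 ^ n * w)" for x y
    using bits0[OF that(1)] bits0[OF that(2)] by linarith
  let ?CB = "2 * copy_cost j e b + C"
  have inner_step: "wp ?N (\<lambda>t s'. t \<le> ?CB + 2 + 4 * b \<and>
      fst s' lo = Suc y * (2 ^ e * w) \<and> fst s' base = fst s1 base \<and>
      (\<forall>f. holds (snd s1 A) 0 (2 ^ n) (part f (h * K + y)) \<longrightarrow>
        holds (snd s' A) 0 (2 ^ n) (part f (h * K + Suc y)))) s1"
    if ag: "agree_off ?P s s1" and h: "h < H" and y: "y < K"
      and base: "fst s1 base = h * (2 ^ (p + j) * w)" and lo: "fst s1 lo = y * (2 ^ e * w)" for s1 h y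
  proof -
    have "Suc h * 2 ^ (p + j) \<le> H * 2 ^ (p + j)" using h by (intro mult_le_mono1) simp
    then have h': "(h + 1) * 2 ^ (p + j) \<le> 2 ^ n" using Hn by simp
    then have "(h + 1) * 2 ^ (p + j) * w \<le> 2 ^ n * w" by (rule mult_le_mono1)
    then have bb: "h * (2 ^ (p + j) * w) + 2 ^ (p + j) * w \<le> 2 ^ n * w" by (simp add: algebra_simps)
    have "Suc y * 2 ^ e \<le> K * 2 ^ e" using y by (intro mult_le_mono1) simp
    then have "Suc y * 2 ^ e * w \<le> 2 ^ p * w" unfolding Kp by (rule mult_le_mono1)
    then have yy: "y * (2 ^ e * w) + 2 ^ e * w \<le> 2 ^ p * w" by (simp add: algebra_simps)
    define s2 where "s2 = ((fst s1)(a := (h * 2 ^ (p + j) + y * 2 ^ e) * w), snd s1)"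
    have "agree_off ?P s1 s2" by (simp add: agree_off_def s2_def)
    with ag have ag2: "agree_off ?P s s2" by (rule agree_off_trans)
    have step: "wp ?S (\<lambda>t s'. (t \<le> ?CB \<and>
      (\<forall>f g. holds (snd s2 A) 0 (2 ^ n) g \<and>
          (\<forall>i. block_index p e j i = h * 2 ^ (p - e) + y \<longrightarrow> g i = f i) \<longrightarrow>
        holds (snd s' A) 0 (2 ^ n)
          (\<lambda>i. if block_index p e j i = h * 2 ^ (p - e) + y then butterflies p j f i else g i))) \<and>
      agree_off ?S s2 s') s2"
    proof (rule wp_frame, rule wp_block_step)
      show "ready s2" "fst s2 5 = 2 ^ j" "fst s2 stride = 2 ^ p * w" "fst s2 len = 2 ^ e * w"
        using R'[OF ag2] by simp_all
      show "fst s2 a = (h * 2 ^ (p + j) + y * 2 ^ e) * w" by (simp add: s2_def)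
      show "{1, 2, 5, a, stride, len} \<inter> ({32..35} \<union> written_regs inner) = {}"
        using regs(1,2) by blast
      show "transforms X (e + j) e j C inner s3" if "agree_off ?S s2 s3" for s3
      proof (rule inner)
        have "agree_off ?P s2 s3" using that by (rule agree_off_sub) auto
        with ag2 show "agree_off ?P s s3" by (rule agree_off_trans)
      qed
    qed (use arrs n h' b y in \<open>simp_all add: K_def\<close>)
    have c1: "op_cost Add (h * (2 ^ (p + j) * w)) (y * (2 ^ e * w)) \<le> 1 + 2 * b"
      "op_cost Add (y * (2 ^ e * w)) (2 ^ e * w) \<le> 1 + 2 * b"
      unfolding op_cost.simps by (rule cost_le; use bb yy P_le in linarith)+
    have al: "h * (2 ^ (p + j) * w) + y * (2 ^ e * w) = (h * 2 ^ (p + j) + y * 2 ^ e) * w"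
      by (simp add: algebra_simps)
    show ?thesis
      unfolding inner_pass_def
    proof (rule wp_SeqI[where ?Q1.0 = "\<lambda>t s'. t = op_cost Add (h * (2 ^ (p + j) * w)) (y * (2 ^ e * w)) \<and> s' = s2"], goal_cases)
      case 1
      then show ?case by (simp only: step_simps base lo al s2_def)
    next
      case (2 t1 s2')
      then have t1: "t1 \<le> 1 + 2 * b" and s2': "s2' = s2" using c1 by auto
      show ?case
        unfolding s2'
      proof (rule wp_SeqI[OF step], goal_cases)
        case (1 t2 s3)
        then have t2: "t2 \<le> ?CB" and ag3: "agree_off ?S s2 s3"
          and post: "\<And>f g. holds (snd s1 A) 0 (2 ^ n) g \<Longrightarrow>
            (\<And>i. block_index p e j i = h * K + y \<Longrightarrow> g i = f i) \<Longrightarrow>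
            holds (snd s3 A) 0 (2 ^ n)
              (\<lambda>i. if block_index p e j i = h * K + y then butterflies p j f i else g i)"
          by (auto simp: s2_def K_def)
        have r3: "fst s3 lo = y * (2 ^ e * w)" "fst s3 base = fst s1 base" "fst s3 len = 2 ^ e * w"
          using agree_off_reg[OF ag3, of lo] agree_off_reg[OF ag3, of base] agree_off_reg[OF ag3, of len]
            tb[of lo] tb[of base] tn[of len] lo regs(3-5) R'(6)[OF ag2]
          by (auto simp: s2_def)
        have "holds (snd s3 A) 0 (2 ^ n) (part f (h * K + Suc y))"
          if "holds (snd s1 A) 0 (2 ^ n) (part f (h * K + y))" for f
          by (rule holds_cong[OF post[OF that, of f]]) (auto simp: part_def)
        then show ?case
          using t1 t2 c1 regs(3-5) base by (auto simp: wp_simps r3 simp del: op_cost.simps)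
      qed
    qed
  qed
  let ?C1 = "K * (?CB + 2 + 4 * b + (1 + 2 * b)) + (1 + 2 * b)"
  have outer_step: "wp ?O (\<lambda>t s'. t \<le> ?C1 + 2 + 2 * b \<and>
      fst s' base = Suc h * (2 ^ (p + j) * w) \<and>
      (\<forall>f. holds (snd s1 A) 0 (2 ^ n) (part f (h * K)) \<longrightarrow>
        holds (snd s' A) 0 (2 ^ n) (part f (Suc h * K)))) s1"
    if ag: "agree_off ?P s s1" and h: "h < H" and base: "fst s1 base = h * (2 ^ (p + j) * w)" for s1 h
  proof -
    have "Suc h * 2 ^ (p + j) \<le> H * 2 ^ (p + j)" using h by (intro mult_le_mono1) simp
    then have "(h + 1) * 2 ^ (p + j) \<le> 2 ^ n" using Hn by simp
    then have "(h + 1) * 2 ^ (p + j) * w \<le> 2 ^ n * w" by (rule mult_le_mono1)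
    then have bb: "h * (2 ^ (p + j) * w) + 2 ^ (p + j) * w \<le> 2 ^ n * w" by (simp add: algebra_simps)
    define s2 where "s2 = ((fst s1)(lo := 0), snd s1)"
    have "agree_off ?P s1 s2" by (simp add: agree_off_def s2_def)
    with ag have ag2: "agree_off ?P s s2" by (rule agree_off_trans)
    have agP: "agree_off ?P s s'" if "agree_off ?N s2 s'" for s'
    proof -
      have "agree_off ?P s2 s'" using that by (rule agree_off_sub) auto
      with ag2 show ?thesis by (rule agree_off_trans)
    qed
    define I where "I y s' \<longleftrightarrow> fst s' lo = y * (2 ^ e * w) \<and> fst s' base = h * (2 ^ (p + j) * w) \<and>
      (\<forall>f. holds (snd s1 A) 0 (2 ^ n) (part f (h * K)) \<longrightarrow>
        holds (snd s' A) 0 (2 ^ n) (part f (h * K + y)))" for y and s' :: state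
    have K_eq: "K * (2 ^ e * w) = 2 ^ p * w" by (simp flip: Kp)
    have K_le: "y * (2 ^ e * w) \<le> 2 ^ p * w" if "y \<le> K" for y
      using mult_le_mono1[OF that, of "2 ^ e * w"] K_eq by simp
    have loop: "wp (WhileLess lo stride ?N) (\<lambda>t s'. t \<le> ?C1 \<and> I K s' \<and> agree_off ?N s2 s') s2"
    proof (rule wp_While)
      show "I 0 s2" using base regs(3) by (simp add: I_def s2_def)
    next
      fix y s' assume y: "y < K" and s': "I y s'" "agree_off ?N s2 s'"
      have "y * (2 ^ e * w) < K * (2 ^ e * w)" using y w_pos by (intro mult_strict_right_mono) simp_all
      then show "fst s' lo < fst s' stride"
        using s'(1) R'(3)[OF agP[OF s'(2)]] K_eq by (simp add: I_def)
      show "wp ?N (\<lambda>t s''. t \<le> ?CB + 2 + 4 * b \<and> I (Suc y) s'') s'"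
        by (rule wp_mono[OF inner_step[OF agP[OF s'(2)] h y]]) (use s'(1) in \<open>auto simp: I_def\<close>)
    next
      fix s' assume s': "I K s'" "agree_off ?N s2 s'"
      then show "\<not> fst s' lo < fst s' stride"
        using R'(3)[OF agP[OF s'(2)]] K_eq by (simp add: I_def)
    next
      fix y s' assume y: "y \<le> K" and s': "I y s'" "agree_off ?N s2 s'"
      have "fst s' lo \<le> 2 * (2 ^ n * w)" "fst s' stride \<le> 2 * (2 ^ n * w)"
        using K_le[OF y] s'(1) P_le R'(3)[OF agP[OF s'(2)]] unfolding I_def by linarith+
      then show "1 + bits (fst s' lo) + bits (fst s' stride) \<le> 1 + 2 * b" by (rule cost_le)
    qed
    show ?thesis
      unfolding outer_pass_def
    proof (rule wp_SeqI[where ?Q1.0 = "\<lambda>t s'. t = 1 \<and> s' = s2"], goal_cases)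
      case 1
      then show ?case using R'(7)[OF ag] by (simp add: wp_simps s2_def)
    next
      case (2 t1 s2')
      then have t1: "t1 = 1" and s2': "s2' = s2" by auto
      show ?case
        unfolding s2' t1
      proof (rule wp_SeqI[OF loop], goal_cases)
        case (1 t2 s3)
        then have r3: "fst s3 base = h * (2 ^ (p + j) * w)" "fst s3 tp = 2 ^ (p + j) * w"
          using R'(4)[OF agP] by (auto simp: I_def)
        have "op_cost Add (h * (2 ^ (p + j) * w)) (2 ^ (p + j) * w) \<le> 1 + 2 * b"
          unfolding op_cost.simps by (rule cost_le; use bb in linarith)
        then show ?case
          using 1 by (auto simp: wp_simps r3 I_def add.commute simp del: op_cost.simps)
      qed
    qed
  qed
  define s0 where "s0 = ((fst s)(base := 0), snd s)"
  have "agree_off ?P s s0" by (simp add: agree_off_def s0_def)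
  have agP: "agree_off ?P s s'" if "agree_off ?O s0 s'" for s'
  proof -
    have "agree_off ?P s0 s'" using that by (rule agree_off_sub) auto
    with \<open>agree_off ?P s s0\<close> show ?thesis by (rule agree_off_trans)
  qed
  define I where "I h s' \<longleftrightarrow> fst s' base = h * (2 ^ (p + j) * w) \<and>
      (\<forall>f. holds (snd s A) 0 (2 ^ n) f \<longrightarrow> holds (snd s' A) 0 (2 ^ n) (part f (h * K)))"
    for h and s' :: state
  have H_eq: "H * (2 ^ (p + j) * w) = 2 ^ n * w" by (simp flip: Hn)
  have H_le: "h * (2 ^ (p + j) * w) \<le> 2 ^ n * w" if "h \<le> H" for h
    using mult_le_mono1[OF that, of "2 ^ (p + j) * w"] H_eq by simp
  have loop: "wp (WhileLess base tot ?O) (\<lambda>t s'. t \<le> H * (?C1 + 2 + 2 * b + (1 + 2 * b)) + (1 + 2 * b) \<and>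
      I H s' \<and> agree_off ?O s0 s') s0"
  proof (rule wp_While)
    have "part f 0 = f" for f by (rule ext) (simp add: part_def)
    then show "I 0 s0" by (simp add: I_def s0_def)
  next
    fix h s' assume h: "h < H" and s': "I h s'" "agree_off ?O s0 s'"
    have "h * (2 ^ (p + j) * w) < H * (2 ^ (p + j) * w)"
      using h w_pos by (intro mult_strict_right_mono) simp_all
    then show "fst s' base < fst s' tot"
      using s'(1) R'(5)[OF agP[OF s'(2)]] H_eq by (simp add: I_def)
    show "wp ?O (\<lambda>t s''. t \<le> ?C1 + 2 + 2 * b \<and> I (Suc h) s'') s'"
      by (rule wp_mono[OF outer_step[OF agP[OF s'(2)] h]]) (use s'(1) in \<open>auto simp: I_def\<close>)
  next
    fix s' assume s': "I H s'" "agree_off ?O s0 s'"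
    then show "\<not> fst s' base < fst s' tot"
      using R'(5)[OF agP[OF s'(2)]] H_eq by (simp add: I_def)
  next
    fix h s' assume h: "h \<le> H" and s': "I h s'" "agree_off ?O s0 s'"
    have "fst s' base \<le> 2 * (2 ^ n * w)" "fst s' tot \<le> 2 * (2 ^ n * w)"
      using H_le[OF h] s'(1) R'(5)[OF agP[OF s'(2)]] unfolding I_def by linarith+
    then show "1 + bits (fst s' base) + bits (fst s' tot) \<le> 1 + 2 * b" by (rule cost_le)
  qed
  have full: "holds m 0 (2 ^ n) (butterflies p j f)" if "holds m 0 (2 ^ n) (part f (H * K))" for m f
    using that
  proof (rule holds_cong)
    fix i :: nat assume "i < 2 ^ n"
    then have "i div 2 ^ (p + j) < H" by (intro less_mult_imp_div_less) (simp add: Hn)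
    then have "Suc (i div 2 ^ (p + j)) * K \<le> H * K" by (intro mult_le_mono1) simp
    moreover have "i mod 2 ^ p div 2 ^ e < K" by (intro less_mult_imp_div_less) (simp add: Kp)
    ultimately have "block_index p e j i < H * K" by (simp add: block_index_def K_def)
    then show "butterflies p j f i = part f (H * K) i" by (simp add: part_def)
  qed
  \<comment> \<open>Costs incurred once per outer iteration or once per pass are charged to the
    \<open>H * K\<close> blocks.\<close>
  have "1 \<le> H" "1 \<le> K" by (simp_all add: H_def K_def)
  then have "H \<le> H * K" "1 \<le> H * K" by simp_all
  have "H * (?C1 + 2 + 2 * b + (1 + 2 * b)) + (1 + 2 * b) + 1 =
      H * K * (?CB + 3 + 6 * b) + H * (4 + 6 * b) + 1 * (2 + 2 * b)"
    by (simp add: algebra_simps)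
  also have "\<dots> \<le> H * K * (?CB + 3 + 6 * b) + H * K * (4 + 6 * b) + H * K * (2 + 2 * b)"
    using \<open>H \<le> H * K\<close> \<open>1 \<le> H * K\<close> by (intro add_mono mult_le_mono order_refl)
  also have "\<dots> = H * K * (?CB + 9 + 14 * b)" by (simp add: algebra_simps)
  also have "\<dots> \<le> pass_cost n j e b C"
    unfolding pass_cost_def HK by (intro mult_le_mono2) simp
  finally have cost: "H * (?C1 + 2 + 2 * b + (1 + 2 * b)) + (1 + 2 * b) + 1 \<le> pass_cost n j e b C" .
  show ?thesis
    unfolding transforms_def pass_def
  proof (rule wp_SeqI[where ?Q1.0 = "\<lambda>t s'. t = 1 \<and> s' = s0"], goal_cases)
    case 1
    then show ?case using R'(7)[OF agree_off_refl] by (simp add: wp_simps s0_def)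
  next
    case (2 t1 s1)
    then have t1: "t1 = 1" and s1: "s1 = s0" by auto
    show ?case
      unfolding s1 t1
    proof (rule wp_mono[OF loop], intro conjI allI impI, goal_cases)
      case (1 t2 s3)
      then show ?case using cost by linarith
    next
      case (2 t2 s3 g)
      then show ?case using full by (simp add: I_def)
    qed
  qed
qed


section \<open>The program\<close>

text \<open>The slot address is a shift, linear in the key length. Slots spaced by the exact word
  length would need a schoolbook product, costing an extra factor of order \<open>j\<close> and
  losing the gain.\<close>

definition lookup :: com where
  "lookup = Seq (Load 31 3 2 7) (Seq (Op Shl 31 31 10) (Seq (Load 31 4 31 7) (Store 3 2 7 31)))"

text \<open>A key is the packed word itself read as a number, so \<open>bit k\<close> serves as
  memory contents. Slots of keys that code no vector are unconstrained.\<close>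

definition table_ok :: "nat \<Rightarrow> nat \<Rightarrow> (nat \<Rightarrow> bool) \<Rightarrow> nat \<Rightarrow> bool" where
  "table_ok j \<sigma> m c \<longleftrightarrow> (\<forall>k<c. \<forall>g. holds (bit k) 0 (2 ^ (2 * j)) g \<longrightarrow>
     holds m (k * 2 ^ \<sigma>) (2 ^ (2 * j)) (butterflies j j g))"

lemma transforms_lookup:
  assumes R: "fst s 2 = 0" "fst s 7 = 2 ^ (2 * j) * w" "fst s 10 = \<sigma>"
    and table: "table_ok j \<sigma> (snd s 4) (2 ^ (2 ^ (2 * j) * w))"
  shows "transforms 3 (j + j) j j (9 * (2 ^ (2 * j) * w) + 3 * \<sigma> + 4) lookup s"
  unfolding transforms_def
proof (rule wp_abstract, goal_cases)
  case (1 Q)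
  let ?B = "2 ^ (2 * j) * w"
  let ?k = "read_field (snd s 3) 0 ?B"
  let ?v = "read_field (snd s 4) (?k * 2 ^ \<sigma>) ?B"
  have k: "?k < 2 ^ ?B" by (rule read_field_less)
  show ?case
    unfolding lookup_def
  proof (simp (no_asm) only: step_simps R, intro 1 conjI allI impI, goal_cases)
    case 1
    have "bits ?k \<le> ?B" "bits ?v \<le> ?B" by (rule bits_read_field)+
    moreover have "bits (?k * 2 ^ \<sigma>) \<le> bits ?k + \<sigma>" by (rule bits_mult_le)
    ultimately show ?case
      using bits_le_self[of ?B] bits_le_self[of \<sigma>] unfolding op_cost.simps bits_0 by linarith
  next
    case (2 g)
    then have "holds (snd s 3) 0 (2 ^ (2 * j)) g" by (simp add: mult_2[symmetric])
    then have "holds (bit ?k) 0 (2 ^ (2 * j)) g"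
      by (rule holds_cong_bits) (simp add: bit_read_field)
    then have "holds (snd s 4) (?k * 2 ^ \<sigma>) (2 ^ (2 * j)) (butterflies j j g)"
      using table k by (simp add: table_ok_def)
    then have "holds (write_field (snd s 3) 0 ?B ?v) 0 (2 ^ (2 * j)) (butterflies j j g)"
      by (rule holds_cong_bits) (simp add: write_field_def bit_read_field)
    then show ?case by (simp add: mult_2[symmetric])
  qed
qed

section \<open>Filling the table\<close>

definition fill_step :: com where
  "fill_step = Seq (Store 2 2 7 20) (Seq (naive 6 7) (Seq (Load 21 2 2 7)
     (Seq (Op Shl 22 20 10) (Seq (Store 4 22 7 21) (Op Add 20 20 1)))))"

definition fill :: com where
  "fill = Seq (Const 20 0) (WhileLess 20 16 fill_step)"

lemma written_fill_step [simp]: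
  "written_regs fill_step = {20, 21, 22} \<union> {40..48}" "written_arrs fill_step = {2, 3, 4}"
  by (auto simp: fill_step_def)

lemma written_fill [simp]:
  "written_regs fill = {20, 21, 22} \<union> {40..48}" "written_arrs fill = {2, 3, 4}"
  by (auto simp: fill_def)

definition naive_cost :: "nat \<Rightarrow> nat \<Rightarrow> nat" where
  "naive_cost k m = (k + 1) * 2 ^ m * (120 * (1 + m + overhead)\<^sup>2)"

definition fill_cost :: "nat \<Rightarrow> nat" where
  "fill_cost j = 2 ^ (2 ^ (2 * j) * w) * (naive_cost j (2 * j) + 13 * (2 ^ (2 * j) * w) + 3 * (2 * j + w) + 9)
     + 2 * (2 ^ (2 * j) * w) + 4"

text \<open>Running from the distance in register 6 to the length in register 7 performs exactly
  levels \<open>j\<close> to \<open>2 * j - 1\<close> of the key.\<close>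

lemma wp_fill_step:
  assumes R: "ready s" "fst s 6 = 2 ^ j * w" "fst s 7 = 2 ^ (2 * j) * w" "fst s 10 = \<sigma>"
      "fst s 20 = k" and k: "k < 2 ^ (2 ^ (2 * j) * w)" and \<sigma>: "2 ^ (2 * j) * w \<le> 2 ^ \<sigma>"
  shows "wp fill_step (\<lambda>t s'. t \<le> naive_cost j (2 * j) + 11 * (2 ^ (2 * j) * w) + 3 * \<sigma> + 6 \<and>
    fst s' 20 = Suc k \<and> (table_ok j \<sigma> (snd s 4) k \<longrightarrow> table_ok j \<sigma> (snd s' 4) (Suc k))) s"
proof -
  let ?B = "2 ^ (2 * j) * w" and ?K = "2 ^ (2 * j)"
  define s1 where "s1 = (fst s, (snd s)(2 := write_field (snd s 2) 0 ?B k))"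
  have s1: "ready s1" "fst s1 6 = 2 ^ j * w" "fst s1 7 = 2 ^ (j + j) * w"
    using R by (simp_all add: s1_def ready_def mult_2[symmetric])
  have key: "holds (snd s1 2) 0 ?K g" if "holds (bit k) 0 ?K g" for g
    using that by (rule holds_cong_bits) (simp add: s1_def write_field_def)
  have bk: "bits k \<le> ?B" using k by (rule bits_le)
  have 2: "wp (naive 6 7) (\<lambda>t s'. (t \<le> naive_cost j (2 * j) \<and>
      (\<forall>g. holds (snd s1 2) 0 ?K g \<longrightarrow> holds (snd s' 2) 0 ?K (butterflies j j g))) \<and>
      agree_off (naive 6 7) s1 s') s1"
    by (rule wp_mono[OF wp_frame[OF wp_naive[OF s1(1,2,3) _ order_refl]]])
      (auto simp: naive_cost_def mult_2[symmetric] algebra_simps)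
  show ?thesis
    unfolding fill_step_def
  proof (rule wp_SeqI[where ?Q1.0 = "\<lambda>t s'. t \<le> 1 + 3 * ?B \<and> s' = s1"], goal_cases)
    case 1
    have "1 + bits 0 + bits ?B + bits k + ?B \<le> 1 + 3 * ?B"
      using bk bits_le_self[of ?B] unfolding bits_0 by linarith
    then show ?case by (simp only: step_simps R readyD[OF R(1)] s1_def)
  next
    case (2 t1 s1')
    then have t1: "t1 \<le> 1 + 3 * ?B" and s1': "s1' = s1" by auto
    show ?case
      unfolding s1'
    proof (rule wp_SeqI[OF \<open>wp (naive 6 7) _ s1\<close>], goal_cases)
      case (1 t2 s2)
      then have t2: "t2 \<le> naive_cost j (2 * j)"
        and post: "\<And>g. holds (bit k) 0 ?K g \<Longrightarrow> holds (snd s2 2) 0 ?K (butterflies j j g)"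
        and ag: "agree_off (naive 6 7) s1 s2" using key by blast+
      have r2: "fst s2 1 = 1" "fst s2 2 = 0" "fst s2 7 = ?B" "fst s2 10 = \<sigma>" "fst s2 20 = k"
        using agree_off_reg[OF ag, of 1] agree_off_reg[OF ag, of 2] agree_off_reg[OF ag, of 7]
          agree_off_reg[OF ag, of 10] agree_off_reg[OF ag, of 20] R by (simp_all add: s1_def ready_def)
      have A4: "snd s2 4 = snd s 4" using agree_off_arr[OF ag, of 4] by (simp add: s1_def)
      let ?v = "read_field (snd s2 2) 0 ?B"
      let ?m = "write_field (snd s 4) (k * 2 ^ \<sigma>) ?B ?v"
      have table: "table_ok j \<sigma> ?m (Suc k)" if ok: "table_ok j \<sigma> (snd s 4) k"
        unfolding table_ok_def
      proof (intro allI impI)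
        fix i g assume i: "i < Suc k" and g: "holds (bit i) 0 ?K g"
        show "holds ?m (i * 2 ^ \<sigma>) ?K (butterflies j j g)"
        proof (cases "i = k")
          case True
          then have "holds (snd s2 2) 0 ?K (butterflies j j g)" using g post by simp
          then show ?thesis
            by (rule holds_cong_bits) (simp add: True write_field_in bit_read_field)
        next
          case False
          \<comment> \<open>By \<open>\<sigma>\<close> a slot is at least as long as a word, so
            writing slot \<open>k\<close> spares the earlier ones.\<close>
          then have "Suc i * 2 ^ \<sigma> \<le> k * 2 ^ \<sigma>" using i by (intro mult_le_mono1) simp
          then have "?m (i * 2 ^ \<sigma> + t) = snd s 4 (i * 2 ^ \<sigma> + t)" if "t < ?B" for t
            using that \<sigma> by (intro write_field_out) simp
          moreover have "holds (snd s 4) (i * 2 ^ \<sigma>) ?K (butterflies j j g)"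
            using ok g i False by (simp add: table_ok_def)
          ultimately show ?thesis by (rule holds_cong_bits[rotated])
        qed
      qed
      show ?case
      proof (rule wp_abstract, goal_cases)
        case (1 Q)
        show ?case
        proof (simp (no_asm) only: step_simps r2 A4, intro 1 conjI, goal_cases)
          case 1
          have "bits ?v \<le> ?B" by (rule bits_read_field)
          moreover have "bits (k * 2 ^ \<sigma>) \<le> bits k + \<sigma>" by (rule bits_mult_le)
          ultimately show ?case
            using t1 t2 bk bits_le_self[of ?B] bits_le_self[of \<sigma>]
            unfolding op_cost.simps bits_0 bits_1 by linarith
        qed (use table in simp_all)
      qed
    qed
  qed
qed

lemma wp_fill:
  assumes R: "ready s" "fst s 6 = 2 ^ j * w" "fst s 7 = 2 ^ (2 * j) * w" "fst s 10 = 2 * j + w"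
      "fst s 16 = 2 ^ (2 ^ (2 * j) * w)"
  shows "wp fill (\<lambda>t s'. t \<le> fill_cost j \<and>
    table_ok j (2 * j + w) (snd s' 4) (2 ^ (2 ^ (2 * j) * w))) s"
proof -
  let ?B = "2 ^ (2 * j) * w" and ?\<sigma> = "2 * j + w"
  define s1 where "s1 = ((fst s)(20 := 0), snd s)"
  define I where "I k s' \<longleftrightarrow> fst s' 20 = k \<and> table_ok j ?\<sigma> (snd s' 4) k" for k and s' :: state
  have R': "ready s'" "fst s' 6 = 2 ^ j * w" "fst s' 7 = 2 ^ (2 * j) * w" "fst s' 10 = ?\<sigma>"
    "fst s' 16 = 2 ^ ?B" if "agree_off fill_step s1 s'" for s'
  proof -
    have "fst s' r = fst s r" if "r \<in> {1, 2, 3, 6, 7, 10, 12, 16, 17}" for r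
      using agree_off_reg[OF \<open>agree_off fill_step s1 s'\<close>, of r] that by (auto simp: s1_def)
    then show "ready s'" "fst s' 6 = 2 ^ j * w" "fst s' 7 = 2 ^ (2 * j) * w" "fst s' 10 = ?\<sigma>"
      "fst s' 16 = 2 ^ ?B" using R by (simp_all add: ready_def)
  qed
  have \<sigma>: "?B \<le> 2 ^ ?\<sigma>" by (simp add: power_add)
  let ?C = "naive_cost j (2 * j) + 11 * ?B + 3 * ?\<sigma> + 6"
  have loop: "wp (WhileLess 20 16 fill_step) (\<lambda>t s'. t \<le> 2 ^ ?B * (?C + (3 + 2 * ?B)) + (3 + 2 * ?B) \<and>
      I (2 ^ ?B) s' \<and> agree_off fill_step s1 s') s1"
  proof (rule wp_While)
    show "I 0 s1" by (simp add: I_def s1_def table_ok_def)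
  next
    fix k s' assume k: "k < 2 ^ ?B" and s': "I k s'" "agree_off fill_step s1 s'"
    show "fst s' 20 < fst s' 16" using k s' R'[OF s'(2)] by (simp add: I_def)
    show "wp fill_step (\<lambda>t s''. t \<le> ?C \<and> I (Suc k) s'') s'"
      by (rule wp_mono[OF wp_fill_step[OF R'(1-4)[OF s'(2)] _ k \<sigma>]])
        (use s'(1) in \<open>simp_all add: I_def\<close>)
  next
    fix s' assume "I (2 ^ ?B) s'" "agree_off fill_step s1 s'"
    then show "\<not> fst s' 20 < fst s' 16" using R' by (simp add: I_def)
  next
    fix k s' assume k: "k \<le> 2 ^ ?B" and s': "I k s'" "agree_off fill_step s1 s'"
    have "bits k \<le> ?B + 1" "bits (2 ^ ?B) \<le> ?B + 1"
      using k by (intro bits_le, simp add: le_less_trans)+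
    moreover have r20: "fst s' 20 = k" using s'(1) by (simp add: I_def)
    ultimately show "1 + bits (fst s' 20) + bits (fst s' 16) \<le> 3 + 2 * ?B"
      unfolding R'(5)[OF s'(2)] r20 by linarith
  qed
  have "2 ^ ?B * (?C + (3 + 2 * ?B)) + (3 + 2 * ?B) + 1 = fill_cost j"
    by (simp add: fill_cost_def algebra_simps)
  then show ?thesis
    unfolding fill_def
    by (intro wp_SeqI[where ?Q1.0 = "\<lambda>t s'. t = 1 \<and> s' = s1"])
      (auto simp: wp_simps s1_def I_def intro!: wp_mono[OF loop[unfolded s1_def]])
qed

section \<open>The low levels, block by block\<close>

definition low_step :: com where
  "low_step = Seq (Load 21 0 20 15) (Seq (Store 2 2 15 21) (Seq (naive 3 15)
     (Seq (Load 21 2 2 15) (Seq (Store 1 20 15 21) (Op Add 20 20 15)))))"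

definition low :: com where
  "low = Seq (Const 20 0) (WhileLess 20 9 low_step)"

lemma written_low_step [simp]:
  "written_regs low_step = {20, 21} \<union> {40..48}" "written_arrs low_step = {1, 2, 3}"
  by (auto simp: low_step_def)

lemma written_low [simp]:
  "written_regs low = {20, 21} \<union> {40..48}" "written_arrs low = {1, 2, 3}"
  by (auto simp: low_def)

definition low_cost :: "nat \<Rightarrow> nat \<Rightarrow> nat" where
  "low_cost n m = 2 ^ (n - m) * (naive_cost m m + 10 * (2 ^ m * w) + 10 * (1 + n + overhead))"

text \<open>Array 0 is only read; this phase also carries the vector over to the output
  array.\<close>

lemma wp_low_step:
  assumes R: "ready s" "fst s 15 = 2 ^ m * w" "fst s 20 = i * (2 ^ m * w)"
    and i: "i < 2 ^ (n - m)" and m: "m \<le> n" and b: "n + overhead \<le> b"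
  shows "wp low_step (\<lambda>t s'. t \<le> naive_cost m m + 10 * (2 ^ m * w) + (6 + 4 * b) \<and>
    fst s' 20 = Suc i * (2 ^ m * w) \<and>
    (\<forall>f. holds (snd s 0) 0 (2 ^ n) f \<and> holds (snd s 1) 0 (i * 2 ^ m) (butterflies 0 m f) \<longrightarrow>
      holds (snd s' 1) 0 (Suc i * 2 ^ m) (butterflies 0 m f))) s"
proof -
  let ?B = "2 ^ m * w" and ?a = "i * (2 ^ m * w)"
  let ?v = "read_field (snd s 0) ?a ?B"
  define s1 where "s1 = ((fst s)(21 := ?v), (snd s)(2 := write_field (snd s 2) 0 ?B ?v))"
  have bits0: "bits z \<le> b" if "z \<le> 2 * (2 ^ n * w)" for z
    using bits_le two_power_less_overhead[OF b that] .
  have "Suc i * 2 ^ m \<le> 2 ^ (n - m) * 2 ^ m" using i by (intro mult_le_mono1) simp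
  also have "\<dots> = 2 ^ n" using m by (simp flip: power_add)
  finally have im: "Suc i * 2 ^ m \<le> 2 ^ n" .
  then have "Suc i * 2 ^ m * w \<le> 2 ^ n * w" by (rule mult_le_mono1)
  then have le: "?a + ?B \<le> 2 ^ n * w" by (simp add: algebra_simps)
  have bb: "bits ?a \<le> b" "bits ?B \<le> b" by (rule bits0; use le in linarith)+
  have s1: "ready s1" "fst s1 3 = 2 ^ 0 * w" "fst s1 15 = 2 ^ (0 + m) * w"
    using R by (simp_all add: s1_def ready_def)
  have 2: "wp (naive 3 15) (\<lambda>t s'. (t \<le> naive_cost m m \<and>
      (\<forall>g. holds (snd s1 2) 0 (2 ^ m) g \<longrightarrow> holds (snd s' 2) 0 (2 ^ m) (butterflies 0 m g))) \<and>
      agree_off (naive 3 15) s1 s') s1"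
    by (rule wp_mono[OF wp_frame[OF wp_naive[OF s1(1,2,3) _ order_refl]]])
      (auto simp: naive_cost_def algebra_simps)
  have bv: "bits ?v \<le> ?B" by (rule bits_read_field)
  have "wp (Seq (Load 21 0 20 15) (Seq (Store 2 2 15 21) c)) Q s"
    if "\<And>t. t \<le> 2 + 2 * b + 4 * ?B \<Longrightarrow> wp c (\<lambda>t'. Q (t + t')) s1" for c Q
  proof -
    have "1 + bits ?a + bits ?B + ?B + (1 + bits 0 + bits ?B + bits ?v + ?B) \<le> 2 + 2 * b + 4 * ?B"
      using bb bv bits_le_self[of ?B] unfolding bits_0 by linarith
    from that[OF this] show ?thesis
      by (simp only: step_simps R readyD[OF R(1)] s1_def add.assoc)
  qed
  note start = this
  show ?thesis
    unfolding low_step_def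
  proof (rule start)
    fix t1 assume t1: "t1 \<le> 2 + 2 * b + 4 * ?B"
    show "wp (Seq (naive 3 15) (Seq (Load 21 2 2 15) (Seq (Store 1 20 15 21) (Op Add 20 20 15))))
      (\<lambda>t' s'. t1 + t' \<le> naive_cost m m + 10 * ?B + (6 + 4 * b) \<and>
        fst s' 20 = Suc i * (2 ^ m * w) \<and>
        (\<forall>f. holds (snd s 0) 0 (2 ^ n) f \<and> holds (snd s 1) 0 (i * 2 ^ m) (butterflies 0 m f) \<longrightarrow>
          holds (snd s' 1) 0 (Suc i * 2 ^ m) (butterflies 0 m f))) s1"
    proof (rule wp_SeqI[OF 2], goal_cases)
      case (1 t2 s2)
      then have t2: "t2 \<le> naive_cost m m"
        and post: "\<And>g. holds (snd s1 2) 0 (2 ^ m) g \<Longrightarrow> holds (snd s2 2) 0 (2 ^ m) (butterflies 0 m g)"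
        and ag: "agree_off (naive 3 15) s1 s2" by blast+
      have r2: "fst s2 2 = 0" "fst s2 15 = ?B" "fst s2 20 = ?a"
        using agree_off_reg[OF ag, of 2] agree_off_reg[OF ag, of 15] agree_off_reg[OF ag, of 20] R
        by (simp_all add: s1_def ready_def)
      have A1: "snd s2 1 = snd s 1" using agree_off_arr[OF ag, of 1] by (simp add: s1_def)
      let ?u = "read_field (snd s2 2) 0 ?B"
      show ?case
      proof (rule wp_abstract, goal_cases)
        case (1 Q)
        show ?case
        proof (simp (no_asm) only: step_simps r2 A1, intro 1 conjI allI impI, goal_cases)
          case 1
          have "bits ?u \<le> ?B" by (rule bits_read_field)
          then show ?case
            using t1 t2 bb bits_le_self[of ?B] unfolding op_cost.simps bits_0 by linarith
        next
          case 2
          then show ?case by simp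
        next
          case (3 f)
          define g where "g x = f (i * 2 ^ m + x)" for x
          have "holds (snd s1 2) 0 (2 ^ m) g"
            unfolding holds_def
          proof (intro allI impI)
            fix x t :: nat assume x: "x < 2 ^ m" and t: "t < w"
            have "i * 2 ^ m + x < 2 ^ n" using im x by simp
            then have "snd s 0 (0 + (i * 2 ^ m + x) * w + t) = bit (enc (g x)) t"
              using 3 t by (simp add: holds_def g_def)
            also have "0 + (i * 2 ^ m + x) * w + t = ?a + (x * w + t)" by (simp add: algebra_simps)
            finally have "snd s 0 (?a + (x * w + t)) = bit (enc (g x)) t" .
            then show "snd s1 2 (0 + x * w + t) = bit (enc (g x)) t"
              using field_index_less[OF x t] by (simp add: s1_def write_field_def bit_read_field)
          qed
          then have g: "holds (snd s2 2) 0 (2 ^ m) (butterflies 0 m g)" by (rule post)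
          \<comment> \<open>Levels below \<open>m\<close> never leave a block of
            \<open>2 ^ m\<close> entries, so the block may be treated as if it started at 0.\<close>
          have re: "butterflies 0 m f (i * 2 ^ m + x) = butterflies 0 m g x" if "x < 2 ^ m" for x
            using butterflies_reindex[of "i * 2 ^ m" 0 m 0 0 f g x] that by (simp add: g_def)
          show ?case
            unfolding holds_def snd_conv fun_upd_same
          proof (intro allI impI)
            fix z t :: nat assume z: "z < Suc i * 2 ^ m" and t: "t < w"
            show "write_field (snd s 1) ?a ?B ?u (0 + z * w + t) = bit (enc (butterflies 0 m f z)) t"
            proof (cases "z < i * 2 ^ m")
              case True
              then have "z * w + t < i * 2 ^ m * w" using t by (rule field_index_less)
              then have "write_field (snd s 1) ?a ?B ?u (0 + z * w + t) = snd s 1 (0 + z * w + t)"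
                by (intro write_field_out) (simp add: mult.assoc)
              then show ?thesis using 3 True t by (simp add: holds_def)
            next
              case False
              define x where "x = z - i * 2 ^ m"
              have x: "x < 2 ^ m" "z = i * 2 ^ m + x" using False z by (auto simp: x_def)
              have eq: "0 + z * w + t = ?a + (x * w + t)" by (simp add: x algebra_simps)
              have "write_field (snd s 1) ?a ?B ?u (0 + z * w + t) = bit ?u (x * w + t)"
                unfolding eq by (rule write_field_in[OF field_index_less[OF x(1) t]])
              then have "write_field (snd s 1) ?a ?B ?u (0 + z * w + t) = snd s2 2 (0 + x * w + t)"
                using field_index_less[OF x(1) t] by (simp add: bit_read_field)
              then show ?thesis using g x t re by (simp add: holds_def)
            qed
          qed
        qed
      qed
    qed
  qed
qed

lemma wp_low:
  assumes R: "ready s" "fst s 9 = 2 ^ n * w" "fst s 15 = 2 ^ m * w" and m: "m \<le> n"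
  shows "wp low (\<lambda>t s'. t \<le> low_cost n m \<and>
    (\<forall>f. holds (snd s 0) 0 (2 ^ n) f \<longrightarrow> holds (snd s' 1) 0 (2 ^ n) (butterflies 0 m f))) s"
proof -
  define b where "b = n + overhead"
  define s1 where "s1 = ((fst s)(20 := 0), snd s)"
  define H where "H = (2::nat) ^ (n - m)"
  have Hm: "H * 2 ^ m = 2 ^ n" using m by (simp add: H_def flip: power_add)
  have H_eq: "H * (2 ^ m * w) = 2 ^ n * w" by (simp flip: Hm)
  define I where "I i s' \<longleftrightarrow> fst s' 20 = i * (2 ^ m * w) \<and>
      (\<forall>f. holds (snd s 0) 0 (2 ^ n) f \<longrightarrow> holds (snd s' 1) 0 (i * 2 ^ m) (butterflies 0 m f))"
    for i and s' :: state
  have bits0: "bits z \<le> b" if "z \<le> 2 * (2 ^ n * w)" for z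
    using bits_le two_power_less_overhead[OF _ that] unfolding b_def by blast
  have R': "ready s'" "fst s' 9 = 2 ^ n * w" "fst s' 15 = 2 ^ m * w" "snd s' 0 = snd s 0"
    if "agree_off low_step s1 s'" for s'
  proof -
    have "fst s' r = fst s r" if "r \<in> {1, 2, 3, 9, 12, 15, 17}" for r
      using agree_off_reg[OF \<open>agree_off low_step s1 s'\<close>, of r] that by (auto simp: s1_def)
    then show "ready s'" "fst s' 9 = 2 ^ n * w" "fst s' 15 = 2 ^ m * w"
      using R by (simp_all add: ready_def)
    show "snd s' 0 = snd s 0" using agree_off_arr[OF that, of 0] by (simp add: s1_def)
  qed
  let ?C = "naive_cost m m + 10 * (2 ^ m * w) + (6 + 4 * b)"
  have loop: "wp (WhileLess 20 9 low_step) (\<lambda>t s'. t \<le> H * (?C + (1 + 2 * b)) + (1 + 2 * b) \<and>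
      I H s' \<and> agree_off low_step s1 s') s1"
  proof (rule wp_While)
    show "I 0 s1" by (simp add: I_def s1_def holds_def)
  next
    fix i s' assume i: "i < H" and s': "I i s'" "agree_off low_step s1 s'"
    have "i * (2 ^ m * w) < H * (2 ^ m * w)" using i w_pos by (intro mult_strict_right_mono) simp_all
    then show "fst s' 20 < fst s' 9" using s' R'[OF s'(2)] H_eq by (simp add: I_def)
    show "wp low_step (\<lambda>t s''. t \<le> ?C \<and> I (Suc i) s'') s'"
      by (rule wp_mono[OF wp_low_step[OF R'(1,3)[OF s'(2)] _ _ m, of i b]])
        (use s'(1) i R'(4)[OF s'(2)] in \<open>simp_all add: I_def H_def b_def\<close>)
  next
    fix s' assume "I H s'" "agree_off low_step s1 s'"
    then show "\<not> fst s' 20 < fst s' 9" using R' H_eq by (simp add: I_def)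
  next
    fix i s' assume i: "i \<le> H" and s': "I i s'" "agree_off low_step s1 s'"
    have "i * (2 ^ m * w) \<le> 2 ^ n * w" using mult_le_mono1[OF i, of "2 ^ m * w"] H_eq by simp
    then have "fst s' 20 \<le> 2 * (2 ^ n * w)" "fst s' 9 \<le> 2 * (2 ^ n * w)"
      using s'(1) R'(2)[OF s'(2)] unfolding I_def by linarith+
    then show "1 + bits (fst s' 20) + bits (fst s' 9) \<le> 1 + 2 * b"
      using bits0[of "fst s' 20"] bits0[of "fst s' 9"] by linarith
  qed
  have "1 * (2 + 2 * b) \<le> H * (2 + 2 * b)" by (intro mult_le_mono1) (simp add: H_def)
  then have "H * (?C + (1 + 2 * b)) + (1 + 2 * b) + 1 \<le> H * (?C + (1 + 2 * b) + (2 + 2 * b))"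
    by (simp add: algebra_simps)
  also have "\<dots> \<le> low_cost n m"
    unfolding low_cost_def H_def by (intro mult_le_mono2) (simp add: b_def)
  finally have "H * (?C + (1 + 2 * b)) + (1 + 2 * b) + 1 \<le> low_cost n m" .
  then have "1 + t \<le> low_cost n m" if "t \<le> H * (?C + (1 + 2 * b)) + (1 + 2 * b)" for t
    using that by linarith
  then show ?thesis
    unfolding low_def
    by (intro wp_SeqI[where ?Q1.0 = "\<lambda>t s'. t = 1 \<and> s' = s1"])
      (auto simp: wp_simps s1_def I_def Hm intro!: wp_mono[OF loop[unfolded s1_def]])
qed


section \<open>Choice and computation of the parameters\<close>

definition digit_length :: "nat \<Rightarrow> nat" where
  "digit_length n = Suc (LEAST i. n \<le> 32 * w * 4 ^ i)"

lemma ex_digit_length: "\<exists>i. n \<le> 32 * w * 4 ^ i"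
proof
  have "n < 4 ^ n" by (induction n) auto
  also have "\<dots> \<le> 32 * w * 4 ^ n" using w_pos by simp
  finally show "n \<le> 32 * w * 4 ^ n" by simp
qed

text \<open>For \<open>j = digit_length n \<ge> 2\<close>, minimality at \<open>j - 2\<close> gives
  \<open>2 * w * 4 ^ j < n\<close>. So a key has fewer than \<open>n / 2\<close> bits, which keeps
  the table small, and by this lemma at least \<open>n / 8\<close>, which makes it as long as a main
  address up to a constant. The \<open>32\<close> is \<open>2 * 16\<close>, the \<open>16\<close>
  being lost between \<open>4 ^ (j - 2)\<close> and \<open>4 ^ j\<close>.\<close>

lemma le_digit_length: "n \<le> 8 * w * 4 ^ digit_length n"
  using LeastI_ex[OF ex_digit_length, of n] by (simp add: digit_length_def)

lemma digit_length_less: "i < digit_length n - 1 \<Longrightarrow> 32 * w * 4 ^ i < n"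
  using not_less_Least[of i "\<lambda>i. n \<le> 32 * w * 4 ^ i"] by (simp add: digit_length_def)

text \<open>Leaves a multiple of \<open>j\<close> levels for the passes and keeps at least
  \<open>2 * j\<close> below them whenever a pass remains. For \<open>n < 3 * j\<close> the quotient
  is 0 and all levels are low, so small \<open>n\<close> needs no case distinction in the
  program.\<close>

definition low_levels :: "nat \<Rightarrow> nat \<Rightarrow> nat" where
  "low_levels n j = n - (n - 2 * j) div j * j"

definition params :: "nat \<Rightarrow> nat \<Rightarrow> state \<Rightarrow> bool" where
  "params n j s \<longleftrightarrow> ready s \<and> fst s 4 = j \<and> fst s 5 = 2 ^ j \<and> fst s 6 = 2 ^ j * w \<and>
     fst s 7 = 2 ^ (2 * j) * w \<and> fst s 8 = 2 ^ (3 * j) * w \<and> fst s 9 = 2 ^ n * w \<and>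
     fst s 10 = 2 * j + w \<and> fst s 15 = 2 ^ low_levels n j * w \<and> fst s 16 = 2 ^ (2 ^ (2 * j) * w)"

lemma params_agree:
  assumes "params n j s" "agree_off c s s'" "{0..17} \<inter> written_regs c = {}"
  shows "params n j s'"
proof -
  have "fst s' r = fst s r" if "r \<in> {0..17}" for r
    using assms(3) that by (intro agree_off_reg[OF assms(2)]) blast
  then show ?thesis using assms(1) by (simp add: params_def ready_def)
qed

lemma paramsD:
  assumes "params n j s"
  shows "ready s" "fst s 4 = j" "fst s 5 = 2 ^ j" "fst s 6 = 2 ^ j * w"
    "fst s 7 = 2 ^ (2 * j) * w" "fst s 8 = 2 ^ (3 * j) * w" "fst s 9 = 2 ^ n * w"
    "fst s 10 = 2 * j + w" "fst s 15 = 2 ^ low_levels n j * w" "fst s 16 = 2 ^ (2 ^ (2 * j) * w)"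
  using assms by (simp_all add: params_def)

definition constants :: com where
  "constants = Seq (Const 1 1) (Seq (Const 2 0) (Seq (Const 3 w) (Seq (Const 4 1)
     (Seq (Const 11 (32 * w)) (Seq (Const 12 2) (Const 17 (2 ^ w)))))))"

text \<open>Register 11 runs through \<open>32 * w * 4 ^ i\<close>; register 4 starts at 1, which
  accounts for the \<open>Suc\<close> in \<open>digit_length\<close>.\<close>

definition find_digit_length :: com where
  "find_digit_length = WhileLess 11 0 (Seq (Op Shl 11 11 12) (Op Add 4 4 1))"

definition compute_params :: com where
  "compute_params = Seq (Op Shl 5 1 4) (Seq (Op Shl 6 3 4) (Seq (Op Shl 7 6 4) (Seq (Op Shl 8 7 4)
     (Seq (Op Add 13 4 4) (Seq (Op Add 10 13 3) (Seq (Op Sub 14 0 13) (Seq (Op Div 14 14 4)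
     (Seq (Op Mul 14 14 4) (Seq (Op Sub 14 0 14) (Seq (Op Shl 15 3 14) (Seq (Op Shl 9 3 0)
     (Op Shl 16 1 7))))))))))))"

lemma wp_constants:
  "wp constants (\<lambda>t s'. t \<le> 14 + 34 * w \<and> ready s' \<and> fst s' 0 = fst s 0 \<and>
     fst s' 4 = 1 \<and> fst s' 11 = 32 * w \<and> snd s' = snd s) s"
proof (rule wp_abstract, goal_cases)
  case (1 Q)
  show ?case
    unfolding constants_def
  proof (simp (no_asm) only: step_simps, intro 1 conjI, goal_cases)
    case 1
    have "bits (2 ^ w) \<le> w + 1" by (rule bits_le) simp
    moreover have "bits 2 \<le> 2" by (rule bits_le_self)
    ultimately show ?case
      using bits_le_self[of w] bits_le_self[of "32 * w"] unfolding bits_0 bits_1 by linarith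
  qed (simp_all add: ready_def)
qed

lemma wp_find_digit_length:
  assumes R: "ready s" "fst s 0 = n" "fst s 4 = 1" "fst s 11 = 32 * w"
  shows "wp find_digit_length (\<lambda>t s'. t \<le> digit_length n * (10 + 9 * n + 64 * w + digit_length n) + 1 + 5 * n + 32 * w \<and>
     ready s' \<and> fst s' 0 = n \<and> fst s' 4 = digit_length n \<and> snd s' = snd s) s"
proof -
  let ?c = "Seq (Op Shl 11 11 12) (Op Add 4 4 1)" and ?m = "digit_length n - 1"
  define I where "I i s' \<longleftrightarrow> fst s' 11 = 32 * w * 4 ^ i \<and> fst s' 4 = Suc i" for i and s' :: state
  \<comment> \<open>The preceding value was still below \<open>n\<close>; the summand
    \<open>32 * w\<close> covers \<open>i = 0\<close>. Costs here are bounded crudely by values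
    instead of lengths, since polynomials in \<open>n\<close> are negligible.\<close>
  have le: "32 * w * 4 ^ i \<le> 4 * n + 32 * w" if "i \<le> ?m" for i
  proof (cases i)
    case (Suc k)
    then have "32 * w * 4 ^ k < n" using that by (intro digit_length_less) simp
    then show ?thesis using Suc by simp
  qed simp
  have R': "ready s'" "fst s' 0 = n" "snd s' = snd s" if "agree_off ?c s s'" for s'
  proof -
    show "ready s'" using R(1) that by (rule ready_agree) simp
    show "fst s' 0 = n" using agree_off_reg[OF that, of 0] R by simp
    show "snd s' = snd s" using agree_off_arr[OF that] by (intro ext) simp
  qed
  have loop: "wp find_digit_length (\<lambda>t s'. t \<le> ?m * ((9 + 4 * n + 32 * w + digit_length n) + (1 + 5 * n + 32 * w)) + (1 + 5 * n + 32 * w) \<and>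
      I ?m s' \<and> agree_off ?c s s') s"
    unfolding find_digit_length_def
  proof (rule wp_While)
    show "I 0 s" using R by (simp add: I_def)
  next
    fix i s' assume i: "i < ?m" and s': "I i s'" "agree_off ?c s s'"
    show "fst s' 11 < fst s' 0"
      using s'(1) R'[OF s'(2)] digit_length_less[OF i] by (simp add: I_def)
    have I: "fst s' 11 = 32 * w * 4 ^ i" "fst s' 4 = Suc i" using s'(1) by (simp_all add: I_def)
    show "wp ?c (\<lambda>t s''. t \<le> 9 + 4 * n + 32 * w + digit_length n \<and> I (Suc i) s'') s'"
    proof (rule wp_abstract, goal_cases)
      case (1 Q)
      show ?case
      proof (simp (no_asm) only: step_simps I readyD[OF R'(1)[OF s'(2)]], intro 1 conjI, goal_cases)
        case 1
        have "bits 2 \<le> 2" "bits (Suc i) \<le> Suc i" "bits (32 * w * 4 ^ i) \<le> 32 * w * 4 ^ i"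
          by (rule bits_le_self)+
        then show ?case
          using le[of i] i unfolding op_cost.simps bits_1 by linarith
      qed (simp add: I_def)
    qed
  next
    fix s' assume s': "I ?m s'" "agree_off ?c s s'"
    have "n \<le> 32 * w * 4 ^ ?m" using LeastI_ex[OF ex_digit_length, of n] by (simp add: digit_length_def)
    then show "\<not> fst s' 11 < fst s' 0"
      using s'(1) R'(2)[OF s'(2)] by (simp add: I_def)
  next
    fix i s' assume i: "i \<le> ?m" and s': "I i s'" "agree_off ?c s s'"
    have r: "fst s' 11 = 32 * w * 4 ^ i" using s'(1) by (simp add: I_def)
    show "1 + bits (fst s' 11) + bits (fst s' 0) \<le> 1 + 5 * n + 32 * w"
      unfolding r R'(2)[OF s'(2)]
      using bits_le_self[of "32 * w * 4 ^ i"] bits_le_self[of n] le[OF i] by linarith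
  qed
  have "?m * ((9 + 4 * n + 32 * w + digit_length n) + (1 + 5 * n + 32 * w)) \<le>
      digit_length n * (10 + 9 * n + 64 * w + digit_length n)"
    by (intro mult_le_mono) simp_all
  then have cost: "t \<le> digit_length n * (10 + 9 * n + 64 * w + digit_length n) + 1 + 5 * n + 32 * w"
    if "t \<le> ?m * ((9 + 4 * n + 32 * w + digit_length n) + (1 + 5 * n + 32 * w)) + (1 + 5 * n + 32 * w)" for t
    using that by linarith
  show ?thesis
  proof (rule wp_mono[OF loop], goal_cases)
    case (1 t s')
    have "Suc ?m = digit_length n" by (simp add: digit_length_def)
    then show ?case using 1 R'[of s'] cost[of t] by (simp only: I_def simp_thms)
  qed
qed

text \<open>Thirteen instructions of cost at most three squares each; the bracket bounds operand
  lengths as well as shift distances.\<close>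

definition params_cost :: "nat \<Rightarrow> nat \<Rightarrow> nat" where
  "params_cost n j = 39 * (1 + (n + 4 * j + 2 * w + 2 ^ (2 * j) * w))\<^sup>2"

lemma wp_compute_params:
  assumes R: "ready s" "fst s 0 = n" "fst s 4 = j"
  shows "wp compute_params (\<lambda>t s'. t \<le> params_cost n j \<and> params n j s' \<and> snd s' = snd s) s"
proof -
  define b where "b = n + 4 * j + 2 * w + 2 ^ (2 * j) * w"
  define C where "C = 3 * (1 + b)\<^sup>2"
  have C: "op_cost f x y \<le> C" if "bits x \<le> b" "bits y \<le> b" "f \<noteq> Shl" for f x y
    using op_cost_le[OF that] by (simp add: C_def)
  have S: "op_cost Shl x y \<le> C" if "bits x \<le> b" "y \<le> b" for x y
  proof -
    have "1 + 3 * b \<le> C" by (simp add: C_def power2_eq_square)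
    then show ?thesis using that bits_le_self[of y] by simp
  qed
  have sh: "bits (x * 2 ^ j) \<le> bits x + j" for x by (rule bits_mult_le)
  have B: "w * 2 ^ j * 2 ^ j = 2 ^ (2 * j) * w" by (simp add: power_add mult_2)
  have self: "bits x \<le> b" if "x \<le> b" for x using bits_le_self[of x] that by linarith
  define m where "m = (n - 2 * j) div j"
  have m: "m * j \<le> n" "m \<le> n" "m * j \<le> n - 2 * j"
    unfolding m_def using div_times_less_eq_dividend[of "n - 2 * j" j] div_le_dividend[of "n - 2 * j" j]
    by linarith+
  have w1: "w \<le> 2 ^ (2 * j) * w" by simp
  have big: "bits (w * 2 ^ j) \<le> b" "bits (w * 2 ^ j * 2 ^ j) \<le> b"
    using sh[of w] sh[of "w * 2 ^ j"] bits_le_self[of w] unfolding b_def by linarith+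
  have one: "1 \<le> b" using w_pos w1 unfolding b_def by linarith
  have jj: "j + j = 2 * j" by simp
  show ?thesis
  proof (rule wp_abstract, goal_cases)
    case (1 Q)
    show ?case
      unfolding compute_params_def
    proof (simp (no_asm) only: step_simps R readyD[OF R(1)] jj m_def[symmetric], intro 1 conjI, goal_cases)
      case 1
      have eq: "params_cost n j = 13 * C" by (simp add: params_cost_def C_def b_def)
      have sz: "j \<le> b" "w \<le> b" "2 * j \<le> b" "n \<le> b" "n - 2 * j \<le> b" "m \<le> b" "m * j \<le> b"
        "n - m * j \<le> b" "w * 2 ^ j * 2 ^ j \<le> b"
        using m unfolding B b_def by linarith+
      show ?case unfolding eq
        by (intro add_le_mult_step le_mult_step C S self big sz one; simp)
    next
      case 2
      show ?case
        using R by (simp add: params_def ready_def low_levels_def m_def power_add mult_2 mult_ac eval_nat_numeral)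
    qed simp
  qed
qed


section \<open>The high levels, \<open>j\<close> at a time\<close>

definition scratch_pass :: com where
  "scratch_pass = pass 2 3 7 8 8 6 28 29 30 lookup"

text \<open>Words of \<open>4 ^ j\<close> entries (register 7) are moved here, pieces of
  \<open>2 ^ j\<close> entries (register 6) in the scratch pass. There \<open>tp\<close> and
  \<open>tot\<close> are both register 8, so its outer loop runs once.\<close>

definition main_pass :: com where
  "main_pass = pass 1 2 23 24 9 7 25 26 27 scratch_pass"

definition high_step :: com where
  "high_step = Seq (Op Shl 24 23 4) (Seq main_pass (Op Add 23 24 2))"

definition high :: com where
  "high = Seq (Op Add 23 15 2) (WhileLess 23 9 high_step)"

lemma written_lookup [simp]: "written_regs lookup = {31}" "written_arrs lookup = {3}"
  by (auto simp: lookup_def)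

lemma written_scratch_pass [simp]:
  "written_regs scratch_pass = {28, 29, 30, 31} \<union> {32..35}" "written_arrs scratch_pass = {2, 3}"
  by (auto simp: scratch_pass_def)

lemma written_main_pass [simp]:
  "written_regs main_pass = {25, 26, 27, 28, 29, 30, 31} \<union> {32..35}" "written_arrs main_pass = {1, 2, 3}"
  by (auto simp: main_pass_def)

lemma written_high_step [simp]:
  "written_regs high_step = {23, 24, 25, 26, 27, 28, 29, 30, 31} \<union> {32..35}"
  "written_arrs high_step = {1, 2, 3}"
  by (auto simp: high_step_def)

definition lookup_cost :: "nat \<Rightarrow> nat" where
  "lookup_cost j = 9 * (2 ^ (2 * j) * w) + 3 * (2 * j + w) + 4"

definition scratch_cost :: "nat \<Rightarrow> nat" where
  "scratch_cost j = pass_cost (3 * j) j j (3 * j + overhead) (lookup_cost j)"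

definition main_cost :: "nat \<Rightarrow> nat \<Rightarrow> nat" where
  "main_cost n j = pass_cost n j (2 * j) (n + overhead) (scratch_cost j)"

definition usable :: "nat \<Rightarrow> nat \<Rightarrow> state \<Rightarrow> bool" where
  "usable n j s \<longleftrightarrow> params n j s \<and> table_ok j (2 * j + w) (snd s 4) (2 ^ (2 ^ (2 * j) * w))"

lemma usable_agree:
  assumes "usable n j s" "agree_off c s s'" "{0..17} \<inter> written_regs c = {}" "4 \<notin> written_arrs c"
  shows "usable n j s'"
  using assms params_agree[of n j s c s'] agree_off_arr[of c s s' 4] by (simp add: usable_def)

lemma transforms_scratch_pass:
  assumes "usable n j s"
  shows "transforms 2 (2 * j + j) (2 * j) j (scratch_cost j) scratch_pass s"
proof -
  have three: "2 * j + j = 3 * j" by simp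
  have P: "params n j s" using assms by (simp add: usable_def)
  note D = paramsD[OF P]
  show ?thesis
    unfolding three scratch_cost_def scratch_pass_def
  proof (rule transforms_pass[where b = "3 * j + overhead"])
    show "fst s 8 = 2 ^ (2 * j + j) * w" unfolding three by (rule D)
    fix s1 assume "agree_off (pass 2 3 7 8 8 6 28 29 30 lookup) s s1"
    then have "usable n j s1"
      using assms by (rule_tac usable_agree) auto
    then show "transforms 3 (j + j) j j (lookup_cost j) lookup s1"
      unfolding lookup_cost_def usable_def params_def
      by (intro transforms_lookup) (simp_all add: ready_def)
  qed (use D in auto)
qed

lemma transforms_main_pass:
  assumes "usable n j s" "fst s 23 = 2 ^ p * w" "fst s 24 = 2 ^ (p + j) * w" "2 * j \<le> p" "p + j \<le> n"
  shows "transforms 1 n p j (main_cost n j) main_pass s"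
proof -
  have P: "params n j s" using assms by (simp add: usable_def)
  note D = paramsD[OF P]
  show ?thesis
    unfolding main_cost_def main_pass_def
  proof (rule transforms_pass)
    fix s1 assume "agree_off (pass 1 2 23 24 9 7 25 26 27 scratch_pass) s s1"
    then have "usable n j s1"
      using assms(1) by (rule_tac usable_agree) auto
    then show "transforms 2 (2 * j + j) (2 * j) j (scratch_cost j) scratch_pass s1"
      by (rule transforms_scratch_pass)
  qed (use D assms in auto)
qed

definition high_cost :: "nat \<Rightarrow> nat \<Rightarrow> nat" where
  "high_cost n j = (n - 2 * j) div j * (main_cost n j + 3 + 2 * j + 4 * (n + overhead)) + 2 + 3 * (n + overhead)"

lemma wp_high:
  assumes u: "usable n j s" and j: "0 < j"
  shows "wp high (\<lambda>t s'. t \<le> high_cost n j \<and>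
    (\<forall>f. holds (snd s 1) 0 (2 ^ n) f \<longrightarrow>
      holds (snd s' 1) 0 (2 ^ n) (butterflies (low_levels n j) (n - low_levels n j) f))) s"
proof -
  let ?m = "low_levels n j" and ?r = "(n - 2 * j) div j" and ?b = "n + overhead"
  have "?r * j \<le> n - 2 * j" by (rule div_times_less_eq_dividend)
  \<comment> \<open>If any pass runs, then \<open>j \<le> n - 2 * j\<close>, and
    \<open>2 * j \<le> n\<close> yields the condition \<open>e \<le> p\<close> of the main
    pass.\<close>
  then have m: "?m + ?r * j = n" "0 < ?r \<Longrightarrow> 2 * j \<le> ?m"
    using j unfolding low_levels_def div_greater_zero_iff by linarith+
  define s1 where "s1 = ((fst s)(23 := 2 ^ ?m * w), snd s)"
  define I where "I q s' \<longleftrightarrow> fst s' 23 = 2 ^ (?m + q * j) * w \<and>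
      (\<forall>f. holds (snd s 1) 0 (2 ^ n) f \<longrightarrow> holds (snd s' 1) 0 (2 ^ n) (butterflies ?m (q * j) f))"
    for q and s' :: state
  have bits0: "bits z \<le> ?b" if "z \<le> 2 * (2 ^ n * w)" for z
    using bits_le two_power_less_overhead[OF order_refl that] .
  have pow: "bits (2 ^ k * w) \<le> ?b" if "k \<le> n" for k
  proof (rule bits0)
    have "2 ^ k * w \<le> 2 ^ n * w" using that by (intro mult_le_mono1) simp
    then show "2 ^ k * w \<le> 2 * (2 ^ n * w)" by linarith
  qed
  have "usable n j s1"
    using u by (simp add: usable_def params_def ready_def s1_def)
  then have R': "usable n j s'" if "agree_off high_step s1 s'" for s'
    using that by (rule_tac usable_agree) auto
  have qm: "?m + q * j \<le> n" if "q \<le> ?r" for q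
    using mult_le_mono1[OF that, of j] m(1) by linarith
  let ?C = "main_cost n j + 2 + 2 * j + 2 * ?b"
  have loop: "wp (WhileLess 23 9 high_step) (\<lambda>t s'. t \<le> ?r * (?C + (1 + 2 * ?b)) + (1 + 2 * ?b) \<and>
      I ?r s' \<and> agree_off high_step s1 s') s1"
  proof (rule wp_While)
    show "I 0 s1" by (simp add: I_def s1_def)
  next
    fix q s' assume q: "q < ?r" and s': "I q s'" "agree_off high_step s1 s'"
    let ?p = "?m + q * j"
    have P: "params n j s'" using R'[OF s'(2)] by (simp add: usable_def)
    note D = paramsD[OF P]
    have "Suc q * j \<le> ?r * j" using q by (intro mult_le_mono1) simp
    then have pj: "?p + j \<le> n" using m(1) by simp
    have p: "?p < n" using pj j by simp
    then have "(2::nat) ^ ?p * w < 2 ^ n * w" using w_pos by simp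
    then show "fst s' 23 < fst s' 9" using s'(1) D by (simp add: I_def)
    define s2 where "s2 = ((fst s')(24 := 2 ^ (?p + j) * w), snd s')"
    have "usable n j s2"
      using R'[OF s'(2)] by (simp add: usable_def params_def ready_def s2_def)
    then have T: "transforms 1 n ?p j (main_cost n j) main_pass s2"
      using s'(1) q m(2) pj by (intro transforms_main_pass) (auto simp: s2_def I_def)
    have "wp main_pass (\<lambda>t s3. (t \<le> main_cost n j \<and>
      (\<forall>g. holds (snd s2 1) 0 (2 ^ n) g \<longrightarrow> holds (snd s3 1) 0 (2 ^ n) (butterflies ?p j g))) \<and>
      agree_off main_pass s2 s3) s2"
      using T unfolding transforms_def by (rule wp_frame)
    note step = this
    show "wp high_step (\<lambda>t s''. t \<le> ?C \<and> I (Suc q) s'') s'"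
      unfolding high_step_def
    proof (rule wp_SeqI[where ?Q1.0 = "\<lambda>t s''. t \<le> 1 + ?b + 2 * j \<and> s'' = s2"], goal_cases)
      case 1
      have r: "fst s' 23 = 2 ^ ?p * w" using s'(1) by (simp add: I_def)
      have "op_cost Shl (2 ^ ?p * w) j \<le> 1 + ?b + 2 * j"
        using pow[of ?p] p bits_le_self[of j] unfolding op_cost.simps by linarith
      moreover have "2 ^ ?p * w * 2 ^ j = 2 ^ (?p + j) * w" by (simp add: power_add)
      ultimately show ?case by (simp only: step_simps r D s2_def)
    next
      case (2 t1 s2')
      then have t1: "t1 \<le> 1 + ?b + 2 * j" and s2': "s2' = s2" by auto
      show ?case
        unfolding s2'
      proof (rule wp_SeqI[OF step], goal_cases)
        case (1 t2 s3)
        then have t2: "t2 \<le> main_cost n j" and ag: "agree_off main_pass s2 s3"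
          and post: "\<And>g. holds (snd s' 1) 0 (2 ^ n) g \<Longrightarrow> holds (snd s3 1) 0 (2 ^ n) (butterflies ?p j g)"
          by (auto simp: s2_def)
        have r3: "fst s3 24 = 2 ^ (?p + j) * w" "fst s3 2 = 0"
          using agree_off_reg[OF ag, of 24] agree_off_reg[OF ag, of 2] readyD(2)[OF D(1)]
          by (simp_all add: s2_def)
        have "op_cost Add (2 ^ (?p + j) * w) 0 \<le> 1 + ?b"
          using pow[OF pj] unfolding op_cost.simps bits_0 by linarith
        from add_mono[OF t1 add_mono[OF t2 this]]
        have c: "t1 + (t2 + op_cost Add (2 ^ (?p + j) * w) 0) \<le> ?C"
          by (rule order_trans) simp
        have "holds (snd s3 1) 0 (2 ^ n) (butterflies ?m (Suc q * j) f)" if "holds (snd s 1) 0 (2 ^ n) f" for f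
        proof -
          have "holds (snd s3 1) 0 (2 ^ n) (butterflies ?p j (butterflies ?m (q * j) f))"
            using s'(1) that by (intro post) (simp add: I_def)
          moreover have "Suc q * j = q * j + j" by simp
          ultimately show ?thesis by (simp only: butterflies_add)
        qed
        then have "I (Suc q) ((fst s3)(23 := 2 ^ (?p + j) * w + 0), snd s3)"
          by (simp add: I_def algebra_simps)
        with c show ?case by (simp only: wp_simps r3 op_val.simps)
      qed
    qed
  next
    fix s' assume s': "I ?r s'" "agree_off high_step s1 s'"
    then show "\<not> fst s' 23 < fst s' 9"
      using R'[OF s'(2)] m(1) by (simp add: I_def usable_def params_def)
  next
    fix q s' assume q: "q \<le> ?r" and s': "I q s'" "agree_off high_step s1 s'"
    have r: "fst s' 23 = 2 ^ (?m + q * j) * w" "fst s' 9 = 2 ^ n * w"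
      using s'(1) R'[OF s'(2)] by (simp_all add: I_def usable_def params_def)
    show "1 + bits (fst s' 23) + bits (fst s' 9) \<le> 1 + 2 * ?b"
      unfolding r using add_mono[OF pow[OF qm[OF q]] pow[OF order_refl]] by simp
  qed
  have "?r * (?C + (1 + 2 * ?b)) + (1 + 2 * ?b) + (1 + ?b) = high_cost n j"
    by (simp add: high_cost_def algebra_simps)
  then have cost: "t1 + t2 \<le> high_cost n j"
    if "t1 \<le> 1 + ?b" "t2 \<le> ?r * (?C + (1 + 2 * ?b)) + (1 + 2 * ?b)" for t1 t2
    using that by linarith
  have D: "fst s 15 = 2 ^ ?m * w" "fst s 2 = 0"
    using u by (simp_all add: usable_def params_def ready_def)
  have "n - ?m = ?r * j" using m(1) by linarith
  show ?thesis
    unfolding high_def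
  proof (rule wp_SeqI[where ?Q1.0 = "\<lambda>t s'. t \<le> 1 + ?b \<and> s' = s1"], goal_cases)
    case 1
    have "op_cost Add (2 ^ ?m * w) 0 \<le> 1 + ?b"
      using pow[of ?m] m(1) unfolding op_cost.simps bits_0 by linarith
    then show ?case by (simp only: step_simps D s1_def add_0_right)
  next
    case (2 t1 s1')
    then have t1: "t1 \<le> 1 + ?b" and s1': "s1' = s1" by auto
    show ?case
      unfolding s1'
      by (rule wp_mono[OF loop])
        (use cost[OF t1] in \<open>auto simp: I_def \<open>n - ?m = ?r * j\<close>\<close>)
  qed
qed

section \<open>The whole program and its correctness\<close>

definition transform_program :: com where
  "transform_program =
     Seq constants (Seq find_digit_length (Seq compute_params (Seq fill (Seq low high))))"

definition total_cost :: "nat \<Rightarrow> nat" where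
  "total_cost n = (let j = digit_length n in
     14 + 34 * w + (j * (10 + 9 * n + 64 * w + j) + 1 + 5 * n + 32 * w) + params_cost n j +
     fill_cost j + low_cost n (low_levels n j) + high_cost n j)"

lemma wp_transform_program:
  assumes "fst s 0 = n"
  shows "wp transform_program (\<lambda>t s'. t \<le> total_cost n \<and>
    (\<forall>f. holds (snd s 0) 0 (2 ^ n) f \<longrightarrow> holds (snd s' 1) 0 (2 ^ n) (butterflies 0 n f))) s"
  unfolding transform_program_def
proof (rule wp_SeqI[OF wp_constants], goal_cases)
  case (1 t1 s1)
  let ?j = "digit_length n"
  let ?m = "low_levels n ?j"
  have j: "0 < ?j" by (simp add: digit_length_def)
  have m: "?m \<le> n" by (simp add: low_levels_def)
  show ?case
  proof (rule wp_SeqI[OF wp_find_digit_length[of s1 n]], goal_cases)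
    case (5 t2 s2)
    note 2 = this
    show ?case
    proof (rule wp_SeqI[OF wp_compute_params[of s2 n ?j]], goal_cases)
      case (4 t3 s3)
      note 3 = this
      then have P: "params n ?j s3" by simp
      note D = paramsD[OF P]
      show ?case
      proof (rule wp_SeqI[OF wp_frame[OF wp_fill[OF D(1,4,5,8,10)]]], goal_cases)
        case (1 t4 s4)
        then have P4: "params n ?j s4" and u4: "usable n ?j s4"
          using params_agree[OF P, of fill s4] by (auto simp: usable_def)
        have A0: "snd s4 0 = snd s 0"
          using 1 agree_off_arr[of fill s3 s4 0] 3 2 \<open>t1 \<le> _ \<and> _\<close> by simp
        note D = paramsD[OF P4]
        note fill = 1
        show ?case
        proof (rule wp_SeqI[OF wp_frame[OF wp_low[OF D(1,7,9) m]]], goal_cases)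
          case (1 t5 s5)
          then have u5: "usable n ?j s5"
            using usable_agree[OF u4, of low s5] by auto
          note low = 1
          show ?case
          proof (rule wp_mono[OF wp_high[OF u5 j]], intro conjI allI impI, goal_cases)
            case (1 t6 s6)
            then show ?case
              using low fill 3 2 \<open>t1 \<le> _ \<and> _\<close> by (simp add: total_cost_def Let_def)
          next
            case (2 t6 s6 f)
            have "holds (snd s6 1) 0 (2 ^ n) (butterflies (0 + ?m) (n - ?m) (butterflies 0 ?m f))"
              using 2 low A0 by simp
            then show ?case unfolding butterflies_add[symmetric] using m by simp
          qed
        qed
      qed
    qed (use 2 in simp_all)
  qed (use 1 assms in simp_all)
qed

lemma transform_program_correct:
  fixes v :: "'a vec"
  assumes v: "v \<in> carrier_vec (2 ^ n)"
  shows "\<exists>t s. exec transform_program (input_state enc w n v) t s \<and> t \<le> total_cost n \<and>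
    outputs enc w s (walsh_hadamard n *\<^sub>v v)"
proof -
  let ?s = "input_state enc w n v"
  define f where "f k = v $ k" for k
  have dim: "dim_vec v = 2 ^ n" using v by simp
  have "holds (snd ?s 0) 0 (2 ^ n) f"
    unfolding holds_def
  proof (intro allI impI)
    fix i t :: nat assume i: "i < 2 ^ n" and t: "t < w"
    have "(i * w + t) div w = i" "(i * w + t) mod w = t" using t by simp_all
    then show "snd ?s 0 (0 + i * w + t) = bit (enc (f i)) t"
      using field_index_less[OF i t] dim by (simp add: input_state_def f_def)
  qed
  moreover have "fst ?s 0 = n" by (simp add: input_state_def)
  ultimately obtain t s' where ex: "exec transform_program ?s t s'" "t \<le> total_cost n"
    and out: "holds (snd s' 1) 0 (2 ^ n) (butterflies 0 n f)"
    using wp_transform_program[of ?s n] unfolding wp_def by blast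
  have "dim_vec (walsh_hadamard n *\<^sub>v v) = 2 ^ n"
    by (simp add: walsh_hadamard_def)
  moreover have "(walsh_hadamard n *\<^sub>v v) $ i = butterflies 0 n f i" if "i < 2 ^ n" for i
    using v that by (rule walsh_hadamard_butterflies) (simp add: f_def)
  ultimately have "outputs enc w s' (walsh_hadamard n *\<^sub>v v)"
    using out by (simp add: outputs_def holds_def)
  then show ?thesis using ex by blast
qed

end

section \<open>The running time\<close>

text \<open>The quotient tends to 0, hence is bounded; rounding the bound up keeps the later
  estimates in the natural numbers.\<close>

lemma polynomial_le_exponential:
  assumes "1 < (a::nat)"
  shows "\<exists>c. \<forall>n. n ^ k \<le> c * a ^ n"
proof -
  have "(\<lambda>n. real n ^ k / real a ^ n) \<longlonglongrightarrow> 0"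
  proof -
    have "1 < real a" using assms by simp
    then show ?thesis by real_asymp
  qed
  then have "Bseq (\<lambda>n. real n ^ k / real a ^ n)" by (rule convergent_imp_Bseq[OF convergentI])
  then obtain B where B: "\<And>n. norm (real n ^ k / real a ^ n) \<le> B" by (auto simp: Bseq_def)
  have "n ^ k \<le> nat \<lceil>B\<rceil> * a ^ n" for n
  proof -
    have "0 < real a ^ n" using assms by simp
    moreover have "real n ^ k / real a ^ n \<le> real (nat \<lceil>B\<rceil>)"
      using B[of n] of_nat_ceiling[of B] by simp
    ultimately have "real n ^ k \<le> real (nat \<lceil>B\<rceil>) * real a ^ n" by (simp add: pos_divide_le_eq)
    then have "real (n ^ k) \<le> real (nat \<lceil>B\<rceil> * a ^ n)" by simp
    then show ?thesis by (simp only: of_nat_le_iff)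
  qed
  then show ?thesis by blast
qed

context encoding begin

text \<open>Collects the dependence of all constants below on the field and its encoding.\<close>

definition scale :: nat where
  "scale = 1 + overhead"

lemma w_le_scale: "w \<le> scale" by (simp add: scale_def overhead_def)

lemma scale_pos [simp]: "0 < scale" "Suc 0 \<le> scale" by (simp_all add: scale_def)

text \<open>If fields and addresses are both of order \<open>z\<close>, moving \<open>2 ^ j\<close>
  fields costs \<open>O(2 ^ j * z)\<close>; used with \<open>z\<close> of order \<open>2 ^ j\<close>
  in the scratch array and \<open>4 ^ j\<close> in the main array.\<close>

lemma copy_cost_le:
  assumes "1 + b \<le> c * z" "2 ^ e * w \<le> z"
  shows "copy_cost j e b \<le> (17 * c + 3) * (2 ^ j * z)"
proof -
  have "5 * (1 + b) \<le> 2 ^ j * (5 * (1 + b))" by simp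
  then have "copy_cost j e b \<le> 2 ^ j * (12 * (1 + b) + 3 * (2 ^ e * w)) + 2 ^ j * (5 * (1 + b))"
    unfolding copy_cost_def by linarith
  also have "\<dots> = 2 ^ j * (17 * (1 + b) + 3 * (2 ^ e * w))" by (simp add: algebra_simps)
  also have "\<dots> \<le> 2 ^ j * (17 * (c * z) + 3 * z)"
    using assms by (intro mult_le_mono2 add_mono) simp_all
  also have "\<dots> = (17 * c + 3) * (2 ^ j * z)" by (simp add: algebra_simps)
  finally show ?thesis .
qed

lemma digits_bound: "1 \<le> j \<Longrightarrow> 1 + (3 * j + overhead) \<le> 4 * (scale * j)"
proof -
  assume "1 \<le> j"
  then have "scale * 1 \<le> scale * j" "3 * (1 * j) \<le> 3 * (scale * j)" by (intro mult_le_mono2 mult_le_mono; simp)+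
  then show ?thesis using scale_def by linarith
qed

text \<open>Addresses of about \<open>3 * j\<close> bits are dominated by pieces of length of order
  \<open>2 ^ j\<close>, so each of the \<open>2 ^ j\<close> keys is gathered, looked up and
  scattered in time linear in its length.\<close>

lemma scratch_cost_le:
  assumes "1 \<le> j"
  shows "scratch_cost j \<le> 250 * (scale * 2 ^ (3 * j))"
proof -
  let ?J = "(2::nat) ^ j" and ?K = "(2::nat) ^ (2 * j)"
  have J: "j \<le> ?J" by (simp add: less_imp_le)
  have K: "?K = ?J * ?J" by (simp add: power_add mult_2)
  have JK: "?J \<le> ?K" "1 \<le> ?K" unfolding K by simp_all
  with J have "j \<le> ?K" by linarith
  have "scale * j \<le> scale * ?J" using J by (rule mult_le_mono2)
  then have b: "1 + (3 * j + overhead) \<le> 4 * (scale * ?J)" using digits_bound[OF assms] by linarith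
  have "?J * w \<le> scale * ?J" using w_le_scale by simp
  from copy_cost_le[OF b this, of j]
  have "copy_cost j j (3 * j + overhead) \<le> (17 * 4 + 3) * (?J * (scale * ?J))" .
  also have "\<dots> = 71 * (scale * ?K)" unfolding K by simp
  finally have c: "copy_cost j j (3 * j + overhead) \<le> 71 * (scale * ?K)" .
  have scale_ge: "x \<le> scale * x" for x by simp
  have "?K * w \<le> scale * ?K" using w_le_scale by simp
  moreover have "w \<le> ?K * w" by simp
  moreover have "j \<le> scale * ?K" "1 \<le> scale * ?K" using JK \<open>j \<le> ?K\<close> scale_ge[of ?K] by linarith+
  moreover have "3 * (2 * j + w) = 6 * j + 3 * w" by simp
  ultimately have l: "lookup_cost j \<le> 22 * (scale * ?K)"
    unfolding lookup_cost_def by linarith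
  have "scale * ?J \<le> scale * ?K" using JK by (intro mult_le_mono2)
  then have "20 * (1 + (3 * j + overhead)) \<le> 80 * (scale * ?K)"
    using b unfolding add_mult_distrib2 by linarith
  \<comment> \<open>\<open>250\<close> rounds up \<open>2 * 71 + 22 + 80\<close>.\<close>
  with c l have "2 * copy_cost j j (3 * j + overhead) + lookup_cost j + 20 * (1 + (3 * j + overhead)) \<le> 250 * (scale * ?K)"
    by linarith
  then have "scratch_cost j \<le> 2 ^ (3 * j - j - j) * (250 * (scale * ?K))"
    unfolding scratch_cost_def pass_cost_def by (rule mult_le_mono2)
  also have "3 * j - j - j = j" by simp
  also have "?J * (250 * (scale * ?K)) = 250 * (scale * (?J * ?K))" by simp
  also have "?J * ?K = 2 ^ (3 * j)" by (simp flip: power_add)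
  finally show ?thesis .
qed

text \<open>One pass over the vector is linear: the third assumption bounds the address length by a
  constant multiple of the word length.\<close>

lemma main_cost_le:
  assumes "1 \<le> j" "3 * j \<le> n" "n \<le> 8 * w * 2 ^ (2 * j)"
  shows "main_cost n j \<le> 750 * (scale * 2 ^ n)" "1 + (n + overhead) \<le> 9 * (scale * 2 ^ (2 * j))"
proof -
  let ?K = "(2::nat) ^ (2 * j)" and ?E = "(2::nat) ^ (3 * j)"
  have "8 * (w * ?K) \<le> 8 * (scale * ?K)" using w_le_scale by (intro mult_le_mono) simp_all
  moreover have "scale \<le> scale * ?K" by simp
  ultimately show b: "1 + (n + overhead) \<le> 9 * (scale * ?K)"
    using assms(3) scale_def by linarith
  have "?K * w \<le> scale * ?K" using w_le_scale by simp
  from copy_cost_le[OF b this, of j]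
  have "copy_cost j (2 * j) (n + overhead) \<le> (17 * 9 + 3) * (2 ^ j * (scale * ?K))" .
  also have "\<dots> = 156 * (scale * (2 ^ j * ?K))" by simp
  also have "2 ^ j * ?K = ?E" by (simp flip: power_add)
  finally have "copy_cost j (2 * j) (n + overhead) \<le> 156 * (scale * ?E)" .
  moreover have "?K \<le> ?E" by (intro power_increasing) simp_all
  then have "scale * ?K \<le> scale * ?E" by (rule mult_le_mono2)
  moreover note scratch_cost_le[OF assms(1)]
  ultimately have "2 * copy_cost j (2 * j) (n + overhead) + scratch_cost j + 20 * (1 + (n + overhead)) \<le> 750 * (scale * ?E)"
    using b unfolding add_mult_distrib2 by linarith
  then have "main_cost n j \<le> 2 ^ (n - j - 2 * j) * (750 * (scale * ?E))"
    unfolding main_cost_def pass_cost_def by (rule mult_le_mono2)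
  also have "\<dots> = 750 * (scale * (2 ^ (n - j - 2 * j) * ?E))" by simp
  also have "2 ^ (n - j - 2 * j) * ?E = 2 ^ n" using assms(2) by (simp flip: power_add)
  finally show "main_cost n j \<le> 750 * (scale * 2 ^ n)" .
qed

text \<open>The number of passes times \<open>j\<close> is at most \<open>n\<close>; multiplying by
  \<open>j\<close> replaces the division in the target bound.\<close>

lemma high_cost_le:
  assumes "1 \<le> j" "3 * j \<le> n" "n \<le> 8 * w * 2 ^ (2 * j)" "2 ^ (2 * j) \<le> n"
  shows "j * high_cost n j \<le> 850 * scale * (2 ^ n * n)"
proof -
  let ?K = "(2::nat) ^ (2 * j)"
  note m = main_cost_le[OF assms(1-3)]
  have n: "n \<le> 2 ^ n" by (simp add: less_imp_le)
  have "scale * ?K \<le> scale * 2 ^ n" using assms(4) n by (intro mult_le_mono2) linarith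
  moreover have "2 ^ n \<le> scale * 2 ^ n" by simp
  then have "j \<le> scale * 2 ^ n" using assms(2) n by linarith
  ultimately have "main_cost n j + 3 + 2 * j + 4 * (n + overhead) \<le> 788 * (scale * 2 ^ n)"
    using m unfolding add_mult_distrib2 by linarith
  then have 1: "(n - 2 * j) div j * j * (main_cost n j + 3 + 2 * j + 4 * (n + overhead)) \<le> n * (788 * (scale * 2 ^ n))"
    by (intro mult_le_mono) (auto intro: order_trans[OF div_times_less_eq_dividend])
  have "2 + 3 * (n + overhead) \<le> 27 * (scale * 2 ^ n)" using m(2) \<open>scale * ?K \<le> scale * 2 ^ n\<close>
    unfolding add_mult_distrib2 by linarith
  then have 2: "j * (2 + 3 * (n + overhead)) \<le> n * (27 * (scale * 2 ^ n))"
    using assms(2) by (intro mult_le_mono) simp_all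
  have "j * high_cost n j = (n - 2 * j) div j * j * (main_cost n j + 3 + 2 * j + 4 * (n + overhead)) +
      j * (2 + 3 * (n + overhead))"
    unfolding high_cost_def by (simp add: algebra_simps)
  also have "\<dots> \<le> n * (788 * (scale * 2 ^ n)) + n * (27 * (scale * 2 ^ n))" using 1 2 by (rule add_mono)
  also have "\<dots> = 815 * (scale * (2 ^ n * n))" by simp
  also have "\<dots> \<le> 850 * (scale * (2 ^ n * n))" by simp
  finally show ?thesis by (simp only: mult.assoc)
qed

lemma naive_cost_le:
  assumes "1 \<le> j" "k \<le> 3 * j" "m \<le> 3 * j"
  shows "naive_cost k m \<le> 7680 * (scale\<^sup>2 * j ^ 3 * 2 ^ m)"
proof -
  have "1 + m + overhead \<le> 4 * (scale * j)" using digits_bound[OF assms(1)] assms(3) by linarith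
  then have "(1 + m + overhead)\<^sup>2 \<le> (4 * (scale * j))\<^sup>2" by (rule power_mono) simp
  moreover have "k + 1 \<le> 4 * j" using assms by linarith
  ultimately have "naive_cost k m \<le> 4 * j * 2 ^ m * (120 * (4 * (scale * j))\<^sup>2)"
    unfolding naive_cost_def by (intro mult_le_mono) simp_all
  also have "\<dots> = 7680 * (scale\<^sup>2 * j ^ 3 * 2 ^ m)"
    by (simp add: power2_eq_square power3_eq_cube mult_ac)
  finally show ?thesis .
qed

lemma poly_ge:
  assumes "1 \<le> j"
  shows "scale \<le> scale\<^sup>2 * j ^ 3" "w \<le> scale\<^sup>2 * j ^ 3" "j \<le> scale\<^sup>2 * j ^ 3" "1 \<le> scale\<^sup>2 * j ^ 3"
proof -
  have "scale * 1 \<le> scale * scale * j ^ 3" using assms by (intro mult_le_mono) simp_all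
  then show 1: "scale \<le> scale\<^sup>2 * j ^ 3" by (simp add: power2_eq_square)
  then show "w \<le> scale\<^sup>2 * j ^ 3" using w_le_scale by linarith
  have "1 * j ^ 1 \<le> scale\<^sup>2 * j ^ 3" using assms by (intro mult_le_mono power_increasing) simp_all
  then show "j \<le> scale\<^sup>2 * j ^ 3" by simp
  then show "1 \<le> scale\<^sup>2 * j ^ 3" using assms by linarith
qed

text \<open>A block has at least \<open>4 ^ j\<close> entries, so the \<open>O(n)\<close> spent on
  addressing it in the main arrays disappears in the work on it; its at most \<open>3 * j\<close>
  levels give the cubic factor.\<close>

lemma low_cost_le:
  assumes "1 \<le> j" "3 * j \<le> n" "n \<le> 8 * w * 2 ^ (2 * j)"
  shows "low_cost n (low_levels n j) \<le> 8000 * (scale\<^sup>2 * j ^ 3) * 2 ^ n"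
proof -
  let ?m = "low_levels n j" and ?P = "scale\<^sup>2 * j ^ 3"
  have "(n - 2 * j) mod j < j" using assms by simp
  moreover have "(n - 2 * j) div j * j + (n - 2 * j) mod j = n - 2 * j" by simp
  ultimately have m: "?m \<le> 3 * j" "2 * j \<le> ?m" "?m \<le> n"
    unfolding low_levels_def using assms(2) by linarith+
  note P = poly_ge[OF assms(1)]
  have "1 + (n + overhead) \<le> 9 * (scale * 2 ^ (2 * j))" using main_cost_le(2)[OF assms] .
  also have "\<dots> \<le> 9 * (?P * 2 ^ ?m)" using P m by (intro mult_le_mono power_increasing) simp_all
  finally have "10 * (1 + n + overhead) \<le> 90 * (?P * 2 ^ ?m)" by simp
  moreover have "2 ^ ?m * w \<le> ?P * 2 ^ ?m" using P by simp
  moreover have "naive_cost ?m ?m \<le> 7680 * (?P * 2 ^ ?m)" using naive_cost_le[OF assms(1) m(1,1)] .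
  ultimately have "naive_cost ?m ?m + 10 * (2 ^ ?m * w) + 10 * (1 + n + overhead) \<le> 8000 * (?P * 2 ^ ?m)"
    by linarith
  then have "low_cost n ?m \<le> 2 ^ (n - ?m) * (8000 * (?P * 2 ^ ?m))"
    unfolding low_cost_def by (rule mult_le_mono2)
  also have "\<dots> = 8000 * ?P * (2 ^ (n - ?m) * 2 ^ ?m)" by simp
  also have "2 ^ (n - ?m) * 2 ^ ?m = (2::nat) ^ n" using m by (simp flip: power_add)
  finally show ?thesis .
qed

lemma fill_cost_le:
  assumes "1 \<le> j"
  shows "fill_cost j \<le> 8000 * (scale\<^sup>2 * j ^ 3) * (2 ^ (2 ^ (2 * j) * w) * 2 ^ (2 * j))"
proof -
  let ?K = "(2::nat) ^ (2 * j)" and ?P = "scale\<^sup>2 * j ^ 3"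
  let ?Z = "(2::nat) ^ (?K * w)"
  note P = poly_ge[OF assms]
  have PK: "x \<le> ?P * ?K" if "x \<le> ?P" for x
    using mult_le_mono[OF that, of 1 ?K] by simp
  have "?K * w \<le> ?P * ?K" using P by simp
  moreover have "naive_cost j (2 * j) \<le> 7680 * (?P * ?K)" by (rule naive_cost_le[OF assms]) simp_all
  moreover have "3 * (2 * j + w) = 6 * j + 3 * w" by simp
  moreover note PK[OF P(2)] PK[OF P(3)] PK[OF P(4)]
  ultimately have 1: "naive_cost j (2 * j) + 13 * (?K * w) + 3 * (2 * j + w) + 9 \<le> 7711 * (?P * ?K)"
    and 2: "2 * (?K * w) + 4 \<le> 6 * (?P * ?K)"
    by linarith+
  have "6 * (?P * ?K) \<le> ?Z * (6 * (?P * ?K))" by simp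
  with 2 have "2 * (?K * w) + 4 \<le> ?Z * (6 * (?P * ?K))" by (rule order_trans)
  moreover have "?Z * (naive_cost j (2 * j) + 13 * (?K * w) + 3 * (2 * j + w) + 9) \<le> ?Z * (7711 * (?P * ?K))"
    using 1 by (rule mult_le_mono2)
  ultimately have "fill_cost j \<le> ?Z * (7711 * (?P * ?K)) + ?Z * (6 * (?P * ?K))"
    unfolding fill_cost_def by linarith
  also have "\<dots> = 7717 * ?P * (?Z * ?K)" by (simp add: algebra_simps)
  also have "\<dots> \<le> 8000 * ?P * (?Z * ?K)" by (intro mult_le_mono1) simp
  finally show ?thesis .
qed

text \<open>Multiplied by \<open>digit_length n\<close> to stay within natural numbers. The
  threshold \<open>32 * w\<close> excludes \<open>digit_length n = 1\<close>, where minimality says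
  nothing.\<close>

lemma total_cost_le:
  "\<exists>c. \<forall>n>32 * w. digit_length n * total_cost n \<le> c * (2 ^ n * n)"
proof -
  obtain c4 :: nat where c4: "\<And>j. j ^ 4 \<le> c4 * 4 ^ j"
    using polynomial_le_exponential[of 4 4] by auto
  obtain c2 :: nat where c2: "\<And>n. n ^ 2 \<le> c2 * 2 ^ n"
    using polynomial_le_exponential[of 2 2] by auto
  let ?c = "3400 * c2 + 64000 * (scale\<^sup>2 * c4) + 8000 * (scale\<^sup>2 * c4) + 850 * scale"
  have "digit_length n * total_cost n \<le> ?c * (2 ^ n * n)" if n: "32 * w < n" for n
  proof -
    define j where "j = digit_length n"
    let ?K = "(2::nat) ^ (2 * j)"
    have K4: "?K = 4 ^ j" by (simp add: power_mult)
    have j: "1 \<le> j" by (simp add: j_def digit_length_def)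
    have nK: "n \<le> 8 * w * ?K" using le_digit_length[of n] unfolding j_def[symmetric] K4 .
    have j2: "2 \<le> j"
    proof (rule ccontr)
      assume "\<not> 2 \<le> j"
      then have "j = 1" using j by simp
      then show False using nK n by (simp add: power2_eq_square)
    qed
    have Kn: "2 * (?K * w) < n"
    proof -
      have "32 * w * 4 ^ (j - 2) < n" using j2 by (intro digit_length_less) (simp add: j_def)
      moreover have "?K = 16 * 4 ^ (j - 2)"
      proof -
        have "(4::nat) ^ j = 4 ^ (2 + (j - 2))"
          by (rule arg_cong[of _ _ "(^) 4"]) (use j2 in simp)
        also have "\<dots> = 16 * 4 ^ (j - 2)" by (simp only: power_add) simp
        finally show ?thesis unfolding K4 .
      qed
      ultimately show ?thesis by (simp add: mult_ac)
    qed
    have "?K \<le> ?K * w" using w_pos by simp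
    then have Kn': "?K \<le> n" using Kn by linarith
    have "3 * i \<le> (4::nat) ^ i" for i
    proof (induction i)
      case (Suc i)
      have "1 \<le> (4::nat) ^ i" by simp
      then show ?case using Suc unfolding power_Suc mult_Suc_right by linarith
    qed simp
    then have j3: "3 * j \<le> n" using Kn' unfolding K4 by (rule order_trans)
    \<comment> \<open>Three factors come from the naive levels, the fourth is the multiplier;
      \<open>4 ^ j \<le> n\<close> then pays for all of them.\<close>
    have "j * j ^ 3 \<le> c4 * ?K" using c4[of j] by (simp add: K4 power_Suc[symmetric])
    also have "\<dots> \<le> c4 * n" using Kn' by (rule mult_le_mono2)
    finally have j4n: "j * j ^ 3 \<le> c4 * n" .
    have w: "w \<le> n" "j \<le> n" "1 \<le> n" using n j3 j w_pos by linarith+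
    have sq: "n * n \<le> c2 * 2 ^ n" using c2[of n] by (simp add: power2_eq_square)
    have P: "params_cost n j \<le> 3159 * (n * n)"
    proof -
      have "1 + (n + 4 * j + 2 * w + ?K * w) \<le> 9 * n" using w Kn by linarith
      then have "(1 + (n + 4 * j + 2 * w + ?K * w))\<^sup>2 \<le> (9 * n)\<^sup>2" by (rule power_mono) simp
      then show ?thesis by (simp add: params_cost_def power2_eq_square)
    qed
    have S: "14 + 34 * w + (j * (10 + 9 * n + 64 * w + j) + 1 + 5 * n + 32 * w) \<le> 170 * (n * n)"
    proof -
      have "10 + 9 * n + 64 * w + j \<le> 84 * n" using w by linarith
      then have "j * (10 + 9 * n + 64 * w + j) \<le> n * (84 * n)" using w by (intro mult_le_mono)
      moreover have "n \<le> n * n" using w by simp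
      ultimately show ?thesis using w by linarith
    qed
    have 1: "j * (14 + 34 * w + (j * (10 + 9 * n + 64 * w + j) + 1 + 5 * n + 32 * w) + params_cost n j)
        \<le> 3400 * c2 * (2 ^ n * n)"
    proof -
      have "14 + 34 * w + (j * (10 + 9 * n + 64 * w + j) + 1 + 5 * n + 32 * w) + params_cost n j \<le> 3400 * (n * n)"
        using P S by linarith
      also have "\<dots> \<le> 3400 * (c2 * 2 ^ n)" using sq by simp
      finally have "j * (14 + 34 * w + (j * (10 + 9 * n + 64 * w + j) + 1 + 5 * n + 32 * w) + params_cost n j)
        \<le> n * (3400 * (c2 * 2 ^ n))" using w by (intro mult_le_mono)
      then show ?thesis by (simp add: mult_ac)
    qed
    have 2: "j * fill_cost j \<le> 64000 * (scale\<^sup>2 * c4) * (2 ^ n * n)"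
    proof -
      \<comment> \<open>A spare factor \<open>n\<close> is absorbed by a second copy of
        \<open>2 ^ (?K * w)\<close>; the product of both copies stays below \<open>2 ^ n\<close>
        because keys have fewer than \<open>n / 2\<close> bits.\<close>
      have "n \<le> 8 * (?K * w)" using nK by (simp add: mult_ac)
      also have "\<dots> \<le> 8 * 2 ^ (?K * w)" by (simp add: less_imp_le)
      finally have "n * 2 ^ (?K * w) \<le> 8 * 2 ^ (?K * w) * 2 ^ (?K * w)" by (rule mult_le_mono1)
      also have "\<dots> = 8 * 2 ^ (2 * (?K * w))" by (simp only: mult_2 power_add mult.assoc)
      also have "\<dots> \<le> 8 * 2 ^ n" using Kn by (intro mult_le_mono2 power_increasing) simp_all
      finally have Z: "n * 2 ^ (?K * w) \<le> 8 * 2 ^ n" .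
      have "j * fill_cost j \<le> j * (8000 * (scale\<^sup>2 * j ^ 3) * (2 ^ (?K * w) * ?K))"
        using fill_cost_le[OF j] by (rule mult_le_mono2)
      also have "\<dots> = 8000 * scale\<^sup>2 * (j * j ^ 3) * (2 ^ (?K * w) * ?K)" by (simp only: mult_ac)
      also have "\<dots> \<le> 8000 * scale\<^sup>2 * (c4 * n) * (2 ^ (?K * w) * n)"
        by (rule mult_le_mono[OF mult_le_mono2[OF j4n] mult_le_mono2[OF Kn']])
      also have "\<dots> = 8000 * scale\<^sup>2 * c4 * n * (n * 2 ^ (?K * w))" by (simp only: mult_ac)
      also have "\<dots> \<le> 8000 * scale\<^sup>2 * c4 * n * (8 * 2 ^ n)" using Z by (rule mult_le_mono2)
      also have "\<dots> = 64000 * (scale\<^sup>2 * c4) * (2 ^ n * n)" by simp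
      finally show ?thesis .
    qed
    have 3: "j * low_cost n (low_levels n j) \<le> 8000 * (scale\<^sup>2 * c4) * (2 ^ n * n)"
    proof -
      have "j * low_cost n (low_levels n j) \<le> j * (8000 * (scale\<^sup>2 * j ^ 3) * 2 ^ n)"
        using low_cost_le[OF j j3 nK] by (rule mult_le_mono2)
      also have "\<dots> = 8000 * scale\<^sup>2 * (j * j ^ 3) * 2 ^ n" by (simp only: mult_ac)
      also have "\<dots> \<le> 8000 * scale\<^sup>2 * (c4 * n) * 2 ^ n"
        by (rule mult_le_mono1[OF mult_le_mono2[OF j4n]])
      also have "\<dots> = 8000 * (scale\<^sup>2 * c4) * (2 ^ n * n)" by (simp only: mult_ac)
      finally show ?thesis .
    qed
    have 4: "j * high_cost n j \<le> 850 * scale * (2 ^ n * n)"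
      by (rule high_cost_le[OF j j3 nK Kn'])
    have "j * total_cost n =
      j * (14 + 34 * w + (j * (10 + 9 * n + 64 * w + j) + 1 + 5 * n + 32 * w) + params_cost n j) +
      j * fill_cost j + j * low_cost n (low_levels n j) + j * high_cost n j"
      unfolding total_cost_def Let_def j_def[symmetric] by (simp only: distrib_left)
    also have "\<dots> \<le> 3400 * c2 * (2 ^ n * n) + 64000 * (scale\<^sup>2 * c4) * (2 ^ n * n) +
      8000 * (scale\<^sup>2 * c4) * (2 ^ n * n) + 850 * scale * (2 ^ n * n)"
      using 1 2 3 4 by (intro add_mono)
    also have "\<dots> = ?c * (2 ^ n * n)" by (simp only: distrib_right)
    finally show ?thesis unfolding j_def .
  qed
  then show ?thesis by blast
qed

text \<open>Taking logarithms in \<open>le_digit_length\<close> with \<open>w \<le> 2 ^ w\<close>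
  gives \<open>3 + w + 2 * j\<close>, and \<open>1 \<le> j\<close> absorbs the constant.\<close>

lemma log_le_digit_length:
  assumes "1 \<le> n"
  shows "log 2 n \<le> (5 + w) * digit_length n"
proof -
  let ?j = "digit_length n"
  have "n \<le> 8 * w * 4 ^ ?j" by (rule le_digit_length)
  also have "\<dots> \<le> 8 * 2 ^ w * 4 ^ ?j" by (simp add: less_imp_le)
  also have "\<dots> = 2 ^ (3 + w + 2 * ?j)" by (simp add: power_add power_mult)
  finally have "real n \<le> real (2 ^ (3 + w + 2 * ?j))" by (simp only: of_nat_le_iff)
  then have "log 2 n \<le> log 2 (real (2 ^ (3 + w + 2 * ?j)))"
    using assms by (subst log_le_cancel_iff) simp_all
  also have "\<dots> = real (3 + w + 2 * ?j)"
    unfolding of_nat_power by (subst log_nat_power) simp_all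
  also have "3 + w + 2 * ?j \<le> (5 + w) * ?j"
  proof -
    have "(3 + w) * 1 \<le> (3 + w) * ?j" by (intro mult_le_mono2) (simp add: digit_length_def)
    then show ?thesis by (simp add: algebra_simps)
  qed
  then have "real (3 + w + 2 * ?j) \<le> real ((5 + w) * ?j)" by (simp only: of_nat_le_iff)
  finally show ?thesis by simp
qed

lemma total_cost_bigo:
  "(\<lambda>n. real (total_cost n)) \<in> O(\<lambda>n. 2 ^ n * log 2 (2 ^ n) / log 2 (log 2 (2 ^ n)))"
proof -
  obtain c where c: "\<And>n. 32 * w < n \<Longrightarrow> digit_length n * total_cost n \<le> c * (2 ^ n * n)"
    using total_cost_le by blast
  show ?thesis
  proof (rule bigoI)
    show "\<forall>\<^sub>F n in sequentially. norm (real (total_cost n)) \<le>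
      real (c * (5 + w)) * norm (2 ^ n * log 2 (2 ^ n) / log 2 (log 2 (2 ^ n)))"
      using eventually_gt_at_top[of "32 * w"] eventually_gt_at_top[of 1]
    proof eventually_elim
      case (elim n)
      let ?j = "real (digit_length n)"
      have log: "0 < log 2 n" using elim by simp
      have j: "0 < ?j" by (simp add: digit_length_def)
      have "real (digit_length n * total_cost n) \<le> real (c * (2 ^ n * n))"
        using c[OF elim(1)] by (simp only: of_nat_le_iff)
      then have "?j * real (total_cost n) \<le> real c * (2 ^ n * n)" by simp
      have "real (total_cost n) * log 2 n \<le> real (total_cost n) * ((5 + w) * ?j)"
        using log_le_digit_length[of n] elim by (intro mult_left_mono) simp_all
      also have "\<dots> = (5 + w) * (?j * real (total_cost n))" by simp
      also have "\<dots> \<le> (5 + w) * (real c * (2 ^ n * n))"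
        using \<open>?j * real (total_cost n) \<le> _\<close> by (intro mult_left_mono) simp_all
      finally have "real (total_cost n) \<le> (5 + w) * (real c * (2 ^ n * n)) / log 2 n"
        using log by (simp add: pos_le_divide_eq)
      also have "\<dots> = real (c * (5 + w)) * (2 ^ n * n / log 2 n)" by simp
      finally show ?case using log by simp
    qed
  qed
qed

end

theorem theorem3p2:
  fixes enc :: "'a::{field, finite} \<Rightarrow> nat" and w :: nat
  assumes "inj enc" and "\<And>x. enc x < 2 ^ w"
  shows "\<exists>(P :: com) (T :: nat \<Rightarrow> nat).
     (\<forall>n \<ge> 1. \<forall>v \<in> carrier_vec (2 ^ n). \<exists>t s.
        exec P (input_state enc w n v) t s \<and> t \<le> T n \<and>
        outputs enc w s (walsh_hadamard n *\<^sub>v v)) \<and>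
     (\<lambda>n. real (T n)) \<in> O(\<lambda>n. 2 ^ n * log 2 (2 ^ n) / log 2 (log 2 (2 ^ n)))"
proof -
  interpret encoding enc w using assms by unfold_locales
  show ?thesis using transform_program_correct total_cost_bigo by blast
qed

end
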